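(* Let $\mathbf{k}$ be a field of characteristic $0$, $\lambda\in\mathbf{k}$ and $V$ a graded $\mathbf{k}$-vector space. Giving a homotopy Rota-Baxter Lie algebra structure of weight $\lambda$ on $V$ is equivalent to giving a Maurer-Cartan element in the $L_\infty$-algebra $\mathfrak{C}_{\mathrm{RBL}_\lambda}(V)$. In particular, when $V$ is concentrated in degree $0$, a Maurer-Cartan element in $\mathfrak{C}_{\mathrm{RBL}_\lambda}(V)$ gives a Rota-Baxter Lie algebra structure of weight $\lambda$ on $V$.
   Context: Homological grading, Koszul sign rule; $(sV)_p=V_{p-1}$; $S^n$ is the graded symmetric power. $\varepsilon(\sigma;x_1,\dots,x_n)$ is the Koszul sign, $\chi=\mathrm{sgn}(\sigma)\varepsilon$, $r_\sigma(x_1\otimes\cdots\otimes x_n)=\varepsilon(\sigma;x_1,\dots,x_n)\,x_{\sigma(1)}\otimes\cdots\otimes x_{\sigma(n)}$. $\mathrm{sh}(n_1,\dots,n_p)$ denotes the permutations increasing on each of the consecutive blocks of sizes $n_1,\dots,n_p$. **Rota-Baxter Lie algebra of weight $\lambda$:** a Lie algebra with a linear map $T$ satisfying $[T(a),T(b)]=T([a,T(b)]+[T(a),b]+\lambda[a,b])$. **Homotopy Rota-Baxter Lie algebra structure of weight $\lambda$ on $V$:** graded maps $\ell_n:V^{\otimes n}\to V$, $|\ell_n|=n-2$, and $T_n:V^{\otimes n}\to V$, $|T_n|=n-1$ ($n\ge1$), graded anti-symmetric in the sense $\ell_n(v_1\otimes\cdots\otimes v_n)=\chi(\sigma;v_1,\dots,v_n)\ell_n(v_{\sigma(1)}\otimes\cdots\otimes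 v_{\sigma(n)})$ and likewise for $T_n$, such that for all $n\ge1$ $$\sum_{i=1}^n\sum_{\sigma\in\mathrm{sh}(i,n-i)}\mathrm{sgn}(\sigma)(-1)^{i(n-i)}\ell_{n-i+1}(\ell_i\otimes\mathrm{id}^{\otimes n-i})r_\sigma=0$$ and $$\sum_{k=1}^n\sum_{\substack{r_1+\cdots+r_k=n\\ r_j\ge1}}\ \sum_{\substack{\sigma\in\mathrm{sh}(r_1,\dots,r_k)\\ \sigma(1)<\sigma(r_1+1)<\cdots<\sigma(r_1+\cdots+r_{k-1}+1)}}(-1)^{\delta+1}\mathrm{sgn}(\sigma)\,\ell_k(T_{r_1}\otimes\cdots\otimes T_{r_k})r_\sigma$$ $$=\sum_{1\le q\le p}\ \sum_{\substack{r_1+\cdots+r_q+p-q=n\\ r_j\ge1}}\ \sum_{\substack{\sigma\in\mathrm{sh}(r_2,\dots,r_q,p-q+1,r_1-1)\\ \sigma(1)<\sigma(r_2+1)<\cdots<\sigma(r_2+\cdots+r_{q-1}+1)}}\lambda^{p-q}(-1)^\eta\mathrm{sgn}(\sigma)\,T_{r_1}\big(\ell_p(T_{r_2}\otimes\cdots\otimes T_{r_q}\otimes\mathrm{id}^{\otimes p-q+1})\otimes\mathrm{id}^{\otimes r_1-1}\big)r_\sigma,$$ where $\delta=1+\sum_{j=1}^k(k-j)(r_j-1)$ and $\eta=\big(p+\sum_{j=2}^q(r_j-1)\big)(r_1-1)+\sum_{j=2}^q(r_j-1)(p-j+1)$. (Equivalently: a differential $\ell_1=d_V$ on $V$ together with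 a morphism of symmetric dg operads to $\mathrm{End}_{(V,d_V)}$ from the minimal model of the operad of Rota-Baxter Lie algebras of weight $\lambda$, which is free on generators $\ell_n$, $n\ge2$, and $T_n$, $n\ge1$.) **$L_\infty$-algebra:** a graded space $L$ with maps $l_n:L^{\otimes n}\to L$ of degree $n-2$, with $l_n(x_{\sigma(1)}\otimes\cdots\otimes x_{\sigma(n)})=\chi(\sigma;x_1,\dots,x_n)l_n(x_1\otimes\cdots\otimes x_n)$ and $\sum_{i=1}^n\sum_{\sigma\in\mathrm{sh}(i,n-i)}\chi(\sigma;x_1,\dots,x_n)(-1)^{i(n-i)}l_{n-i+1}(l_i(x_{\sigma(1)}\otimes\cdots\otimes x_{\sigma(i)})\otimes x_{\sigma(i+1)}\otimes\cdots\otimes x_{\sigma(n)})=0$. A Maurer-Cartan element is $\alpha\in L_{-1}$ with $\sum_{n\ge1}\frac1{n!}(-1)^{n(n-1)/2}l_n(\alpha^{\otimes n})=0$. **The $L_\infty$-algebra $\mathfrak{C}_{\mathrm{RBL}_\lambda}(V)$.** Put $\mathfrak{C}_{\mathrm{Lie}}(V)=\prod_{n\ge1}\mathrm{Hom}(S^n(sV),sV)$, $\mathfrak{C}_{\mathrm{RBLO}_\lambda}(V)=\prod_{n\ge1}\mathrm{Hom}(S^n(sV),V)$, $\mathfrak{C}_{\mathrm{RBL}_\lambda}(V)=\mathfrak{C}_{\mathrm{Lie}}(V)\oplus\mathfrak{C}_{\mathrm{RBLO}_\lambda}(V)$. Elements of $\mathfrak{C}_{\mathrm{Lie}}(V)$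 are written $sh$ with $h$ valued in $V$ (so $|sh|=|h|+1$); for $g\in\mathfrak{C}_{\mathrm{RBLO}_\lambda}(V)$, $sg$ is valued in $sV$. For $f\in\mathrm{Hom}(S^n(sV),sV)$, $g_i\in\mathrm{Hom}(S^{m_i}(sV),sV)$, $0\le k\le n$, $f\{g_1,\dots,g_k\}=\sum_\sigma f\circ(g_1\otimes\cdots\otimes g_k\otimes\mathrm{id}^{\otimes n-k})\circ r_\sigma$ over $\sigma\in\mathrm{sh}(m_1,\dots,m_k,n-k)$ with $\sigma(1)<\sigma(m_1+1)<\cdots<\sigma(m_1+\cdots+m_{k-1}+1)$ ($f\{\}=f$). The operations are: (I) $l_2(sf\otimes sh)=sf\{sh\}-(-1)^{|sf||sh|}sh\{sf\}$ on $\mathfrak{C}_{\mathrm{Lie}}(V)$. (II)(i) for $n\ge1$, $sh\in\mathrm{Hom}(S^n(sV),sV)$, $g_1,\dots,g_n\in\mathfrak{C}_{\mathrm{RBLO}_\lambda}(V)$: $l_{n+1}(sh\otimes g_1\otimes\cdots\otimes g_n)=\sum_{\sigma\in S_n}(-1)^{\eta'}\big(s^{-1}(sh)\{sg_{\sigma(1)},\dots,sg_{\sigma(n)}\}-(-1)^{(|g_{\sigma(1)}|+1)(|h|+1)}s^{-1}(sg_{\sigma(1)})\{sh\{sg_{\sigma(2)},\dots,sg_{\sigma(n)}\}\}\big)$, with $(-1)^{\eta'}=\chi(\sigma;g_1,\dots,g_n)(-1)^{n(|h|+1)+\sum_{k=1}^{n-1}\sum_{j=1}^k|g_{\sigma(j)}|}$.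 (II)(ii) for $n\ge2$, $sh\in\mathrm{Hom}(S^n(sV),sV)$, $1\le m\le n-1$: $l_{m+1}(sh\otimes g_1\otimes\cdots\otimes g_m)=\sum_{\sigma\in S_m}(-1)^\xi\lambda^{n-m}s^{-1}(sg_{\sigma(1)})\{sh\{sg_{\sigma(2)},\dots,sg_{\sigma(m)}\}\}$, with $(-1)^\xi=\chi(\sigma;g_1,\dots,g_m)(-1)^{1+m(|h|+1)+\sum_{k=1}^{m-1}\sum_{j=1}^k|g_{\sigma(j)}|+(|h|+1)(|g_{\sigma(1)}|+1)}$. (III) for $1\le k\le m\le n$: $l_{m+1}(g_1\otimes\cdots\otimes g_k\otimes sh\otimes g_{k+1}\otimes\cdots\otimes g_m)=(-1)^{(|h|+1)\sum_{j=1}^k|g_j|+k}l_{m+1}(sh\otimes g_1\otimes\cdots\otimes g_m)$. (IV) All other components vanish. *)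

theory Defs
  imports
    Complex_Main
    "HOL-Combinatorics.Permutations"
    "HOL-Library.Function_Algebras"
    "HOL-Library.Product_Plus"
begin

section \<open>Graded vector spaces and graded multilinear maps\<close>

text \<open>
  A graded vector space is a family of vector spaces indexed by the integers, realised as subspaces
  \<open>V p\<close> of one ambient vector space. The \<open>V p\<close> are not required to be independent: homogeneous
  elements always carry their degree, as pairs \<open>(p, v)\<close> with \<open>v \<in> V p\<close>.
\<close>

locale graded_vector_space = vector_space scale
  for scale :: "'k::field_char_0 \<Rightarrow> 'v::ab_group_add \<Rightarrow> 'v" +
  fixes V :: "int \<Rightarrow> 'v set"
  assumes subspace_component: "subspace (V p)"

type_synonym 'v elt = "int \<times> 'v"
type_synonym 'v mmap = "'v elt list \<Rightarrow> 'v"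

text \<open>
  The suspension \<open>s : V \<rightarrow> sV\<close> is the identity on underlying vectors and raises the degree by one.
  Hence composing a map with \<open>s\<close> or \<open>s\<inverse>\<close> on the output side leaves the underlying function
  unchanged.
\<close>

definition susp :: "(int \<Rightarrow> 'v set) \<Rightarrow> int \<Rightarrow> 'v set" where
  "susp V p = V (p - 1)"

abbreviation total_degree :: "(int \<times> 'a) list \<Rightarrow> int" where
  "total_degree xs \<equiv> sum_list (map fst xs)"

definition homogeneous :: "(int \<Rightarrow> 'v set) \<Rightarrow> nat \<Rightarrow> 'v elt list \<Rightarrow> bool" where
  "homogeneous V n xs \<longleftrightarrow> length xs = n \<and> (\<forall>(p, v) \<in> set xs. v \<in> V p)"

text \<open>
  Linear maps \<open>V\<^sup>\<otimes>\<^sup>n \<rightarrow> W\<close> of degree \<open>d\<close>, given by their values on tensors of homogeneous vectors.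
  They are extended by \<open>0\<close> to all other lists, so that equal maps are equal functions.
\<close>

definition graded_hom ::
  "('k \<Rightarrow> 'v::ab_group_add \<Rightarrow> 'v) \<Rightarrow> (int \<Rightarrow> 'v set) \<Rightarrow> (int \<Rightarrow> 'v set) \<Rightarrow> nat \<Rightarrow> int \<Rightarrow> 'v mmap set" where
  "graded_hom scale V W n d = {f.
     (\<forall>xs. \<not> homogeneous V n xs \<longrightarrow> f xs = 0) \<and>
     (\<forall>xs. homogeneous V n xs \<longrightarrow> f xs \<in> W (d + total_degree xs)) \<and>
     (\<forall>xs i. homogeneous V n xs \<and> i < n \<longrightarrow>
        (let p = fst (xs ! i) in
          (\<forall>u \<in> V p. \<forall>w \<in> V p.
             f (xs[i := (p, u + w)]) = f (xs[i := (p, u)]) + f (xs[i := (p, w)])) \<and>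
          (\<forall>c. \<forall>u \<in> V p. f (xs[i := (p, scale c u)]) = scale c (f (xs[i := (p, u)])))))}"

section \<open>Koszul signs\<close>

text \<open>Permutations act on \<open>{..<n}\<close>: all positions are counted from \<open>0\<close>.\<close>

definition koszul_sign :: "(nat \<Rightarrow> nat) \<Rightarrow> int list \<Rightarrow> 'k::field" where
  "koszul_sign \<sigma> ds =
     (\<Prod>(i, j) \<in> {(i, j). i < j \<and> j < length ds \<and> \<sigma> j < \<sigma> i}. (-1) powi (ds ! \<sigma> i * ds ! \<sigma> j))"

definition chi_sign :: "(nat \<Rightarrow> nat) \<Rightarrow> int list \<Rightarrow> 'k::field" where
  "chi_sign \<sigma> ds = of_int (sign \<sigma>) * koszul_sign \<sigma> ds"

text \<open>\<open>f \<circ> r\<^sub>\<sigma>\<close>\<close>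

definition comp_perm :: "('k::field \<Rightarrow> 'v \<Rightarrow> 'v) \<Rightarrow> 'v mmap \<Rightarrow> (nat \<Rightarrow> nat) \<Rightarrow> 'v mmap" where
  "comp_perm scale f \<sigma> xs = scale (koszul_sign \<sigma> (map fst xs)) (f (permute_list \<sigma> xs))"

text \<open>
  A tensor factor \<open>(m, d, f)\<close> is a map \<open>f\<close> of arity \<open>m\<close> and degree \<open>d\<close>. A tensor product
  \<open>f\<^sub>1 \<otimes> \<dots> \<otimes> f\<^sub>k\<close> of such maps is evaluated by the Koszul rule
  \<open>(f \<otimes> g) (x \<otimes> y) = (-1)\<^bsup>|g| |x|\<^esup> f x \<otimes> g y\<close>; sign and resulting tensor are computed separately.
\<close>

type_synonym 'v factor = "nat \<times> int \<times> 'v mmap"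

fun tensor_sign :: "'v factor list \<Rightarrow> 'v elt list \<Rightarrow> 'k::field" where
  "tensor_sign [] xs = 1"
| "tensor_sign ((m, d, f) # fs) xs =
     (-1) powi (sum_list (map (\<lambda>(_, e, _). e) fs) * total_degree (take m xs))
       * tensor_sign fs (drop m xs)"

fun tensor_values :: "'v factor list \<Rightarrow> 'v elt list \<Rightarrow> 'v elt list" where
  "tensor_values [] xs = []"
| "tensor_values ((m, d, f) # fs) xs =
     (d + total_degree (take m xs), f (take m xs)) # tensor_values fs (drop m xs)"

definition comp_tensor ::
  "('k::field \<Rightarrow> 'v::zero \<Rightarrow> 'v) \<Rightarrow> 'v mmap \<Rightarrow> 'v factor list \<Rightarrow> 'v mmap" where
  "comp_tensor scale f fs xs =
     (if length xs = sum_list (map fst fs)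
      then scale (tensor_sign fs xs) (f (tensor_values fs xs)) else 0)"

definition id_factor :: "'v factor" where
  "id_factor = (1, 0, \<lambda>xs. snd (hd xs))"

definition susp_factor :: "'v factor" where
  "susp_factor = (1, 1, \<lambda>xs. snd (hd xs))"

section \<open>Shuffles\<close>

definition block_start :: "nat list \<Rightarrow> nat \<Rightarrow> nat" where
  "block_start ns j = sum_list (take j ns)"

definition shuffles_of :: "nat list \<Rightarrow> (nat \<Rightarrow> nat) set" where
  "shuffles_of ns = {\<sigma>. \<sigma> permutes {..<sum_list ns} \<and>
     (\<forall>j < length ns. strict_mono_on {block_start ns j ..< block_start ns (Suc j)} \<sigma>)}"

text \<open>Shuffles for which moreover the images of the starting points of the first \<open>k\<close> blocks increase.\<close>

definition ordered_shuffles :: "nat \<Rightarrow> nat list \<Rightarrow> (nat \<Rightarrow> nat) set" where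
  "ordered_shuffles k ns = {\<sigma> \<in> shuffles_of ns.
     \<forall>i j. i < j \<and> j < k \<longrightarrow> \<sigma> (block_start ns i) < \<sigma> (block_start ns j)}"

definition compositions :: "nat \<Rightarrow> nat \<Rightarrow> nat list set" where
  "compositions k n = {rs. length rs = k \<and> (\<forall>r \<in> set rs. 1 \<le> r) \<and> sum_list rs = n}"

section \<open>Rota-Baxter Lie algebras and their homotopy version\<close>

definition Lie_algebra_on ::
  "('k::field \<Rightarrow> 'v::ab_group_add \<Rightarrow> 'v) \<Rightarrow> 'v set \<Rightarrow> ('v \<Rightarrow> 'v \<Rightarrow> 'v) \<Rightarrow> bool" where
  "Lie_algebra_on scale A br \<longleftrightarrow>
     vector_space scale \<and> module.subspace scale A \<and>
     (\<forall>x \<in> A. \<forall>y \<in> A. br x y \<in> A) \<and>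
     (\<forall>x \<in> A. \<forall>y \<in> A. \<forall>z \<in> A. br (x + y) z = br x z + br y z \<and> br z (x + y) = br z x + br z y) \<and>
     (\<forall>c. \<forall>x \<in> A. \<forall>y \<in> A. br (scale c x) y = scale c (br x y) \<and> br x (scale c y) = scale c (br x y)) \<and>
     (\<forall>x \<in> A. br x x = 0) \<and>
     (\<forall>x \<in> A. \<forall>y \<in> A. \<forall>z \<in> A. br x (br y z) + br y (br z x) + br z (br x y) = 0)"

definition Rota_Baxter_Lie_algebra_on ::
  "('k::field \<Rightarrow> 'v::ab_group_add \<Rightarrow> 'v) \<Rightarrow> 'k \<Rightarrow> 'v set \<Rightarrow> ('v \<Rightarrow> 'v \<Rightarrow> 'v) \<Rightarrow> ('v \<Rightarrow> 'v) \<Rightarrow> bool" where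
  "Rota_Baxter_Lie_algebra_on scale lam A br T \<longleftrightarrow>
     Lie_algebra_on scale A br \<and>
     (\<forall>x \<in> A. T x \<in> A) \<and>
     (\<forall>x \<in> A. \<forall>y \<in> A. T (x + y) = T x + T y) \<and>
     (\<forall>c. \<forall>x \<in> A. T (scale c x) = scale c (T x)) \<and>
     (\<forall>a \<in> A. \<forall>b \<in> A. br (T a) (T b) = T (br a (T b) + br (T a) b + scale lam (br a b)))"

text \<open>
  Families of maps, indexed by the arity \<open>n \<ge> 1\<close>; the component of index \<open>0\<close> is always \<open>0\<close>.
\<close>

type_synonym 'v family = "nat \<Rightarrow> 'v mmap"

definition antisymmetric_family ::
  "('k::field \<Rightarrow> 'v::ab_group_add \<Rightarrow> 'v) \<Rightarrow> (int \<Rightarrow> 'v set) \<Rightarrow> (nat \<Rightarrow> int) \<Rightarrow> 'v family \<Rightarrow> bool" where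
  "antisymmetric_family scale V d f \<longleftrightarrow> f 0 = (\<lambda>_. 0) \<and>
     (\<forall>n \<ge> 1. f n \<in> graded_hom scale V V n (d n) \<and>
        (\<forall>xs \<sigma>. homogeneous V n xs \<and> \<sigma> permutes {..<n} \<longrightarrow>
           f n xs = scale (chi_sign \<sigma> (map fst xs)) (f n (permute_list \<sigma> xs))))"

definition hrb_l_factor :: "'v family \<Rightarrow> nat \<Rightarrow> 'v factor" where
  "hrb_l_factor \<ll> n = (n, int n - 2, \<ll> n)"

definition hrb_T_factor :: "'v family \<Rightarrow> nat \<Rightarrow> 'v factor" where
  "hrb_T_factor T n = (n, int n - 1, T n)"

definition hrb_jacobi ::
  "('k::field \<Rightarrow> 'v::ab_group_add \<Rightarrow> 'v) \<Rightarrow> 'v family \<Rightarrow> nat \<Rightarrow> 'v mmap" where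
  "hrb_jacobi scale \<ll> n xs =
     (\<Sum>i = 1..n. \<Sum>\<sigma> \<in> shuffles_of [i, n - i].
        scale (of_int (sign \<sigma>) * (-1) ^ (i * (n - i)))
          (comp_perm scale
            (comp_tensor scale (\<ll> (n - i + 1)) (hrb_l_factor \<ll> i # replicate (n - i) id_factor)) \<sigma> xs))"

definition hrb_delta :: "nat \<Rightarrow> nat list \<Rightarrow> nat" where
  "hrb_delta k rs = 1 + (\<Sum>j = 1..k. (k - j) * (rs ! (j - 1) - 1))"

definition hrb_eta :: "nat \<Rightarrow> nat \<Rightarrow> nat list \<Rightarrow> nat" where
  "hrb_eta p q rs =
     (p + (\<Sum>j = 2..q. rs ! (j - 1) - 1)) * (rs ! 0 - 1)
       + (\<Sum>j = 2..q. (rs ! (j - 1) - 1) * (p - j + 1))"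

definition hrb_lhs ::
  "('k::field \<Rightarrow> 'v::ab_group_add \<Rightarrow> 'v) \<Rightarrow> 'v family \<Rightarrow> 'v family \<Rightarrow> nat \<Rightarrow> 'v mmap" where
  "hrb_lhs scale \<ll> T n xs =
     (\<Sum>k = 1..n. \<Sum>rs \<in> compositions k n. \<Sum>\<sigma> \<in> ordered_shuffles k rs.
        scale ((-1) ^ (hrb_delta k rs + 1) * of_int (sign \<sigma>))
          (comp_perm scale (comp_tensor scale (\<ll> k) (map (hrb_T_factor T) rs)) \<sigma> xs))"

text \<open>
  In \<open>hrb_rhs\<close> the list \<open>rs\<close> is \<open>[r\<^sub>1, \<dots>, r\<^sub>q]\<close>, and \<open>inner\<close> is the tensor factor
  \<open>\<ll>\<^sub>p (T\<^bsub>r\<^sub>2\<^esub> \<otimes> \<dots> \<otimes> T\<^bsub>r\<^sub>q\<^esub> \<otimes> id\<^bsup>\<otimes> p-q+1\<^esup>)\<close>. The condition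
  \<open>r\<^sub>1 + \<dots> + r\<^sub>q + p - q = n\<close> with all \<open>r\<^sub>j \<ge> 1\<close> forces \<open>p \<le> n\<close>.
\<close>

definition hrb_rhs ::
  "('k::field \<Rightarrow> 'v::ab_group_add \<Rightarrow> 'v) \<Rightarrow> 'k \<Rightarrow> 'v family \<Rightarrow> 'v family \<Rightarrow> nat \<Rightarrow> 'v mmap" where
  "hrb_rhs scale lam \<ll> T n xs =
     (\<Sum>p = 1..n. \<Sum>q = 1..p. \<Sum>rs \<in> compositions q (n - (p - q)).
        \<Sum>\<sigma> \<in> ordered_shuffles (q - 1) (tl rs @ [p - q + 1, hd rs - 1]).
          let inner = (sum_list (tl rs) + (p - q + 1),
                       int p - 2 + (\<Sum>r \<leftarrow> tl rs. int r - 1),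
                       comp_tensor scale (\<ll> p)
                         (map (hrb_T_factor T) (tl rs) @ replicate (p - q + 1) id_factor))
          in scale (lam ^ (p - q) * (-1) ^ hrb_eta p q rs * of_int (sign \<sigma>))
               (comp_perm scale
                 (comp_tensor scale (T (hd rs)) (inner # replicate (hd rs - 1) id_factor)) \<sigma> xs))"

definition homotopy_Rota_Baxter_structures ::
  "('k::field \<Rightarrow> 'v::ab_group_add \<Rightarrow> 'v) \<Rightarrow> (int \<Rightarrow> 'v set) \<Rightarrow> 'k \<Rightarrow> ('v family \<times> 'v family) set" where
  "homotopy_Rota_Baxter_structures scale V lam = {(\<ll>, T).
     antisymmetric_family scale V (\<lambda>n. int n - 2) \<ll> \<and>
     antisymmetric_family scale V (\<lambda>n. int n - 1) T \<and>
     (\<forall>n \<ge> 1. \<forall>xs. homogeneous V n xs \<longrightarrow> hrb_jacobi scale \<ll> n xs = 0) \<and>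
     (\<forall>n \<ge> 1. \<forall>xs. homogeneous V n xs \<longrightarrow> hrb_lhs scale \<ll> T n xs = hrb_rhs scale lam \<ll> T n xs)}"

section \<open>Maurer-Cartan elements\<close>

text \<open>
  A graded space \<open>L\<close> with operations \<open>l\<close> (the arity is the length of the argument list, and arguments
  carry their degrees). The Maurer-Cartan series is infinite; it is summed in the topology for which
  the \<open>F a\<close> form a neighbourhood basis of \<open>0\<close>. For the product below this is the product
  topology of discrete factors, and in each factor only finitely many terms of the series are nonzero.
\<close>

definition maurer_cartan_elements ::
  "('k::field_char_0 \<Rightarrow> 'a::ab_group_add \<Rightarrow> 'a) \<Rightarrow> (int \<Rightarrow> 'a set) \<Rightarrow> ((int \<times> 'a) list \<Rightarrow> 'a) \<Rightarrow>
     (nat \<Rightarrow> 'a set) \<Rightarrow> 'a set" where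
  "maurer_cartan_elements smul L l F = {\<alpha> \<in> L (-1).
     \<forall>a. \<forall>\<^sub>F N in sequentially.
       (\<Sum>n = 1..N. smul ((-1) ^ (n * (n - 1) div 2) / fact n) (l (replicate n (-1, \<alpha>)))) \<in> F a}"

section \<open>The L-infinity algebra of a graded space\<close>

text \<open>
  \<open>\<Prod>\<^sub>n\<^sub>\<ge>\<^sub>1 Hom(S\<^sup>n(sV), W)\<close> in degree \<open>d\<close>: maps on the graded symmetric power are the maps on the tensor
  power that are invariant under all \<open>r\<^sub>\<sigma>\<close>.
\<close>

definition sym_hom_product ::
  "('k::field \<Rightarrow> 'v::ab_group_add \<Rightarrow> 'v) \<Rightarrow> (int \<Rightarrow> 'v set) \<Rightarrow> (int \<Rightarrow> 'v set) \<Rightarrow> int \<Rightarrow> 'v family set" where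
  "sym_hom_product scale V W d = {f. f 0 = (\<lambda>_. 0) \<and>
     (\<forall>n \<ge> 1. f n \<in> graded_hom scale (susp V) W n d \<and>
        (\<forall>xs \<sigma>. homogeneous (susp V) n xs \<and> \<sigma> permutes {..<n} \<longrightarrow>
           f n xs = comp_perm scale (f n) \<sigma> xs))}"

definition C_Lie where
  "C_Lie scale V = sym_hom_product scale V (susp V)"

definition C_RBLO where
  "C_RBLO scale V = sym_hom_product scale V V"

definition C_RBL where
  "C_RBL scale V d = C_Lie scale V d \<times> C_RBLO scale V d"

definition family_scale :: "('k \<Rightarrow> 'v \<Rightarrow> 'v) \<Rightarrow> 'k \<Rightarrow> 'v family \<Rightarrow> 'v family" where
  "family_scale scale c f = (\<lambda>n xs. scale c (f n xs))"

definition C_RBL_scale ::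
  "('k \<Rightarrow> 'v \<Rightarrow> 'v) \<Rightarrow> 'k \<Rightarrow> 'v family \<times> 'v family \<Rightarrow> 'v family \<times> 'v family" where
  "C_RBL_scale scale c = map_prod (family_scale scale c) (family_scale scale c)"

definition C_RBL_filtration :: "nat \<Rightarrow> ('v::zero family \<times> 'v family) set" where
  "C_RBL_filtration a = {(f, g). \<forall>n \<le> a. f n = (\<lambda>_. 0) \<and> g n = (\<lambda>_. 0)}"

text \<open>
  The brace \<open>f{g\<^sub>1, \<dots>, g\<^sub>k}\<close>, extended to the products: its component of arity \<open>a\<close> is the sum of
  \<open>f\<^sub>n{g\<^bsub>1,m\<^sub>1\<^esub>, \<dots>, g\<^bsub>k,m\<^sub>k\<^esub>}\<close> over all \<open>m\<^sub>j \<ge> 1\<close> and \<open>n \<ge> k\<close> with \<open>n - k + m\<^sub>1 + \<dots> + m\<^sub>k = a\<close>. The \<open>g\<^sub>j\<close>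
  come with their degrees as maps into \<open>sV\<close>.
\<close>

definition brace ::
  "('k::field \<Rightarrow> 'v::ab_group_add \<Rightarrow> 'v) \<Rightarrow> 'v family \<Rightarrow> (int \<times> 'v family) list \<Rightarrow> 'v family" where
  "brace scale f gs a xs =
     (\<Sum>ms \<in> {ms. length ms = length gs \<and> (\<forall>m \<in> set ms. 1 \<le> m) \<and> sum_list ms \<le> a}.
        let r = a - sum_list ms in
        \<Sum>\<sigma> \<in> ordered_shuffles (length gs) (ms @ [r]).
          comp_perm scale
            (comp_tensor scale (f (r + length gs))
              (map2 (\<lambda>m (d, g). (m, d, g m)) ms gs @ replicate r id_factor)) \<sigma> xs)"

text \<open>The operation \<open>l\<^sub>2(sf \<otimes> sh)\<close>; \<open>d\<close> and \<open>e\<close> are the degrees of \<open>f\<close> and \<open>h\<close> as maps into \<open>sV\<close>.\<close>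

definition Lie_bracket ::
  "('k::field \<Rightarrow> 'v::ab_group_add \<Rightarrow> 'v) \<Rightarrow> int \<times> 'v family \<Rightarrow> int \<times> 'v family \<Rightarrow> 'v family" where
  "Lie_bracket scale = (\<lambda>(d, f) (e, h).
     brace scale f [(e, h)] - family_scale scale ((-1) powi (d * e)) (brace scale h [(d, f)]))"

text \<open>
  The operation \<open>l\<^bsub>m+1\<^esub>(sh \<otimes> g\<^sub>1 \<otimes> \<dots> \<otimes> g\<^sub>m)\<close> for a map \<open>sh\<close> concentrated in arity \<open>n\<close>, of degree \<open>dh = |sh| = |h| + 1\<close>, and elements
  \<open>gs = [g\<^sub>1, \<dots>, g\<^sub>m]\<close> listed with their degrees \<open>|g\<^sub>i|\<close>; the degree of \<open>sg\<^sub>i\<close> is \<open>|g\<^sub>i| + 1\<close>. In the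
  definition, \<open>gt = [g\<^bsub>\<tau>(1)\<^esub>, \<dots>, g\<^bsub>\<tau>(m)\<^esub>]\<close> and \<open>nested = sg\<^bsub>\<tau>(1)\<^esub>{sh{sg\<^bsub>\<tau>(2)\<^esub>, \<dots>, sg\<^bsub>\<tau>(m)\<^esub>}}\<close>.
\<close>

definition mixed_bracket_arity ::
  "('k::field \<Rightarrow> 'v::ab_group_add \<Rightarrow> 'v) \<Rightarrow> 'k \<Rightarrow> nat \<Rightarrow> int \<times> 'v family \<Rightarrow> (int \<times> 'v family) list \<Rightarrow> 'v family" where
  "mixed_bracket_arity scale lam n = (\<lambda>(dh, sh) gs.
     let m = length gs in
     if m = 0 \<or> n < m then 0
     else \<Sum>\<tau> | \<tau> permutes {..<m}.
       let gt = permute_list \<tau> gs;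
           ds = map fst gt;
           sgt = map (\<lambda>(d, g). (d + 1, g)) gt;
           sign0 = chi_sign \<tau> (map fst gs)
             * (-1) powi (int m * dh + (\<Sum>k = 1..m - 1. sum_list (take k ds)));
           nested = brace scale (snd (hd sgt))
             [(dh + total_degree (tl sgt), brace scale sh (tl sgt))]
       in if n = m
          then family_scale scale sign0
            (brace scale sh sgt - family_scale scale ((-1) powi ((hd ds + 1) * dh)) nested)
          else family_scale scale
            (sign0 * (-1) powi (1 + dh * (hd ds + 1)) * lam ^ (n - m)) nested)"

text \<open>
  The same operation for \<open>sh\<close> in the product, as the sum over the components of \<open>sh\<close>. A component of arity \<open>n > a\<close> does not contribute to the output of arity \<open>a\<close>.
\<close>

definition mixed_bracket ::
  "('k::field \<Rightarrow> 'v::ab_group_add \<Rightarrow> 'v) \<Rightarrow> 'k \<Rightarrow> int \<times> 'v family \<Rightarrow> (int \<times> 'v family) list \<Rightarrow> 'v family" where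
  "mixed_bracket scale lam = (\<lambda>(dh, sh) gs a xs.
     \<Sum>n = 1..a. mixed_bracket_arity scale lam n (dh, (\<lambda>j. if j = n then sh j else 0)) gs a xs)"

text \<open>
  All operations on homogeneous elements \<open>(d, (sh, g))\<close>, by multilinear expansion: the first component
  is the Lie bracket, and the second component sums over the position \<open>k\<close> of the factor taken from
  the Lie part, where moving \<open>sh\<close> past \<open>g\<^sub>1, \<dots>, g\<^sub>k\<close> costs \<open>(-1)\<^bsup>|sh| (|g\<^sub>1| + \<dots> + |g\<^sub>k|) + k\<^esup>\<close>. The
  operations vanish on all other combinations of factors.
\<close>

definition C_RBL_bracket ::
  "('k::field \<Rightarrow> 'v::ab_group_add \<Rightarrow> 'v) \<Rightarrow> 'k \<Rightarrow> (int \<times> 'v family \<times> 'v family) list \<Rightarrow>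
     'v family \<times> 'v family" where
  "C_RBL_bracket scale lam xs =
     (let fs = map (\<lambda>(d, f, g). (d, f)) xs;
          gs = map (\<lambda>(d, f, g). (d, g)) xs
      in (if length xs = 2 then Lie_bracket scale (fs ! 0) (fs ! 1) else 0,
          \<Sum>k < length xs.
            family_scale scale ((-1) powi (fst (fs ! k) * total_degree (take k gs) + int k))
              (mixed_bracket scale lam (fs ! k) (take k gs @ drop (Suc k) gs))))"

definition C_RBL_maurer_cartan ::
  "('k::field_char_0 \<Rightarrow> 'v::ab_group_add \<Rightarrow> 'v) \<Rightarrow> (int \<Rightarrow> 'v set) \<Rightarrow> 'k \<Rightarrow> ('v family \<times> 'v family) set" where
  "C_RBL_maurer_cartan scale V lam =
     maurer_cartan_elements (C_RBL_scale scale) (C_RBL scale V) (C_RBL_bracket scale lam)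
       C_RBL_filtration"

section \<open>From Maurer-Cartan elements to homotopy Rota-Baxter structures\<close>

text \<open>
  \<open>\<ll>\<^sub>n = s\<inverse> \<circ> sh\<^sub>n \<circ> s\<^sup>\<otimes>\<^sup>n\<close> and \<open>T\<^sub>n = g\<^sub>n \<circ> s\<^sup>\<otimes>\<^sup>n\<close>, with \<open>s\<^sup>\<otimes>\<^sup>n\<close> evaluated by the Koszul rule.
\<close>

definition desuspend :: "('k::field \<Rightarrow> 'v::ab_group_add \<Rightarrow> 'v) \<Rightarrow> 'v family \<Rightarrow> 'v family" where
  "desuspend scale f n = comp_tensor scale (f n) (replicate n susp_factor)"

definition induced_structure ::
  "('k::field \<Rightarrow> 'v::ab_group_add \<Rightarrow> 'v) \<Rightarrow> 'v family \<times> 'v family \<Rightarrow> 'v family \<times> 'v family" where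
  "induced_structure scale = map_prod (desuspend scale) (desuspend scale)"

end

theory Submission
  imports Defs "HOL-Library.Infinite_Set"
begin

text \<open>
  A Maurer-Cartan element is a pair \<open>\<alpha> = (sh, g)\<close> of degree \<open>-1\<close>. Since \<open>sh\<close> and \<open>g\<close> are odd as elements of the
  \<open>L\<^sub>\<infinity>\<close>-algebra, all signs that depend on the order of the arguments cancel when every argument is \<open>\<alpha>\<close>: each of
  the \<open>m!\<close> permutations of the copies of \<open>g\<close> and each of the \<open>m + 1\<close> positions of \<open>sh\<close> contributes
  the same term, which the coefficient \<open>\<plusminus>1/(m+1)!\<close> normalises. The Maurer-Cartan equation therefore reads
  (\<open>maurer_cartan_iff\<close>)
    \<open>sh{sh} = 0\<close>  and
    \<open>\<Sum>\<^sub>n sh\<^sub>n{sg, \<dots>, sg} = \<Sum>\<^bsub>1 \<le> m \<le> n\<^esub> \<lambda>\<^bsup>n-m\<^esup> sg{sh\<^sub>n{sg, \<dots>, sg}}\<close>,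
  with \<open>n\<close> copies of \<open>sg\<close> on the left and \<open>m - 1\<close> inner ones on the right. As \<open>sg\<close> has degree \<open>0\<close>, the only signs
  in these equations are the Koszul signs of the shuffles.

  Written out, the two equations are sums over the same shuffles as the equations of a homotopy Rota-Baxter
  structure. For the nested braces this rests on the unique factorization of a shuffle of the blocks
  \<open>(m\<^sub>1, \<dots>, m\<^sub>k, r)\<close> into a shuffle of the blocks \<open>(m\<^sub>1 + \<dots> + m\<^sub>k, r)\<close> and a shuffle of the first blocks
  (\<open>bij_betw_shuffle_composition\<close>, \<open>brace_brace_expand\<close>), together with the cocycle property of Koszul signs.

  What remains is to transport the equations along \<open>\<ll>\<^sub>n = s\<inverse> \<circ> sh\<^sub>n \<circ> s\<^sup>\<otimes>\<^sup>n\<close> and \<open>T\<^sub>n = g\<^sub>n \<circ> s\<^sup>\<otimes>\<^sup>n\<close>. Moving \<open>s\<^sup>\<otimes>\<^sup>n\<close> past a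
  permutation produces the signature (\<open>koszul_sign_desusp\<close>). Moving it into a composite with a tensor
  product of maps produces a sign that depends only on the arities and degrees of these maps
  (\<open>comp_tensor_desuspended\<close>); for the three composites in question it is \<open>(-1)\<^bsup>i(n-i)\<^esup>\<close>, \<open>(-1)\<^bsup>\<delta>+1\<^esup>\<close> and
  \<open>(-1)\<^bsup>\<eta>\<^esup>\<close>. So both sides of each homotopy equation equal the sides of the corresponding
  Maurer-Cartan equation up to one common sign, and desuspension, which is a bijection between symmetric
  maps on \<open>sV\<close> and antisymmetric maps on \<open>V\<close>, restricts to the asserted bijection.

  If \<open>V\<close> is concentrated in degree \<open>0\<close>, only \<open>\<ll>\<^sub>2\<close> and \<open>T\<^sub>1\<close> survive; the equation for \<open>\<ll>\<close> in arity \<open>3\<close> is the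
  Jacobi identity and the equation for \<open>T\<close> in arity \<open>2\<close> is the Rota-Baxter relation.
\<close>

section \<open>Koszul signs\<close>

lemma minus_one_powi_add: "(-1 :: 'k::field) powi a * (-1) powi b = (-1) powi (a + b)"
  by (simp add: power_int_add)

lemma minus_one_powi_cong: "even a = even b \<Longrightarrow> (-1 :: 'k::field) powi a = (-1) powi b"
  by (simp add: power_int_minus_left)

lemma minus_one_power_powi: "(-1 :: 'k::field) ^ n = (-1) powi int n"
  by simp

definition index_pairs :: "nat \<Rightarrow> (nat \<times> nat) set" where
  "index_pairs n = {(i, j). i < j \<and> j < n}"

lemma finite_index_pairs [simp]: "finite (index_pairs n)"
  by (rule finite_subset[of _ "{..<n} \<times> {..<n}"]) (auto simp: index_pairs_def)

text \<open>
  A symmetric function of two indices is a function of two-element sets of indices, and \<open>\<sigma>\<close>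
  permutes these sets.
\<close>

lemma prod_index_pairs_permute:
  fixes F :: "nat \<Rightarrow> nat \<Rightarrow> 'a::comm_monoid_mult"
  assumes s: "\<sigma> permutes {..<n}" and sym: "\<And>i j. F i j = F j i"
  shows "(\<Prod>(i, j)\<in>index_pairs n. F (\<sigma> i) (\<sigma> j)) = (\<Prod>(i, j)\<in>index_pairs n. F i j)"
proof (rule prod.reindex_bij_witness[where
      j = "\<lambda>(i, j). (min (\<sigma> i) (\<sigma> j), max (\<sigma> i) (\<sigma> j))" and
      i = "\<lambda>(i, j). (min (inv \<sigma> i) (inv \<sigma> j), max (inv \<sigma> i) (inv \<sigma> j))"])
  have inj: "\<sigma> i = \<sigma> j \<longleftrightarrow> i = j" "inv \<sigma> i = inv \<sigma> j \<longleftrightarrow> i = j" for i j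
    using s by (metis permutes_inverses(2), metis s permutes_inverses(1))
  have inn: "\<sigma> i < n \<longleftrightarrow> i < n" "inv \<sigma> i < n \<longleftrightarrow> i < n" for i
    using permutes_in_image[OF s] permutes_in_image[OF permutes_inv[OF s]] by auto
  have lt: "\<sigma> i \<le> \<sigma> j \<Longrightarrow> \<sigma> i < \<sigma> j" "inv \<sigma> i \<le> inv \<sigma> j \<Longrightarrow> inv \<sigma> i < inv \<sigma> j" if "i < j" for i j
    using inj[of i j] that by (simp_all add: order.strict_iff_order)
  note inv = permutes_inverses[OF s]
  fix a assume "a \<in> index_pairs n"
  then show "(case (case a of (i, j) \<Rightarrow> (min (\<sigma> i) (\<sigma> j), max (\<sigma> i) (\<sigma> j))) of
          (i, j) \<Rightarrow> (min (inv \<sigma> i) (inv \<sigma> j), max (inv \<sigma> i) (inv \<sigma> j))) = a"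
    "(case a of (i, j) \<Rightarrow> (min (\<sigma> i) (\<sigma> j), max (\<sigma> i) (\<sigma> j))) \<in> index_pairs n"
    "(case (case a of (i, j) \<Rightarrow> (min (\<sigma> i) (\<sigma> j), max (\<sigma> i) (\<sigma> j))) of (i, j) \<Rightarrow> F i j) =
       (case a of (i, j) \<Rightarrow> F (\<sigma> i) (\<sigma> j))"
    using inj inn lt by (auto simp: index_pairs_def min_def max_def inv not_le intro: sym)
  from \<open>a \<in> index_pairs n\<close> show "(case (case a of (i, j) \<Rightarrow> (min (inv \<sigma> i) (inv \<sigma> j), max (inv \<sigma> i) (inv \<sigma> j))) of
          (i, j) \<Rightarrow> (min (\<sigma> i) (\<sigma> j), max (\<sigma> i) (\<sigma> j))) = a"
    "(case a of (i, j) \<Rightarrow> (min (inv \<sigma> i) (inv \<sigma> j), max (inv \<sigma> i) (inv \<sigma> j))) \<in> index_pairs n"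
    using inj inn lt by (auto simp: index_pairs_def min_def max_def inv not_le)
qed

lemma koszul_sign_index_pairs:
  "koszul_sign \<sigma> ds =
     (\<Prod>(i, j)\<in>index_pairs (length ds). if \<sigma> j < \<sigma> i then (-1 :: 'k::field) powi (ds ! \<sigma> i * ds ! \<sigma> j) else 1)"
  unfolding koszul_sign_def
  by (rule prod.mono_neutral_cong_left) (auto simp: index_pairs_def[symmetric], auto simp: index_pairs_def split: if_splits)

text \<open>
  A pair of positions is an inversion of \<open>\<sigma> \<circ> \<tau>\<close> iff it is an inversion of
  exactly one of \<open>\<tau>\<close> (at the pair) and \<open>\<sigma>\<close> (at its image under \<open>\<tau>\<close>); the factors of a pair that
  is inverted twice cancel.
\<close>

lemma koszul_sign_compose:
  assumes s: "\<sigma> permutes {..<length ds}" and t: "\<tau> permutes {..<length ds}"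
  shows "koszul_sign (\<sigma> \<circ> \<tau>) ds = (koszul_sign \<sigma> ds * koszul_sign \<tau> (permute_list \<sigma> ds) :: 'k::field)"
proof -
  let ?n = "length ds"
  \<comment> \<open>The factor of \<open>\<sigma>\<close> as a symmetric function of the pair, so that it can be transported along \<open>\<tau>\<close>.\<close>
  define F :: "nat \<Rightarrow> nat \<Rightarrow> 'k" where
    "F i j = (if (i < j \<and> \<sigma> j < \<sigma> i) \<or> (j < i \<and> \<sigma> i < \<sigma> j) then (-1) powi (ds ! \<sigma> i * ds ! \<sigma> j) else 1)" for i j
  have inj: "\<tau> i = \<tau> j \<longleftrightarrow> i = j" "\<sigma> i = \<sigma> j \<longleftrightarrow> i = j" for i j
    using t s by (metis permutes_inverses(2))+
  have "koszul_sign \<sigma> ds = (\<Prod>(i, j)\<in>index_pairs ?n. F i j)"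
    unfolding koszul_sign_index_pairs by (rule prod.cong) (auto simp: F_def index_pairs_def)
  also have "\<dots> = (\<Prod>(i, j)\<in>index_pairs ?n. F (\<tau> i) (\<tau> j))"
    by (rule prod_index_pairs_permute[OF t, symmetric]) (auto simp: F_def mult.commute)
  finally have "koszul_sign \<sigma> ds * koszul_sign \<tau> (permute_list \<sigma> ds) =
      (\<Prod>(i, j)\<in>index_pairs ?n. F (\<tau> i) (\<tau> j) *
         (if \<tau> j < \<tau> i then (-1) powi (permute_list \<sigma> ds ! \<tau> i * permute_list \<sigma> ds ! \<tau> j) else 1))"
    by (simp add: koszul_sign_index_pairs[of \<tau>] prod.distrib[symmetric] case_prod_unfold)
  also have "\<dots> = koszul_sign (\<sigma> \<circ> \<tau>) ds"
    unfolding koszul_sign_index_pairs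
  proof (intro prod.cong refl, clarify)
    fix i j assume ij: "(i, j) \<in> index_pairs ?n"
    then have "\<tau> i < ?n" "\<tau> j < ?n"
      using permutes_in_image[OF t] by (auto simp: index_pairs_def)
    then have nth: "permute_list \<sigma> ds ! \<tau> i = ds ! \<sigma> (\<tau> i)" "permute_list \<sigma> ds ! \<tau> j = ds ! \<sigma> (\<tau> j)"
      using s by (auto simp: permute_list_nth)
    have sq: "(-1 :: 'k) powi a * (-1) powi a = 1" for a
      by (simp add: minus_one_powi_add power_int_minus_left)
    have "\<tau> i \<noteq> \<tau> j" "\<sigma> (\<tau> i) \<noteq> \<sigma> (\<tau> j)" using ij by (auto simp: inj index_pairs_def)
    then show "F (\<tau> i) (\<tau> j) *
         (if \<tau> j < \<tau> i then (-1) powi (permute_list \<sigma> ds ! \<tau> i * permute_list \<sigma> ds ! \<tau> j) else 1) =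
       (if (\<sigma> \<circ> \<tau>) j < (\<sigma> \<circ> \<tau>) i then (-1) powi (ds ! (\<sigma> \<circ> \<tau>) i * ds ! (\<sigma> \<circ> \<tau>) j) else 1)"
      unfolding nth F_def by (auto simp: sq)
  qed
  finally show ?thesis by simp
qed

lemma koszul_sign_transpose_ones:
  assumes "a < b" "b < n"
  shows "koszul_sign (Transposition.transpose a b) (replicate n 1) = (-1 :: 'k::field)"
proof -
  let ?t = "Transposition.transpose a b"
  \<comment> \<open>The inversions are the pairs in \<open>{a..b}\<close> that contain \<open>a\<close> or \<open>b\<close>.\<close>
  have eq: "{(i, j). i < j \<and> j < n \<and> ?t j < ?t i} = (Pair a) ` {a<..b} \<union> (\<lambda>i. (i, b)) ` {a<..<b}"
    using assms by (auto simp: Transposition.transpose_def split: if_splits)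
  have "card {(i, j). i < j \<and> j < n \<and> ?t j < ?t i} = (b - a) + (b - a - 1)"
    unfolding eq by (subst card_Un_disjoint) (auto simp: card_image inj_on_def)
  then have odd: "odd (card {(i, j). i < j \<and> j < n \<and> ?t j < ?t i})"
    using assms by simp
  have "koszul_sign ?t (replicate n 1) = (\<Prod>(i, j)\<in>{(i, j). i < j \<and> j < n \<and> ?t j < ?t i}. (-1 :: 'k))"
    unfolding koszul_sign_def using assms
    by (intro prod.cong) (auto simp: Transposition.transpose_def)
  also have "\<dots> = -1" using odd by (simp add: case_prod_unfold)
  finally show ?thesis .
qed

lemma permute_list_replicate [simp]:
  assumes "\<sigma> permutes {..<n}" shows "permute_list \<sigma> (replicate n x) = replicate n x"
  by (rule nth_equalityI) (use assms permutes_in_image[OF assms] in \<open>auto simp: permute_list_nth\<close>)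

text \<open>
  Both sides are multiplicative in \<open>\<sigma>\<close>, and a transposition has an odd number of inversions.
\<close>

lemma koszul_sign_ones:
  assumes "\<sigma> permutes {..<n}"
  shows "koszul_sign \<sigma> (replicate n 1) = (of_int (sign \<sigma>) :: 'k::field)"
  using assms finite_lessThan
proof (induction rule: permutes_induct)
  case id
  then show ?case by (simp add: koszul_sign_index_pairs) (auto intro!: prod.neutral simp: index_pairs_def)
next
  case (swap a b p)
  let ?t = "Transposition.transpose a b"
  have t: "?t permutes {..<n}" using swap by (intro permutes_swap_id) auto
  have "koszul_sign ?t (replicate n 1) = (-1 :: 'k)"
    using koszul_sign_transpose_ones[of a b n] koszul_sign_transpose_ones[of b a n] swap.hyps swap.IH
    by (cases a b rule: linorder_cases) (auto simp: transpose_commute)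
  moreover have "sign (?t \<circ> p) = - sign p"
    using swap t by (subst sign_compose)
      (auto simp: sign_swap_id permutation_swap_id permutation_permutes)
  moreover have "koszul_sign (?t \<circ> p) (replicate n 1) =
      (koszul_sign ?t (replicate n 1) * koszul_sign p (replicate n 1) :: 'k)"
    using t swap by (subst koszul_sign_compose) auto
  ultimately show ?case
    using swap by (simp del: o_apply)
qed

text \<open>
  The sign of \<open>s\<^sup>\<otimes>\<^sup>n\<close> evaluated by the Koszul rule: an element is passed by the
  odd maps \<open>s\<close> that belong to the elements on its right.
\<close>

fun desusp_sign :: "int list \<Rightarrow> 'k::field" where
  "desusp_sign [] = 1"
| "desusp_sign (p # ps) = (-1) powi (int (length ps) * p) * desusp_sign ps"

lemma desusp_sign_index_pairs:
  "desusp_sign ds = (\<Prod>(i, j)\<in>index_pairs (length ds). (-1 :: 'k::field) powi (ds ! i))"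
proof (induction ds)
  case Nil
  show ?case by (simp add: index_pairs_def)
next
  case (Cons p ps)
  let ?n = "length ps"
  have eq: "index_pairs (Suc ?n) = Pair 0 ` {1..?n} \<union> map_prod Suc Suc ` index_pairs ?n"
  proof (intro equalityI subsetI)
    fix x assume "x \<in> index_pairs (Suc ?n)"
    then obtain i j where x: "x = (i, j)" "i < j" "j < Suc ?n" by (auto simp: index_pairs_def)
    show "x \<in> Pair 0 ` {1..?n} \<union> map_prod Suc Suc ` index_pairs ?n"
    proof (cases i)
      case 0
      then show ?thesis using x by auto
    next
      case (Suc i')
      then have "x = map_prod Suc Suc (i', j - 1)" "(i', j - 1) \<in> index_pairs ?n"
        using x by (auto simp: index_pairs_def)
      then show ?thesis by blast
    qed
  qed (auto simp: index_pairs_def)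
  have "(\<Prod>(i, j)\<in>index_pairs (length (p # ps)). (-1 :: 'k) powi ((p # ps) ! i)) =
    (\<Prod>(i, j)\<in>Pair 0 ` {1..?n}. (-1 :: 'k) powi ((p # ps) ! i)) *
    (\<Prod>(i, j)\<in>map_prod Suc Suc ` index_pairs ?n. (-1 :: 'k) powi ((p # ps) ! i))"
    unfolding list.size add_0_right add_Suc_right eq by (rule prod.union_disjoint) auto
  also have "(\<Prod>(i, j)\<in>Pair 0 ` {1..?n}. (-1 :: 'k) powi ((p # ps) ! i)) = ((-1) powi p) ^ ?n"
    by (subst prod.reindex) (auto simp: inj_on_def)
  also have "\<dots> = (-1) powi (int ?n * p)"
    by (simp add: power_int_power' mult.commute)
  also have "(\<Prod>(i, j)\<in>map_prod Suc Suc ` index_pairs ?n. (-1 :: 'k) powi ((p # ps) ! i)) = desusp_sign ps"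
    unfolding Cons by (subst prod.reindex) (auto simp: inj_on_def case_prod_unfold)
  finally show ?case by simp
qed

text \<open>
  The sign of the decalage isomorphism. Over the inversions of \<open>\<sigma>\<close>, the exponent \<open>(p + 1) (q + 1)\<close> exceeds \<open>p q\<close> by \<open>1\<close>, which
  produces the signature, and by \<open>p + q\<close>, which measures the change of the sign of \<open>s\<^sup>\<otimes>\<^sup>n\<close>.
\<close>

lemma koszul_sign_desusp:
  assumes s: "\<sigma> permutes {..<length ds}"
  shows "of_int (sign \<sigma>) * koszul_sign \<sigma> ds * desusp_sign (permute_list \<sigma> ds) =
    (koszul_sign \<sigma> (map (\<lambda>d. d + 1) ds) * desusp_sign ds :: 'k::field)"
proof -
  let ?n = "length ds"
  let ?P = "\<lambda>F. \<Prod>(i, j)\<in>index_pairs ?n. F i j :: 'k"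
  have in_n: "\<sigma> i < ?n" if "i < ?n" for i using permutes_in_image[OF s] that by auto
  \<comment> \<open>The minimum makes the factor symmetric in \<open>i\<close> and \<open>j\<close>, so that \<open>\<sigma>\<close> may be applied to the indices.\<close>
  have "desusp_sign ds = ?P (\<lambda>i j. (-1) powi (ds ! min i j))"
    unfolding desusp_sign_index_pairs by (rule prod.cong) (auto simp: index_pairs_def min_def)
  also have "\<dots> = ?P (\<lambda>i j. (-1) powi (ds ! min (\<sigma> i) (\<sigma> j)))"
    by (rule prod_index_pairs_permute[OF s, symmetric]) (simp add: min.commute)
  finally have D: "desusp_sign ds = \<dots>" .
  have D': "desusp_sign (permute_list \<sigma> ds) = ?P (\<lambda>i j. (-1) powi (ds ! \<sigma> i))"
    unfolding desusp_sign_index_pairs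
    by (rule prod.cong) (auto simp: index_pairs_def permute_list_nth[OF s])
  have S: "of_int (sign \<sigma>) = ?P (\<lambda>i j. if \<sigma> j < \<sigma> i then -1 else 1)"
    unfolding koszul_sign_ones[OF s, symmetric] koszul_sign_index_pairs
    by (rule prod.cong) (auto simp: index_pairs_def in_n)
  have K: "koszul_sign \<sigma> (map (\<lambda>d. d + 1) ds) =
      ?P (\<lambda>i j. if \<sigma> j < \<sigma> i then (-1) powi ((ds ! \<sigma> i + 1) * (ds ! \<sigma> j + 1)) else 1)"
    unfolding koszul_sign_index_pairs by (rule prod.cong) (auto simp: index_pairs_def in_n)
  show ?thesis
    unfolding D D' S K koszul_sign_index_pairs[of \<sigma> ds] prod.distrib[symmetric]
    by (rule prod.cong)
      (auto simp: power_int_minus_left min_def)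
qed

section \<open>Suspension of multilinear maps\<close>

definition suspend :: "'v elt list \<Rightarrow> 'v elt list" where
  "suspend xs = map (apfst (\<lambda>p. p + 1)) xs"

lemma suspend_simps [simp]:
  "suspend [] = []" "suspend ((p, v) # xs) = (p + 1, v) # suspend xs" "length (suspend xs) = length xs"
  "map fst (suspend xs) = map (\<lambda>d. d + 1) (map fst xs)"
  "suspend (xs @ ys) = suspend xs @ suspend ys"
  by (simp_all add: suspend_def)

lemma suspend_permute_list:
  "\<sigma> permutes {..<length xs} \<Longrightarrow> suspend (permute_list \<sigma> xs) = permute_list \<sigma> (suspend xs)"
  by (simp add: suspend_def permute_list_map)

lemma total_degree_suspend: "total_degree (suspend xs) = total_degree xs + int (length xs)"
  by (induction xs) (auto simp: suspend_def)

lemma homogeneous_susp_suspend: "homogeneous (susp V) n (suspend xs) = homogeneous V n xs"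
  by (fastforce simp: homogeneous_def susp_def suspend_def)

lemma surj_suspend: obtains xs where "ys = suspend xs"
proof
  show "ys = suspend (map (apfst (\<lambda>p. p - 1)) ys)"
    by (induction ys) (auto simp: suspend_def)
qed

lemma desusp_sign_cases: "desusp_sign ds = (1 :: 'k::field) \<or> desusp_sign ds = (-1 :: 'k)"
  by (induction ds) (auto simp: power_int_minus_left)

lemma desusp_sign_nonzero [simp]: "desusp_sign ds \<noteq> (0 :: 'k::field)"
  by (induction ds) auto

lemma desusp_sign_square [simp]:
  "desusp_sign ds * desusp_sign ds = (1 :: 'k::field)"
  "desusp_sign ds * (desusp_sign ds * c) = (c :: 'k::field)"
  using desusp_sign_cases[of ds, where ?'k = 'k] by auto

lemma desusp_sign_append:
  "desusp_sign (as @ bs) =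
     (desusp_sign as * (-1) powi (int (length bs) * sum_list as) * desusp_sign bs :: 'k::field)"
proof (induction as)
  case (Cons a as)
  have "desusp_sign ((a # as) @ bs) =
      ((-1) powi (int (length as + length bs) * a) * (-1) powi (int (length bs) * sum_list as))
        * (desusp_sign as * desusp_sign bs :: 'k)"
    using Cons by (simp add: mult_ac)
  also have "(-1) powi (int (length as + length bs) * a) * (-1) powi (int (length bs) * sum_list as) =
      ((-1) powi (int (length as) * a) * (-1) powi (int (length bs) * (sum_list (a # as))) :: 'k)"
    unfolding minus_one_powi_add by (simp add: algebra_simps)
  finally show ?case by (simp add: mult_ac)
qed simp

lemma length_tensor_values [simp]: "length (tensor_values fs xs) = length fs"
  by (induction fs xs rule: tensor_values.induct) auto

lemma desuspend_eq:
  fixes scale :: "'k::field \<Rightarrow> 'v::ab_group_add \<Rightarrow> 'v"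
  shows "desuspend scale f n xs =
     (if length xs = n then scale (desusp_sign (map fst xs)) (f n (suspend xs)) else 0)"
proof -
  have "tensor_sign (replicate n susp_factor) xs = (desusp_sign (map fst xs) :: 'k) \<and>
      tensor_values (replicate n susp_factor) xs = suspend xs" if "length xs = n"
    using that
  proof (induction xs arbitrary: n)
    case (Cons x xs)
    then show ?case by (cases x) (auto simp: susp_factor_def sum_list_replicate)
  qed simp
  then show ?thesis
    by (auto simp: desuspend_def comp_tensor_def susp_factor_def sum_list_replicate)
qed

text \<open>
  The exponent of the sign by which \<open>s\<^sup>\<otimes>\<^sup>n\<close> fails to pass through
  \<open>f \<circ> (f\<^sub>1 \<otimes> \<dots> \<otimes> f\<^sub>k)\<close>. The desuspension of a map
  \<open>f\<^sub>j\<close> of arity \<open>m\<close> and degree \<open>e\<close> has degree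
  \<open>e + m - 1\<close> and is passed by the maps \<open>s\<close> of the later slots of
  \<open>f\<close>, one for each of \<open>f\<^bsub>j+1\<^esub>, \<dots>, f\<^sub>k\<close>; the
  \<open>m\<close> maps \<open>s\<close> in its own block are passed by the later maps
  \<open>f\<^bsub>j+1\<^esub>, \<dots>, f\<^sub>k\<close> themselves.
\<close>

fun koszul_defect :: "'v factor list \<Rightarrow> int" where
  "koszul_defect [] = 0"
| "koszul_defect ((m, e, f) # fs) =
     int (length fs) * (e + int m - 1) + sum_list (map (\<lambda>(_, e, _). e) fs) * int m + koszul_defect fs"

fun block_sign :: "nat list \<Rightarrow> int list \<Rightarrow> 'k::field" where
  "block_sign [] ds = 1"
| "block_sign (m # ms) ds = desusp_sign (take m ds) * block_sign ms (drop m ds)"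

lemma block_sign_nonzero [simp]: "block_sign ms ds \<noteq> (0 :: 'k::field)"
  by (induction ms ds rule: block_sign.induct) auto

text \<open>
  A relation rather than a function on factors, since the identity of \<open>V\<close> is the desuspension of
  the identity of \<open>sV\<close> only on lists of length \<open>1\<close>, the only ones on which a factor of
  arity \<open>1\<close> is ever evaluated.
\<close>

definition desuspended_factor :: "('k::field \<Rightarrow> 'v \<Rightarrow> 'v) \<Rightarrow> 'v factor \<Rightarrow> 'v factor \<Rightarrow> bool" where
  "desuspended_factor scale = (\<lambda>(m, d, \<phi>) (m', e, f). m = m' \<and> d = e + int m - 1 \<and>
     (\<forall>xs. length xs = m \<longrightarrow> \<phi> xs = scale (desusp_sign (map fst xs)) (f (suspend xs))))"

lemma desuspended_factors_arity:
  "list_all2 (desuspended_factor scale) fs fs' \<Longrightarrow> map fst fs = map fst fs'"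
  by (induction fs fs' rule: list_all2_induct) (auto simp: desuspended_factor_def)

lemma desuspended_factors_degree:
  "list_all2 (desuspended_factor scale) fs fs' \<Longrightarrow>
     sum_list (map (\<lambda>(_, e, _). e) fs) =
     sum_list (map (\<lambda>(_, e, _). e) fs') + int (sum_list (map fst fs')) - int (length fs')"
  by (induction fs fs' rule: list_all2_induct) (auto simp: desuspended_factor_def)

lemma minus_one_powi_eqI: "a = b + 2 * t \<Longrightarrow> (-1 :: 'k::field) powi a = (-1) powi b"
  by (rule minus_one_powi_cong) auto

text \<open>
  Induction on the factors. For the first one, with block degree \<open>Q\<close>, arity \<open>m\<close> and
  degree \<open>e\<close>, followed by \<open>k\<close> factors of total degree \<open>E\<close> and total arity
  \<open>R\<close>, the exponents \<open>k (e + m - 1 + Q) + (E + R - k) Q\<close> and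
  \<open>k (e + m - 1) + E m + E (Q + m) + R Q\<close> differ by \<open>2 E m\<close>.
\<close>

lemma tensor_sign_desuspended:
  assumes "list_all2 (desuspended_factor scale) fs fs'" and "length xs = sum_list (map fst fs')"
  shows "desusp_sign (map fst (tensor_values fs xs)) * tensor_sign fs xs
      * block_sign (map fst fs') (map fst xs)
    = ((-1) powi koszul_defect fs' * tensor_sign fs' (suspend xs) * desusp_sign (map fst xs) :: 'k::field)"
  using assms
proof (induction fs fs' arbitrary: xs rule: list_all2_induct)
  case (Cons fac fs fac' fs')
  obtain m e f where fac': "fac' = (m, e, f)" by (cases fac')
  then obtain \<phi> where fac: "fac = (m, e + int m - 1, \<phi>)"
    using Cons.hyps by (cases fac) (auto simp: desuspended_factor_def)
  define ys zs where "ys = take m xs" and "zs = drop m xs"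
  have xs: "xs = ys @ zs" and ys: "length ys = m" and zs: "length zs = sum_list (map fst fs')"
    using Cons.prems fac' by (auto simp: ys_def zs_def)
  define k Q E R where "k = int (length fs')" and "Q = total_degree ys"
    and "E = sum_list (map (\<lambda>(_, e, _). e) fs')" and "R = int (length zs)"
  have len: "length fs = length fs'" using Cons.hyps by (simp add: list_all2_lengthD)
  have E: "sum_list (map (\<lambda>(_, e, _). e) fs) = E + R - k"
    using desuspended_factors_degree[OF Cons.hyps(2)] zs by (simp add: E_def R_def k_def)
  have IH: "desusp_sign (map fst (tensor_values fs zs)) * tensor_sign fs zs * block_sign (map fst fs') (map fst zs)
     = ((-1) powi koszul_defect fs' * tensor_sign fs' (suspend zs) * desusp_sign (map fst zs) :: 'k)"
    using Cons.IH zs by simp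
  have "desusp_sign (map fst (tensor_values (fac # fs) xs)) * tensor_sign (fac # fs) xs
      * block_sign (map fst (fac' # fs')) (map fst xs)
    = ((-1) powi (k * (e + int m - 1 + Q)) * (-1) powi ((E + R - k) * Q)) * desusp_sign (map fst ys)
      * (desusp_sign (map fst (tensor_values fs zs)) * tensor_sign fs zs * block_sign (map fst fs') (map fst zs) :: 'k)"
    by (simp add: fac fac' xs ys len E k_def Q_def mult_ac)
  also have "(-1) powi (k * (e + int m - 1 + Q)) * (-1) powi ((E + R - k) * Q) =
      ((-1) powi (k * (e + int m - 1) + E * int m) * (-1) powi (E * (Q + int m)) * (-1) powi (R * Q) :: 'k)"
    unfolding minus_one_powi_add
    by (rule minus_one_powi_eqI[where t = "- E * int m"]) (simp add: algebra_simps)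
  also have "\<dots> * desusp_sign (map fst ys) *
      (desusp_sign (map fst (tensor_values fs zs)) * tensor_sign fs zs * block_sign (map fst fs') (map fst zs)) =
      (-1) powi koszul_defect (fac' # fs') * tensor_sign (fac' # fs') (suspend xs) * desusp_sign (map fst xs)"
    unfolding IH using total_degree_suspend[of ys]
    by (simp add: fac' xs ys desusp_sign_append power_int_add mult_ac flip: E_def Q_def k_def R_def)
  finally show ?case .
qed simp

context graded_vector_space
begin

lemma component_closed:
  "0 \<in> V p" "u \<in> V p \<Longrightarrow> w \<in> V p \<Longrightarrow> u + w \<in> V p" "u \<in> V p \<Longrightarrow> scale c u \<in> V p"
  using subspace_component by (auto intro: subspace_0 subspace_add subspace_scale)

lemma component_sum: "(\<And>i. i \<in> I \<Longrightarrow> v i \<in> V p) \<Longrightarrow> sum v I \<in> V p"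
  using subspace_component by (rule subspace_sum)

lemma scale_in_component: "c \<noteq> 0 \<Longrightarrow> scale c v \<in> V p \<longleftrightarrow> v \<in> V p"
  using component_closed(3)[of "scale c v" p "inverse c"] component_closed(3)[of v p c] by auto

lemma susp_graded_vector_space: "graded_vector_space scale (susp V)"
  by unfold_locales (simp add: susp_def subspace_component)

text \<open>
  Nonzero scalars, in particular signs, can be moved out of a slot whatever the other entries are: scaling by
  \<open>c \<noteq> 0\<close> does not change whether a list is homogeneous, and off homogeneous lists the
  maps vanish.
\<close>

definition slot_scaling :: "'v mmap \<Rightarrow> bool" where
  "slot_scaling f \<longleftrightarrow> (\<forall>xs p v ys c. c \<noteq> 0 \<longrightarrow> f (xs @ (p, scale c v) # ys) = scale c (f (xs @ (p, v) # ys)))"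

lemma homogeneous_slot:
  "homogeneous V n (xs @ (p, v) # ys) \<longleftrightarrow>
     v \<in> V p \<and> homogeneous V (length xs) xs \<and> homogeneous V (length ys) ys \<and> n = Suc (length xs + length ys)"
  by (auto simp: homogeneous_def)

lemma graded_hom_off:
  assumes "f \<in> graded_hom scale V W n d" shows "\<not> homogeneous V n xs \<Longrightarrow> f xs = 0"
  using assms by (auto simp: graded_hom_def)

lemma graded_hom_degree:
  assumes "f \<in> graded_hom scale V W n d" shows "homogeneous V n xs \<Longrightarrow> f xs \<in> W (d + total_degree xs)"
  using assms by (auto simp: graded_hom_def)

lemma graded_hom_slot:
  assumes f: "f \<in> graded_hom scale V W n d" and h: "homogeneous V n (xs @ (p, z) # ys)"
  shows "u \<in> V p \<Longrightarrow> w \<in> V p \<Longrightarrow> f (xs @ (p, u + w) # ys) = f (xs @ (p, u) # ys) + f (xs @ (p, w) # ys)"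
    and "u \<in> V p \<Longrightarrow> f (xs @ (p, scale c u) # ys) = scale c (f (xs @ (p, u) # ys))"
proof -
  let ?zs = "xs @ (p, z) # ys"
  have "length xs < n" using h by (simp add: homogeneous_slot)
  with f h have "let p = fst (?zs ! length xs) in
          (\<forall>u \<in> V p. \<forall>w \<in> V p.
             f (?zs[length xs := (p, u + w)]) = f (?zs[length xs := (p, u)]) + f (?zs[length xs := (p, w)])) \<and>
          (\<forall>c. \<forall>u \<in> V p. f (?zs[length xs := (p, scale c u)]) = scale c (f (?zs[length xs := (p, u)])))"
    unfolding graded_hom_def by blast
  then show "u \<in> V p \<Longrightarrow> w \<in> V p \<Longrightarrow> f (xs @ (p, u + w) # ys) = f (xs @ (p, u) # ys) + f (xs @ (p, w) # ys)"
    "u \<in> V p \<Longrightarrow> f (xs @ (p, scale c u) # ys) = scale c (f (xs @ (p, u) # ys))"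
    by (simp_all add: Let_def)
qed

lemma graded_hom_slot_scaling:
  assumes f: "f \<in> graded_hom scale V W n d" shows "slot_scaling f"
  unfolding slot_scaling_def
proof (intro allI impI)
  fix xs p v ys and c :: 'k assume c: "c \<noteq> 0"
  show "f (xs @ (p, scale c v) # ys) = scale c (f (xs @ (p, v) # ys))"
  proof (cases "homogeneous V n (xs @ (p, v) # ys)")
    case True
    then show ?thesis using graded_hom_slot(2)[OF f True, of v c] by (simp add: homogeneous_slot)
  next
    case False
    then have "\<not> homogeneous V n (xs @ (p, scale c v) # ys)"
      using c by (simp add: homogeneous_slot scale_in_component)
    then show ?thesis using False graded_hom_off[OF f] by simp
  qed
qed

lemma graded_hom_zero_slot:
  assumes f: "f \<in> graded_hom scale V W n d" shows "f (xs @ (p, 0) # ys) = 0"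
proof (cases "homogeneous V n (xs @ (p, 0) # ys)")
  case True
  then show ?thesis using graded_hom_slot(2)[OF f True, of 0 0] component_closed(1)[of p] by simp
qed (use graded_hom_off[OF f] in simp)

lemma graded_hom_sum_slot:
  assumes f: "f \<in> graded_hom scale V W n d" and "finite I" and "\<And>i. i \<in> I \<Longrightarrow> v i \<in> V p"
  shows "f (xs @ (p, sum v I) # ys) = (\<Sum>i\<in>I. f (xs @ (p, v i) # ys))"
  using assms(2,3)
proof (induction I rule: finite_induct)
  case empty
  then show ?case using graded_hom_zero_slot[OF f] by simp
next
  case (insert i I)
  have "f (xs @ (p, v i + sum v I) # ys) = f (xs @ (p, v i) # ys) + f (xs @ (p, sum v I) # ys)"
  proof (cases "homogeneous V n (xs @ (p, v i) # ys)")
    case True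
    then show ?thesis using graded_hom_slot(1)[OF f True] insert.prems by (auto intro: component_sum)
  next
    case False
    have "v i \<in> V p" "sum v I \<in> V p" using insert.prems by (auto intro: component_sum)
    with False have "\<not> homogeneous V n (xs @ (p, w) # ys)" for w by (auto simp: homogeneous_slot)
    then show ?thesis using graded_hom_off[OF f] by simp
  qed
  then show ?case using insert by simp
qed

text \<open>
  The values \<open>f\<^sub>j\<close> on the suspended blocks differ from those of the desuspended maps by the
  block signs, which are pulled out of \<open>F\<close> one slot after the other; \<open>pre\<close> holds the
  slots that are already done.
\<close>

lemma slot_scaling_tensor_values:
  assumes "list_all2 (desuspended_factor scale) fs fs'" and "length xs = sum_list (map fst fs')"
    and F: "slot_scaling F"
  shows "F (pre @ suspend (tensor_values fs xs)) =
    scale (block_sign (map fst fs') (map fst xs)) (F (pre @ tensor_values fs' (suspend xs)))"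
  using assms(1,2)
proof (induction fs fs' arbitrary: xs pre rule: list_all2_induct)
  case (Cons fac fs fac' fs')
  obtain m e f where fac': "fac' = (m, e, f)" by (cases fac')
  then obtain \<phi> where fac: "fac = (m, e + int m - 1, \<phi>)"
    and \<phi>: "\<And>xs. length xs = m \<Longrightarrow> \<phi> xs = scale (desusp_sign (map fst xs)) (f (suspend xs))"
    using Cons.hyps by (cases fac) (auto simp: desuspended_factor_def)
  define ys zs where "ys = take m xs" and "zs = drop m xs"
  have xs: "xs = ys @ zs" and ys: "length ys = m" and zs: "length zs = sum_list (map fst fs')"
    using Cons.prems fac' by (auto simp: ys_def zs_def)
  let ?q = "e + total_degree (suspend ys)"
  have "F (pre @ suspend (tensor_values (fac # fs) xs)) =
      F ((pre @ [(?q, \<phi> ys)]) @ suspend (tensor_values fs zs))"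
    using total_degree_suspend[of ys] by (simp add: fac xs ys algebra_simps)
  also have "\<dots> = scale (block_sign (map fst fs') (map fst zs))
      (F ((pre @ [(?q, \<phi> ys)]) @ tensor_values fs' (suspend zs)))"
    using zs by (rule Cons.IH)
  also have "F ((pre @ [(?q, \<phi> ys)]) @ tensor_values fs' (suspend zs)) =
      scale (desusp_sign (map fst ys)) (F (pre @ (?q, f (suspend ys)) # tensor_values fs' (suspend zs)))"
    using F[unfolded slot_scaling_def] by (simp add: \<phi> ys)
  finally show ?case by (simp add: fac' xs ys mult.commute)
qed simp

text \<open>
  The sign of \<open>s\<^sup>\<otimes>\<^sup>n\<close> splits into those of the blocks, which turn the inner
  maps into their desuspensions, and that of \<open>s\<^sup>\<otimes>\<^sup>k\<close> on their values, which
  desuspends the outer map; \<open>koszul_defect\<close> is the cost of this rearrangement.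
\<close>

lemma comp_tensor_desuspended:
  assumes fs: "list_all2 (desuspended_factor scale) fs fs'" and F: "slot_scaling F"
    and \<Phi>: "\<And>zs. length zs = length fs' \<Longrightarrow> \<Phi> zs = scale (desusp_sign (map fst zs)) (F (suspend zs))"
  shows "comp_tensor scale \<Phi> fs xs =
    scale ((-1) powi koszul_defect fs' * desusp_sign (map fst xs)) (comp_tensor scale F fs' (suspend xs))"
proof (cases "length xs = sum_list (map fst fs')")
  case True
  have "length fs = length fs'" using fs by (rule list_all2_lengthD)
  then have "comp_tensor scale \<Phi> fs xs =
      scale (tensor_sign fs xs * desusp_sign (map fst (tensor_values fs xs)))
        (F (suspend (tensor_values fs xs)))"
    using True by (simp add: comp_tensor_def \<Phi> desuspended_factors_arity[OF fs])
  also have "F (suspend (tensor_values fs xs)) =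
      scale (block_sign (map fst fs') (map fst xs)) (F (tensor_values fs' (suspend xs)))"
    using slot_scaling_tensor_values[OF fs True F, of "[]"] by simp
  also have "scale (tensor_sign fs xs * desusp_sign (map fst (tensor_values fs xs))) \<dots> =
      scale ((-1) powi koszul_defect fs' * tensor_sign fs' (suspend xs) * desusp_sign (map fst xs))
        (F (tensor_values fs' (suspend xs)))"
    unfolding tensor_sign_desuspended[OF fs True, symmetric] by (simp add: mult_ac)
  finally show ?thesis using True by (simp add: comp_tensor_def mult_ac)
next
  case False
  then show ?thesis by (simp add: comp_tensor_def desuspended_factors_arity[OF fs])
qed

lemma comp_perm_desuspended:
  assumes s: "\<sigma> permutes {..<length xs}"
    and \<Phi>: "\<And>ys. length ys = length xs \<Longrightarrow> \<Phi> ys = scale (c * desusp_sign (map fst ys)) (F (suspend ys))"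
  shows "scale (of_int (sign \<sigma>)) (comp_perm scale \<Phi> \<sigma> xs) =
    scale (c * desusp_sign (map fst xs)) (comp_perm scale F \<sigma> (suspend xs))"
proof -
  have "of_int (sign \<sigma>) * koszul_sign \<sigma> (map fst xs) * desusp_sign (map fst (permute_list \<sigma> xs)) =
      (koszul_sign \<sigma> (map fst (suspend xs)) * desusp_sign (map fst xs) :: 'k)"
    using koszul_sign_desusp[of \<sigma> "map fst xs"] s by (simp add: permute_list_map)
  then have "of_int (sign \<sigma>) * (koszul_sign \<sigma> (map fst xs) * (c * desusp_sign (map fst (permute_list \<sigma> xs)))) =
      c * desusp_sign (map fst xs) * koszul_sign \<sigma> (map fst (suspend xs))"
    by (simp add: mult_ac)
  then show ?thesis by (simp add: comp_perm_def \<Phi> suspend_permute_list[OF s])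
qed

subsection \<open>Degrees and supports\<close>

definition homogeneous_factor :: "'v factor \<Rightarrow> bool" where
  "homogeneous_factor = (\<lambda>(m, d, f). \<forall>xs. homogeneous V m xs \<longrightarrow> f xs \<in> V (d + total_degree xs))"

lemma homogeneous_id_factor: "homogeneous_factor id_factor"
  by (auto simp: homogeneous_factor_def id_factor_def homogeneous_def length_Suc_conv)

lemma tensor_values_homogeneous:
  assumes "\<And>fac. fac \<in> set fs \<Longrightarrow> homogeneous_factor fac"
    and "homogeneous V (sum_list (map fst fs)) xs"
  shows "homogeneous V (length fs) (tensor_values fs xs) \<and>
    total_degree (tensor_values fs xs) = sum_list (map (\<lambda>(_, d, _). d) fs) + total_degree xs"
  using assms
proof (induction fs arbitrary: xs)
  case Nil
  then show ?case by (simp add: homogeneous_def)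
next
  case (Cons fac fs)
  obtain m d f where fac: "fac = (m, d, f)" by (cases fac)
  have 1: "homogeneous V m (take m xs)" and 2: "homogeneous V (sum_list (map fst fs)) (drop m xs)"
    using Cons.prems(2) by (auto simp: homogeneous_def fac dest: in_set_takeD in_set_dropD)
  have "total_degree xs = total_degree (take m xs) + total_degree (drop m xs)"
    by (metis append_take_drop_id map_append sum_list_append)
  moreover have "f (take m xs) \<in> V (d + total_degree (take m xs))"
    using Cons.prems(1)[of fac] 1 by (simp add: fac homogeneous_factor_def)
  moreover have "homogeneous V (length fs) (tensor_values fs (drop m xs)) \<and>
      total_degree (tensor_values fs (drop m xs)) = sum_list (map (\<lambda>(_, d, _). d) fs) + total_degree (drop m xs)"
    using Cons.prems(1) by (intro Cons.IH 2) simp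
  ultimately show ?case by (simp add: fac homogeneous_def)
qed

lemma comp_tensor_degree:
  assumes F: "F \<in> graded_hom scale V W (length fs) e" and W: "\<And>q. subspace (W q)"
    and fs: "\<And>fac. fac \<in> set fs \<Longrightarrow> homogeneous_factor fac"
    and xs: "homogeneous V (sum_list (map fst fs)) xs"
  shows "comp_tensor scale F fs xs \<in> W (e + sum_list (map (\<lambda>(_, d, _). d) fs) + total_degree xs)"
  using graded_hom_degree[OF F, of "tensor_values fs xs"] tensor_values_homogeneous[of fs, OF fs xs] xs
  by (auto simp: comp_tensor_def homogeneous_def add.assoc intro!: subspace_scale[OF W])

text \<open>
  An inhomogeneous block must not be hidden from the outer map: its value is either \<open>0\<close> or again
  inhomogeneous. Graded maps satisfy the first alternative, the identity the second.
\<close>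

definition detects_homogeneity :: "'v factor \<Rightarrow> bool" where
  "detects_homogeneity = (\<lambda>(m, d, f). \<forall>xs. length xs = m \<and> \<not> homogeneous V m xs \<longrightarrow>
     f xs = 0 \<or> f xs \<notin> V (d + total_degree xs))"

lemma detects_homogeneity_id_factor: "detects_homogeneity id_factor"
  by (auto simp: detects_homogeneity_def id_factor_def homogeneous_def length_Suc_conv)

lemma tensor_values_inhomogeneous:
  assumes "\<And>fac. fac \<in> set fs \<Longrightarrow> detects_homogeneity fac"
    and "length xs = sum_list (map fst fs)" and "\<not> homogeneous V (length xs) xs"
  shows "(\<exists>p. (p, 0) \<in> set (tensor_values fs xs)) \<or> \<not> homogeneous V (length fs) (tensor_values fs xs)"
  using assms
proof (induction fs arbitrary: xs)
  case Nil
  then show ?case by (simp add: homogeneous_def)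
next
  case (Cons fac fs)
  obtain m d f where fac: "fac = (m, d, f)" by (cases fac)
  have xs: "xs = take m xs @ drop m xs" by simp
  have len: "length (take m xs) = m" using Cons.prems(2) fac by simp
  show ?case
  proof (cases "homogeneous V m (take m xs)")
    case True
    have "\<not> homogeneous V (length (drop m xs)) (drop m xs)"
      using Cons.prems(3) True set_append[of "take m xs" "drop m xs"] by (auto simp: homogeneous_def ball_Un)
    then show ?thesis using Cons.IH[of "drop m xs"] Cons.prems fac by (auto simp: homogeneous_def)
  next
    case False
    then have "f (take m xs) = 0 \<or> f (take m xs) \<notin> V (d + total_degree (take m xs))"
      using Cons.prems(1)[of fac] len by (auto simp: fac detects_homogeneity_def)
    then show ?thesis by (auto simp: fac homogeneous_def)
  qed
qed

lemma comp_tensor_inhomogeneous: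
  assumes F: "F \<in> graded_hom scale V W (length fs) e"
    and "\<And>fac. fac \<in> set fs \<Longrightarrow> detects_homogeneity fac"
    and "\<not> homogeneous V (sum_list (map fst fs)) xs"
  shows "comp_tensor scale F fs xs = 0"
proof (cases "length xs = sum_list (map fst fs)")
  case True
  then have "(\<exists>p. (p, 0) \<in> set (tensor_values fs xs)) \<or> \<not> homogeneous V (length fs) (tensor_values fs xs)"
    using assms(2,3) by (intro tensor_values_inhomogeneous) auto
  then have "F (tensor_values fs xs) = 0"
    using graded_hom_off[OF F] graded_hom_zero_slot[OF F] by (metis split_list)
  then show ?thesis by (simp add: comp_tensor_def)
qed (simp add: comp_tensor_def)

lemma homogeneous_permute_list:
  "\<sigma> permutes {..<length xs} \<Longrightarrow> homogeneous V n (permute_list \<sigma> xs) \<longleftrightarrow> homogeneous V n xs"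
  by (auto simp: homogeneous_def)

text \<open>
  The vanishing results are needed because Maurer-Cartan elements are subject to equations between functions on
  all lists, whereas the homotopy equations are imposed on homogeneous lists only.
\<close>

lemma comp_perm_inhomogeneous:
  assumes "\<sigma> permutes {..<n}" and "\<And>ys. \<not> homogeneous V n ys \<Longrightarrow> f ys = 0" and "\<not> homogeneous V n xs"
  shows "comp_perm scale f \<sigma> xs = 0"
proof -
  have "\<not> homogeneous V n (permute_list \<sigma> xs)"
    using assms(1,3) homogeneous_permute_list[of \<sigma> xs n] by (cases "length xs = n") (auto simp: homogeneous_def)
  then show ?thesis using assms(2) by (simp add: comp_perm_def)
qed

end

section \<open>Shuffles and composition of permuted maps\<close>

lemma finite_shuffles_of [simp]: "finite (shuffles_of ns)"
  unfolding shuffles_of_def by (rule finite_subset[OF _ finite_permutations[of "{..<sum_list ns}"]]) auto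

lemma finite_ordered_shuffles [simp]: "finite (ordered_shuffles k ns)"
  unfolding ordered_shuffles_def by simp

lemma shuffles_of_permutes: "\<sigma> \<in> shuffles_of ns \<Longrightarrow> \<sigma> permutes {..<sum_list ns}"
  by (simp add: shuffles_of_def)

lemma ordered_shuffles_permutes: "\<sigma> \<in> ordered_shuffles k ns \<Longrightarrow> \<sigma> permutes {..<sum_list ns}"
  by (simp add: ordered_shuffles_def shuffles_of_def)

lemma ordered_shuffles_one [simp]: "ordered_shuffles (Suc 0) ns = shuffles_of ns"
  by (auto simp: ordered_shuffles_def)

lemma block_start_append: "j \<le> length ms \<Longrightarrow> block_start (ms @ ns) j = block_start ms j"
  by (simp add: block_start_def)

lemma block_start_length [simp]: "block_start ms (length ms) = sum_list ms"
  by (simp add: block_start_def)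

lemma block_start_Suc: "j < length ms \<Longrightarrow> block_start ms (Suc j) = block_start ms j + ms ! j"
  by (simp add: block_start_def take_Suc_conv_app_nth)

lemma block_start_le: "block_start ms j \<le> sum_list ms"
  unfolding block_start_def by (metis append_take_drop_id le_add1 sum_list_append)

lemma block_start_less:
  assumes "j < length ms" "0 \<notin> set ms" shows "block_start ms j < sum_list ms"
proof -
  have "ms ! j \<noteq> 0" using assms by (metis nth_mem)
  then show ?thesis using block_start_le[of ms "Suc j"] block_start_Suc[of j ms] assms by simp
qed

lemma shuffles_of_append_one:
  "\<sigma> \<in> shuffles_of (ms @ [r]) \<longleftrightarrow> \<sigma> permutes {..<sum_list ms + r} \<and>
     (\<forall>j < length ms. strict_mono_on {block_start ms j ..< block_start ms (Suc j)} \<sigma>) \<and>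
     strict_mono_on {sum_list ms ..< sum_list ms + r} \<sigma>"
  by (auto simp: shuffles_of_def less_Suc_eq block_start_append all_conj_distrib)
    (auto simp: block_start_def)

text \<open>
  In a brace that uses all inputs of the outer map, the block of remaining inputs is empty.
\<close>

lemma ordered_shuffles_append_zero:
  assumes "k \<le> length ms" shows "ordered_shuffles k (ms @ [0]) = ordered_shuffles k ms"
proof -
  have "shuffles_of (ms @ [0]) = shuffles_of ms"
    by (auto simp: shuffles_of_append_one) (auto simp: shuffles_of_def)
  then show ?thesis using assms by (auto simp: ordered_shuffles_def block_start_append)
qed

lemma strict_mono_permutes_id:
  fixes \<rho> :: "nat \<Rightarrow> nat"
  assumes p: "\<rho> permutes {..<m}" and mono: "strict_mono_on {..<m} \<rho>"
  shows "\<rho> = id"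
proof -
  have incr: "i \<le> f i" if "f permutes {..<m}" "strict_mono_on {..<m} f" "i < m" for f i
    using that(3)
  proof (induction i)
    case (Suc i)
    then have "f i < f (Suc i)" using that(2) by (simp add: strict_mono_on_def)
    then show ?case using Suc by simp
  qed simp
  have q: "inv \<rho> permutes {..<m}" by (rule permutes_inv[OF p])
  have "strict_mono_on {..<m} (inv \<rho>)"
  proof (rule strict_mono_onI)
    fix a b assume ab: "a \<in> {..<m}" "b \<in> {..<m}" "a < b"
    then have "inv \<rho> a \<in> {..<m}" "inv \<rho> b \<in> {..<m}" using permutes_in_image[OF q] by blast+
    then show "inv \<rho> a < inv \<rho> b"
      using strict_mono_on_less[OF mono, of "inv \<rho> a" "inv \<rho> b"] ab by (simp add: permutes_inverses[OF p])
  qed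
  note incr_inv = incr[OF q this]
  have "\<rho> i = i" for i
  proof (cases "i < m")
    case True
    then have "\<rho> i < m" using permutes_in_image[OF p] by auto
    from incr_inv[OF this] have "\<rho> i \<le> i" by (simp add: permutes_inverses[OF p])
    then show ?thesis using incr[OF p mono True] by simp
  next
    case False
    then show ?thesis using p by (simp add: permutes_not_in)
  qed
  then show ?thesis by auto
qed

lemma shuffles_of_two:
  "\<sigma> \<in> shuffles_of [m, r] \<longleftrightarrow> \<sigma> permutes {..<m + r} \<and>
     strict_mono_on {..<m} \<sigma> \<and> strict_mono_on {m..<m + r} \<sigma>"
  using shuffles_of_append_one[of \<sigma> "[m]" r] by (simp add: block_start_def lessThan_atLeast0)

text \<open>
  \<open>\<sigma>\<close> is increasing on the first \<open>sum_list ms\<close> positions, which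
  \<open>\<tau>\<close> permutes among themselves, so every order condition on
  \<open>\<sigma> \<circ> \<tau>\<close> within and between these blocks is one on \<open>\<tau>\<close>.
  Blocks have to be nonempty for their starting points to lie among the first \<open>sum_list ms\<close>
  positions.
\<close>

lemma ordered_shuffles_factor:
  assumes s: "\<sigma> \<in> shuffles_of [sum_list ms, r]" and t: "\<tau> permutes {..<sum_list ms}"
    and k: "k \<le> length ms" and pos: "0 \<notin> set ms"
  shows "\<sigma> \<circ> \<tau> \<in> ordered_shuffles k (ms @ [r]) \<longleftrightarrow> \<tau> \<in> ordered_shuffles k ms"
proof -
  let ?m = "sum_list ms"
  have sp: "\<sigma> permutes {..<?m + r}" and s1: "strict_mono_on {..<?m} \<sigma>" and s2: "strict_mono_on {?m..<?m + r} \<sigma>"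
    using s by (auto simp: shuffles_of_two)
  have less: "\<sigma> (\<tau> a) < \<sigma> (\<tau> b) \<longleftrightarrow> \<tau> a < \<tau> b" if "a < ?m" "b < ?m" for a b
  proof -
    have "\<tau> a \<in> {..<?m}" "\<tau> b \<in> {..<?m}" using permutes_in_image[OF t] that by blast+
    then show ?thesis by (rule strict_mono_on_less[OF s1])
  qed
  have "strict_mono_on {?m..<?m + r} (\<sigma> \<circ> \<tau>)"
    using s2 t by (auto simp: strict_mono_on_def permutes_not_in)
  moreover have "(\<sigma> \<circ> \<tau>) permutes {..<?m + r}"
    using sp permutes_subset[OF t, of "{..<?m + r}"] by (auto intro: permutes_compose)
  moreover have "strict_mono_on {block_start ms j ..< block_start ms (Suc j)} (\<sigma> \<circ> \<tau>) \<longleftrightarrow>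
      strict_mono_on {block_start ms j ..< block_start ms (Suc j)} \<tau>" for j
    using block_start_le[of ms "Suc j"] less by (auto simp: strict_mono_on_def)
  moreover have "(\<sigma> \<circ> \<tau>) (block_start ms i) < (\<sigma> \<circ> \<tau>) (block_start ms j) \<longleftrightarrow>
      \<tau> (block_start ms i) < \<tau> (block_start ms j)" if "i < k" "j < k" for i j
    using that k pos by (auto intro!: less block_start_less)
  ultimately show ?thesis
    using t k by (auto simp: ordered_shuffles_def shuffles_of_append_one block_start_append)
      (auto simp: shuffles_of_def)
qed

text \<open>
  \<open>\<sigma>\<close> lists the values of \<open>\<pi>\<close> on the first \<open>m\<close> positions in
  increasing order, and \<open>\<tau>\<close> records their original order.
\<close>

lemma shuffle_factorization:
  fixes \<pi> :: "nat \<Rightarrow> nat"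
  assumes p: "\<pi> permutes {..<m + r}" and mono: "strict_mono_on {m..<m + r} \<pi>"
  obtains \<sigma> \<tau> where "\<sigma> \<in> shuffles_of [m, r]" "\<tau> permutes {..<m}" "\<pi> = \<sigma> \<circ> \<tau>"
proof -
  have inj: "inj \<pi>" using p by (rule permutes_inj)
  define A where "A = \<pi> ` {..<m}"
  have A: "finite A" "card A = m"
    using inj by (auto simp: A_def card_image inj_on_subset)
  obtain h where h: "bij_betw h {..<m} A" "strict_mono_on {..<m} h"
    using ex_bij_betw_strict_mono_card[OF A(1)] A(2) by auto
  define \<sigma> where "\<sigma> i = (if i < m then h i else \<pi> i)" for i
  have "bij_betw \<sigma> ({..<m} \<union> {m..<m + r}) (A \<union> \<pi> ` {m..<m + r})"
  proof (rule bij_betw_combine)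
    show "bij_betw \<sigma> {..<m} A" using h(1) bij_betw_cong[of "{..<m}" \<sigma> h A] by (simp add: \<sigma>_def)
    show "bij_betw \<sigma> {m..<m + r} (\<pi> ` {m..<m + r})"
      by (auto simp: \<sigma>_def bij_betw_def inj_on_def inj_eq[OF inj])
    show "A \<inter> \<pi> ` {m..<m + r} = {}" by (auto simp: A_def inj_eq[OF inj])
  qed
  moreover have "{..<m} \<union> {m..<m + r} = {..<m + r}" by auto
  moreover have "A \<union> \<pi> ` {m..<m + r} = {..<m + r}"
    unfolding A_def image_Un[symmetric] calculation(2) using p by (rule permutes_image)
  ultimately have "bij_betw \<sigma> {..<m + r} {..<m + r}" by simp
  then have sp: "\<sigma> permutes {..<m + r}"
    using p by (intro bij_imp_permutes) (auto simp: \<sigma>_def permutes_not_in)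
  have "strict_mono_on {..<m} \<sigma>" using h(2) by (auto simp: \<sigma>_def strict_mono_on_def)
  moreover have "strict_mono_on {m..<m + r} \<sigma>" using mono by (auto simp: \<sigma>_def strict_mono_on_def)
  ultimately have s: "\<sigma> \<in> shuffles_of [m, r]" using sp by (simp add: shuffles_of_two)
  have "(inv \<sigma> \<circ> \<pi>) permutes {..<m}"
  proof (rule permutes_superset)
    show "(inv \<sigma> \<circ> \<pi>) permutes {..<m + r}" using p permutes_inv[OF sp] by (rule permutes_compose)
    fix i assume "i \<in> {..<m + r} - {..<m}"
    then have "\<pi> i = \<sigma> i" by (simp add: \<sigma>_def)
    then show "(inv \<sigma> \<circ> \<pi>) i = i" by (simp add: permutes_inverses[OF sp])
  qed
  moreover have "\<pi> = \<sigma> \<circ> (inv \<sigma> \<circ> \<pi>)" by (auto simp: permutes_inverses[OF sp])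
  ultimately show ?thesis using s that by blast
qed

text \<open>
  Two factorizations differ by a permutation of the first \<open>m\<close> positions that is strictly
  increasing.
\<close>

lemma shuffle_factorization_unique:
  assumes s: "\<sigma> \<in> shuffles_of [m, r]" "\<sigma>' \<in> shuffles_of [m, r]"
    and t: "\<tau> permutes {..<m}" "\<tau>' permutes {..<m}" and eq: "\<sigma> \<circ> \<tau> = \<sigma>' \<circ> \<tau>'"
  shows "\<sigma> = \<sigma>' \<and> \<tau> = \<tau>'"
proof -
  \<comment> \<open>\<open>\<rho>\<close> compares the two factorizations: \<open>\<sigma> = \<sigma>' \<circ> \<rho>\<close>.\<close>
  define \<rho> where "\<rho> = \<tau>' \<circ> inv \<tau>"
  have \<rho>: "\<rho> permutes {..<m}" unfolding \<rho>_def using t permutes_inv by (intro permutes_compose) auto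
  have \<sigma>: "\<sigma> i = \<sigma>' (\<rho> i)" for i
    using fun_cong[OF eq, of "inv \<tau> i"] by (simp add: \<rho>_def permutes_inverses[OF t(1)])
  have m: "strict_mono_on {..<m} \<sigma>" "strict_mono_on {..<m} \<sigma>'" using s by (auto simp: shuffles_of_two)
  have "strict_mono_on {..<m} \<rho>"
  proof (rule strict_mono_onI)
    fix a b assume ab: "a \<in> {..<m}" "b \<in> {..<m}" "a < b"
    then have "\<rho> a \<in> {..<m}" "\<rho> b \<in> {..<m}" using permutes_in_image[OF \<rho>] by blast+
    then show "\<rho> a < \<rho> b"
      using strict_mono_on_less[OF m(2), of "\<rho> a" "\<rho> b"] strict_mono_onD[OF m(1) ab] by (simp add: \<sigma>)
  qed
  with \<rho> have "\<rho> = id" by (rule strict_mono_permutes_id)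
  then have "\<sigma> = \<sigma>'" using \<sigma> by auto
  moreover from this have "\<tau> i = \<tau>' i" for i
  proof -
    have "\<sigma>' (\<tau> i) = \<sigma>' (\<tau>' i)" using fun_cong[OF eq, of i] \<open>\<sigma> = \<sigma>'\<close> by simp
    then show ?thesis using injD[OF permutes_inj[OF shuffles_of_permutes[OF s(2)]]] by blast
  qed
  ultimately show ?thesis by auto
qed

text \<open>
  This replaces the double sum over shuffles in a nested brace by a single sum.
\<close>

lemma bij_betw_shuffle_composition:
  assumes k: "k \<le> length ms" and pos: "0 \<notin> set ms"
  shows "bij_betw (\<lambda>(\<sigma>, \<tau>). \<sigma> \<circ> \<tau>) (shuffles_of [sum_list ms, r] \<times> ordered_shuffles k ms)
    (ordered_shuffles k (ms @ [r]))"
  unfolding bij_betw_def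
proof (intro conjI equalityI subsetI)
  show "inj_on (\<lambda>(\<sigma>, \<tau>). \<sigma> \<circ> \<tau>) (shuffles_of [sum_list ms, r] \<times> ordered_shuffles k ms)"
    by (rule inj_onI) (auto dest!: shuffle_factorization_unique[OF _ _ ordered_shuffles_permutes ordered_shuffles_permutes, rotated 4] simp del: o_apply)
next
  fix \<pi> assume "\<pi> \<in> (\<lambda>(\<sigma>, \<tau>). \<sigma> \<circ> \<tau>) ` (shuffles_of [sum_list ms, r] \<times> ordered_shuffles k ms)"
  then show "\<pi> \<in> ordered_shuffles k (ms @ [r])"
    using ordered_shuffles_factor[OF _ ordered_shuffles_permutes k pos] by auto
next
  fix \<pi> assume \<pi>: "\<pi> \<in> ordered_shuffles k (ms @ [r])"
  then obtain \<sigma> \<tau> where st: "\<sigma> \<in> shuffles_of [sum_list ms, r]" "\<tau> permutes {..<sum_list ms}" "\<pi> = \<sigma> \<circ> \<tau>"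
    using shuffle_factorization[of \<pi> "sum_list ms" r]
    by (auto simp: ordered_shuffles_def shuffles_of_append_one)
  then have "\<tau> \<in> ordered_shuffles k ms" using ordered_shuffles_factor[OF st(1,2) k pos] \<pi> by simp
  then show "\<pi> \<in> (\<lambda>(\<sigma>, \<tau>). \<sigma> \<circ> \<tau>) ` (shuffles_of [sum_list ms, r] \<times> ordered_shuffles k ms)"
    using st by auto
qed

text \<open>
  A permutation of the first \<open>m\<close> positions has all its inversions there.
\<close>

lemma koszul_sign_take:
  assumes t: "\<tau> permutes {..<m}" and "m \<le> length ds"
  shows "koszul_sign \<tau> (take m ds) = koszul_sign \<tau> ds"
  unfolding koszul_sign_def
proof (rule prod.cong)
  have in_m: "\<tau> i < m \<longleftrightarrow> i < m" for i using permutes_in_image[OF t] by auto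
  have lt_m: "j < m" if "i < j" "\<tau> j < \<tau> i" for i j
    using that permutes_not_in[OF t, of i] permutes_not_in[OF t, of j] in_m[of i] in_m[of j]
    by (metis lessThan_iff not_less_iff_gr_or_eq order.strict_trans)
  then show "{(i, j). i < j \<and> j < length (take m ds) \<and> \<tau> j < \<tau> i} = {(i, j). i < j \<and> j < length ds \<and> \<tau> j < \<tau> i}"
    using assms(2) by (auto dest: lt_m intro: order.strict_trans2)
  fix x assume "x \<in> {(i, j). i < j \<and> j < length ds \<and> \<tau> j < \<tau> i}"
  then obtain i j where x: "x = (i, j)" "i < j" "\<tau> j < \<tau> i" by blast
  with lt_m[of i j] have "\<tau> i < m" "\<tau> j < m" by (simp_all add: in_m)
  then show "(case x of (i, j) \<Rightarrow> (-1) powi (take m ds ! \<tau> i * take m ds ! \<tau> j)) =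
      (case x of (i, j) \<Rightarrow> (-1) powi (ds ! \<tau> i * ds ! \<tau> j))"
    by (simp add: x)
qed

lemma permute_list_prefix:
  assumes t: "\<tau> permutes {..<m}" and "m \<le> length xs"
  shows "permute_list \<tau> xs = permute_list \<tau> (take m xs) @ drop m xs"
proof (rule nth_equalityI)
  fix i assume i: "i < length (permute_list \<tau> xs)"
  have t': "\<tau> permutes {..<length xs}" by (rule permutes_subset[OF t]) (use assms(2) in auto)
  have in_m: "\<tau> i < m \<longleftrightarrow> i < m" for i using permutes_in_image[OF t] by auto
  show "permute_list \<tau> xs ! i = (permute_list \<tau> (take m xs) @ drop m xs) ! i"
    using i assms in_m[of i] permutes_not_in[OF t, of i]
    by (auto simp: permute_list_nth[OF t'] nth_append permute_list_def)
qed (use assms in auto)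

lemma total_degree_permute_list:
  "\<sigma> permutes {..<length xs} \<Longrightarrow> total_degree (permute_list \<sigma> xs) = total_degree xs"
  by (metis mset_map mset_permute_list sum_mset_sum_list)

lemma koszul_sign_nonzero [simp]: "koszul_sign \<sigma> ds \<noteq> (0 :: 'k::field)"
  unfolding koszul_sign_index_pairs by (auto simp: power_int_minus_left split: if_splits)

lemma id_factor_simps [simp]: "fst id_factor = 1" "(case id_factor of (m, e, f) \<Rightarrow> e) = 0"
  by (simp_all add: id_factor_def)

lemma tensor_id_factors:
  "length xs = r \<Longrightarrow> tensor_values (replicate r id_factor) xs = xs"
  "length xs = r \<Longrightarrow> tensor_sign (replicate r id_factor) xs = (1 :: 'k::field)"
  by (induction xs arbitrary: r) (auto simp: id_factor_def sum_list_replicate)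

context graded_vector_space
begin

lemma comp_perm_comp_perm:
  assumes "\<sigma> permutes {..<length xs}" "\<tau> permutes {..<length xs}"
  shows "comp_perm scale (comp_perm scale f \<tau>) \<sigma> xs = comp_perm scale f (\<sigma> \<circ> \<tau>) xs"
  using koszul_sign_compose[of \<sigma> "map fst xs" \<tau>, where ?'k = 'k] assms
  by (simp add: comp_perm_def permute_list_compose permute_list_map mult.commute del: o_apply)

lemma comp_perm_sum:
  "comp_perm scale (\<lambda>xs. \<Sum>i\<in>I. f i xs) \<sigma> xs = (\<Sum>i\<in>I. comp_perm scale (f i) \<sigma> xs)"
  by (simp add: comp_perm_def scale_sum_right)

lemma comp_perm_cong:
  assumes "\<sigma> permutes {..<length xs}" "homogeneous V n xs" "\<And>ys. homogeneous V n ys \<Longrightarrow> f ys = g ys"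
  shows "comp_perm scale f \<sigma> xs = comp_perm scale g \<sigma> xs"
  using assms homogeneous_permute_list[OF assms(1), of n] by (simp add: comp_perm_def)

lemma comp_tensor_head:
  "comp_tensor scale G ((m, d, f) # replicate r id_factor) xs =
    (if length xs = m + r then G ((d + total_degree (take m xs), f (take m xs)) # drop m xs) else 0)"
  by (simp add: comp_tensor_def tensor_id_factors sum_list_replicate)

text \<open>
  A permutation inside the first factor can be carried out on the whole list, with the same Koszul sign.
\<close>

lemma comp_tensor_head_perm:
  assumes G: "slot_scaling G" and t: "\<tau> permutes {..<m}" and xs: "length xs = m + r"
  shows "comp_tensor scale G ((m, d, comp_perm scale f \<tau>) # replicate r id_factor) xs =
    comp_perm scale (comp_tensor scale G ((m, d, f) # replicate r id_factor)) \<tau> xs"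
proof -
  have t': "\<tau> permutes {..<length (take m xs)}" using t xs by simp
  have p: "permute_list \<tau> xs = permute_list \<tau> (take m xs) @ drop m xs"
    using t xs by (intro permute_list_prefix) auto
  have k: "koszul_sign \<tau> (map fst (take m xs)) = (koszul_sign \<tau> (map fst xs) :: 'k)"
    using koszul_sign_take[of \<tau> m "map fst xs"] t xs by (simp add: take_map)
  show ?thesis
    using G[unfolded slot_scaling_def, rule_format, of _ "[]"] xs
    by (simp add: comp_tensor_head comp_perm_def p k total_degree_permute_list[OF t'])
qed

lemma comp_tensor_head_sum:
  assumes G: "G \<in> graded_hom scale V W n e" and I: "finite I"
    and f: "\<And>i. i \<in> I \<Longrightarrow> homogeneous_factor (m, d, f i)" and xs: "homogeneous V (m + r) xs"
  shows "comp_tensor scale G ((m, d, \<lambda>ys. \<Sum>i\<in>I. f i ys) # replicate r id_factor) xs =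
    (\<Sum>i\<in>I. comp_tensor scale G ((m, d, f i) # replicate r id_factor) xs)"
proof -
  have len: "length xs = m + r" using xs by (simp add: homogeneous_def)
  have "homogeneous V m (take m xs)" using xs by (auto simp: homogeneous_def dest: in_set_takeD)
  then have "\<And>i. i \<in> I \<Longrightarrow> f i (take m xs) \<in> V (d + total_degree (take m xs))"
    using f by (auto simp: homogeneous_factor_def)
  then show ?thesis
    using graded_hom_sum_slot[OF G I, of _ _ "[]"] by (simp add: comp_tensor_head len)
qed

lemma homogeneous_factor_comp_perm:
  assumes f: "homogeneous_factor (m, d, f)" and t: "\<tau> permutes {..<m}"
  shows "homogeneous_factor (m, d, comp_perm scale f \<tau>)"
  unfolding homogeneous_factor_def prod.case
proof (intro allI impI)
  fix xs assume xs: "homogeneous V m xs"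
  then have t': "\<tau> permutes {..<length xs}" using t by (simp add: homogeneous_def)
  then show "comp_perm scale f \<tau> xs \<in> V (d + total_degree xs)"
    using f xs by (auto simp: homogeneous_factor_def comp_perm_def homogeneous_permute_list
        total_degree_permute_list[OF t', symmetric] intro!: component_closed)
qed

lemma homogeneous_factor_comp_tensor:
  assumes F: "F \<in> graded_hom scale V V (length fs) e" and fs: "\<And>fac. fac \<in> set fs \<Longrightarrow> homogeneous_factor fac"
  shows "homogeneous_factor (sum_list (map fst fs), e + sum_list (map (\<lambda>(_, d, _). d) fs), comp_tensor scale F fs)"
  using comp_tensor_degree[OF F subspace_component fs] by (simp add: homogeneous_factor_def)

end

section \<open>The Maurer-Cartan series\<close>

lemma sum_fun_apply: "(\<Sum>i\<in>I. f i) x = (\<Sum>i\<in>I. f i x)"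
  by (induction I rule: infinite_finite_induct) auto

definition restrict_arity :: "nat \<Rightarrow> 'v::zero family \<Rightarrow> 'v family" where
  "restrict_arity n f = (\<lambda>j. if j = n then f j else 0)"

text \<open>
  The left side \<open>\<Sum>\<^sub>n sh\<^sub>n{sg, \<dots>, sg}\<close> of the Maurer-Cartan equation for
  the operator part. All arguments have arity at least \<open>1\<close>, so the components
  \<open>sh\<^sub>n\<close> with \<open>n > a\<close> do not contribute in arity \<open>a\<close>.
\<close>

definition full_braces ::
  "('k::field \<Rightarrow> 'v::ab_group_add \<Rightarrow> 'v) \<Rightarrow> 'v family \<Rightarrow> 'v family \<Rightarrow> 'v family" where
  "full_braces scale sh g a ys =
     (\<Sum>n = 1..a. brace scale (restrict_arity n sh) (replicate n (0, g)) a ys)"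

text \<open>
  The right side
  \<open>\<Sum>\<^bsub>m \<le> n\<^esub> \<lambda>\<^bsup>n-m\<^esup> sg{sh\<^sub>n{sg, \<dots>, sg}}\<close>.
  The degrees are those of maps into \<open>sV\<close>: \<open>sg\<close> has degree \<open>0\<close> and the
  inner brace has the degree \<open>-1\<close> of \<open>sh\<close>.
\<close>

definition nested_braces ::
  "('k::field \<Rightarrow> 'v::ab_group_add \<Rightarrow> 'v) \<Rightarrow> 'k \<Rightarrow> 'v family \<Rightarrow> 'v family \<Rightarrow> 'v family" where
  "nested_braces scale lam sh g a ys =
     (\<Sum>n = 1..a. \<Sum>m = 1..n. scale (lam ^ (n - m))
        (brace scale g [(-1, brace scale (restrict_arity n sh) (replicate (m - 1) (0, g)))] a ys))"

text \<open>
  The Koszul sign of odd elements is the signature, so the two signs cancel.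
\<close>

lemma chi_sign_minus_ones:
  assumes "\<tau> permutes {..<m}" shows "chi_sign \<tau> (replicate m (-1)) = (1 :: 'k::field)"
proof -
  have in_m: "\<tau> i < m" if "i < m" for i using permutes_in_image[OF assms] that by auto
  have "koszul_sign \<tau> (replicate m (-1)) = (koszul_sign \<tau> (replicate m 1) :: 'k)"
    unfolding koszul_sign_index_pairs by (rule prod.cong) (auto simp: index_pairs_def in_m)
  then have "chi_sign \<tau> (replicate m (-1)) = (of_int (sign \<tau> * sign \<tau>) :: 'k)"
    by (simp add: chi_sign_def koszul_sign_ones[OF assms] del: sign_idempotent)
  then show ?thesis by (simp only: sign_idempotent of_int_1)
qed

text \<open>
  The exponent \<open>m + (1 + \<dots> + (m - 1))\<close> in the brackets is
  \<open>m (m + 1) / 2\<close>, which is the exponent in the Maurer-Cartan series for the bracket with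
  \<open>m + 1\<close> arguments.
\<close>

lemma maurer_cartan_coefficient:
  "(-1 :: 'k::field_char_0) ^ (Suc m * m div 2) *
     (-1) powi (int m * (-1) + (\<Sum>k = 1..m - 1. sum_list (take k (replicate m (-1))))) = 1"
proof -
  have "(\<Sum>k = 1..m - 1. sum_list (take k (replicate m (-1)))) = - int (\<Sum>k = 1..m - 1. k)"
    unfolding of_nat_sum sum_negf[symmetric] by (intro sum.cong refl) (auto simp: sum_list_replicate)
  also have "int m * (-1) + \<dots> = - int (\<Sum>k = 1..m. k)"
    by (cases m) simp_all
  also have "(\<Sum>k = 1..m. k) = Suc m * m div 2"
    using gauss_sum_from_Suc_0[of m, where ?'a = nat] by (simp add: mult.commute)
  finally show ?thesis by (simp add: minus_one_power_iff power_int_minus_left)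
qed

context graded_vector_space
begin

text \<open>
  The contribution, up to a common sign, of every permutation to the bracket of \<open>sh\<^sub>n\<close> with
  \<open>m\<close> copies of \<open>g\<close>; the cases \<open>n = m\<close> and \<open>n > m\<close> of
  that bracket are merged, since \<open>\<lambda>\<^sup>0 = 1\<close>.
\<close>

abbreviation mixed_term :: "'k \<Rightarrow> 'v family \<Rightarrow> 'v family \<Rightarrow> nat \<Rightarrow> nat \<Rightarrow> nat \<Rightarrow> 'v mmap" where
  "mixed_term lam sh g m n b ys \<equiv>
     (if m = 0 \<or> n < m then 0
      else (if n = m then brace scale (restrict_arity n sh) (replicate m (0, g)) b ys else 0) -
        scale (lam ^ (n - m))
          (brace scale g [(-1, brace scale (restrict_arity n sh) (replicate (m - 1) (0, g)))] b ys))"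

lemma mixed_bracket_arity_diagonal:
  "mixed_bracket_arity scale lam n (-1, restrict_arity n sh) (replicate m (-1, g)) b ys =
    scale (fact m * (-1) powi (int m * (-1) + (\<Sum>k = 1..m - 1. sum_list (take k (replicate m (-1))))))
      (mixed_term lam sh g m n b ys)"
proof (cases "m = 0 \<or> n < m")
  case True
  then show ?thesis by (simp add: mixed_bracket_arity_def Let_def)
next
  case False
  define s :: 'k where "s = (-1) powi (int m * (-1) + (\<Sum>k = 1..m - 1. sum_list (take k (replicate m (-1)))))"
  have tl: "tl (replicate m x) = replicate (m - 1) x" for x :: "int \<times> 'v family" by (cases m) auto
  have "mixed_bracket_arity scale lam n (-1, restrict_arity n sh) (replicate m (-1, g)) b ys =
      (\<Sum>\<tau> | \<tau> permutes {..<m}. scale s (mixed_term lam sh g m n b ys))"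
    using False
    by (auto simp: mixed_bracket_arity_def Let_def sum_fun_apply s_def chi_sign_minus_ones family_scale_def
        tl sum_list_replicate scale_minus_left scale_right_diff_distrib power_int_add intro!: sum.cong)
  also have "\<dots> = scale (fact m) (scale s (mixed_term lam sh g m n b ys))"
    unfolding sum_constant_scale by (simp add: card_permutations)
  finally show ?thesis by (simp add: s_def)
qed

text \<open>
  Moving \<open>sh\<close> past \<open>k\<close> copies of \<open>g\<close>, all of degree \<open>-1\<close>,
  costs \<open>(-1)\<^bsup>k + k\<^esup> = 1\<close>.
\<close>

lemma C_RBL_bracket_diagonal:
  "C_RBL_bracket scale lam (replicate (Suc m) (-1, sh, g)) =
    (if m = 1 then brace scale sh [(-1, sh)] + brace scale sh [(-1, sh)] else 0,
     \<Sum>k < Suc m. mixed_bracket scale lam (-1, sh) (replicate m (-1, g)))"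
proof -
  have fs1: "family_scale scale 1 f = f" for f by (simp add: family_scale_def)
  have "take k (replicate (Suc m) x) @ drop (Suc k) (replicate (Suc m) x) = replicate m x" if "k < Suc m"
    for k and x :: "int \<times> 'v family"
    using that by (simp add: min_def replicate_add[symmetric] del: replicate.simps)
  moreover have "(-1 :: 'k) powi (-1 * total_degree (take k (replicate (Suc m) (-1 :: int, g))) + int k) = 1"
    if "k < Suc m" for k
    using that by (simp add: min_def sum_list_replicate power_int_minus_left del: replicate.simps)
  ultimately have "(\<Sum>k < Suc m. family_scale scale
        ((-1) powi (fst (replicate (Suc m) (-1, sh) ! k) * total_degree (take k (replicate (Suc m) (-1, g))) + int k))
        (mixed_bracket scale lam (replicate (Suc m) (-1, sh) ! k)
          (take k (replicate (Suc m) (-1, g)) @ drop (Suc k) (replicate (Suc m) (-1, g))))) =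
      (\<Sum>k < Suc m. mixed_bracket scale lam (-1, sh) (replicate m (-1, g)))"
    by (intro sum.cong refl) (simp add: fs1 nth_replicate del: replicate.simps)
  moreover have "Lie_bracket scale (-1, sh) (-1, sh) = brace scale sh [(-1, sh)] + brace scale sh [(-1, sh)]"
    by (simp add: Lie_bracket_def family_scale_def fun_eq_iff)
  ultimately show ?thesis
    by (simp add: C_RBL_bracket_def Let_def nth_replicate del: replicate.simps)
qed

definition maurer_cartan_partial_sum :: "'k \<Rightarrow> 'v family \<Rightarrow> 'v family \<Rightarrow> nat \<Rightarrow> 'v family \<times> 'v family" where
  "maurer_cartan_partial_sum lam sh g N =
     (\<Sum>n = 1..N. C_RBL_scale scale ((-1) ^ (n * (n - 1) div 2) / fact n)
        (C_RBL_bracket scale lam (replicate n (-1, (sh, g)))))"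

text \<open>
  In arity \<open>b\<close> only \<open>m \<le> b\<close> copies of \<open>g\<close> contribute, that is,
  brackets with at most \<open>b + 1\<close> arguments. The bound \<open>b + 2\<close> also includes the
  bracket with two arguments, the only one with values in the Lie part, when \<open>b = 0\<close>.
\<close>

lemma maurer_cartan_partial_sum_components:
  assumes N: "b + 2 \<le> N"
  shows "fst (maurer_cartan_partial_sum lam sh g N) b ys = - brace scale sh [(-1, sh)] b ys" (is ?fst)
    and "snd (maurer_cartan_partial_sum lam sh g N) b ys =
      full_braces scale sh g b ys - nested_braces scale lam sh g b ys" (is ?snd)
proof -
  let ?c = "\<lambda>m. (-1) ^ (Suc m * m div 2) / fact (Suc m) :: 'k"
  have sum: "maurer_cartan_partial_sum lam sh g N =
      (\<Sum>m < N. C_RBL_scale scale (?c m) (C_RBL_bracket scale lam (replicate (Suc m) (-1, (sh, g)))))"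
    unfolding maurer_cartan_partial_sum_def
    by (rule sum.reindex_bij_witness[where i = Suc and j = "\<lambda>n. n - 1"]) auto
  have "fst (maurer_cartan_partial_sum lam sh g N) b ys =
      (\<Sum>m < N. if m = 1 then scale (-1/2) (brace scale sh [(-1, sh)] b ys + brace scale sh [(-1, sh)] b ys) else 0)"
    unfolding sum C_RBL_bracket_diagonal fst_sum sum_fun_apply[where I = "{..<N}"] C_RBL_scale_def
    by (intro sum.cong refl) (simp add: family_scale_def)
  also have "\<dots> = - brace scale sh [(-1, sh)] b ys"
    using N unfolding scale_right_distrib scale_left_distrib[symmetric] by simp
  finally show ?fst .
  have mixed: "scale (?c m) ((\<Sum>k < Suc m. mixed_bracket scale lam (-1, sh) (replicate m (-1, g))) b ys) =
      (\<Sum>n = 1..b. mixed_term lam sh g m n b ys)" for m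
  proof -
    let ?s = "(-1) powi (int m * (-1) + (\<Sum>k = 1..m - 1. sum_list (take k (replicate m (-1))))) :: 'k"
    have "(\<Sum>k < Suc m. mixed_bracket scale lam (-1, sh) (replicate m (-1, g))) b ys =
        scale (of_nat (Suc m)) (mixed_bracket scale lam (-1, sh) (replicate m (-1, g)) b ys)"
      unfolding sum_fun_apply sum_constant_scale by simp
    also have "mixed_bracket scale lam (-1, sh) (replicate m (-1, g)) b ys =
        scale (fact m * ?s) (\<Sum>n = 1..b. mixed_term lam sh g m n b ys)"
      by (simp only: mixed_bracket_def prod.case restrict_arity_def[symmetric] mixed_bracket_arity_diagonal
          scale_sum_right)
    finally have "scale (?c m) ((\<Sum>k < Suc m. mixed_bracket scale lam (-1, sh) (replicate m (-1, g))) b ys) =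
        scale (?c m * (of_nat (Suc m) * (fact m * ?s))) (\<Sum>n = 1..b. mixed_term lam sh g m n b ys)"
      by (simp only: scale_scale)
    also have "?c m * (of_nat (Suc m) * (fact m * ?s)) = ((-1) ^ (Suc m * m div 2) * ?s) * (of_nat (Suc m) * fact m / fact (Suc m))"
      by (simp only: divide_inverse mult_ac)
    also have "\<dots> = 1" unfolding maurer_cartan_coefficient fact_Suc[symmetric] by (simp del: fact_Suc)
    finally show ?thesis by simp
  qed
  have "snd (maurer_cartan_partial_sum lam sh g N) b ys = (\<Sum>m < N. \<Sum>n = 1..b. mixed_term lam sh g m n b ys)"
    unfolding sum C_RBL_bracket_diagonal snd_sum sum_fun_apply[where I = "{..<N}"] C_RBL_scale_def
    by (intro sum.cong refl) (simp only: map_prod_def prod.case snd_conv family_scale_def mixed)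
  also have "\<dots> = (\<Sum>n = 1..b. \<Sum>m < N. mixed_term lam sh g m n b ys)"
    by (rule sum.swap)
  also have "\<dots> = (\<Sum>n = 1..b. \<Sum>m = 1..n. mixed_term lam sh g m n b ys)"
    using N by (intro sum.cong refl sum.mono_neutral_right) auto
  also have "\<dots> = full_braces scale sh g b ys - nested_braces scale lam sh g b ys"
    unfolding full_braces_def nested_braces_def sum_subtractf[symmetric]
  proof (intro sum.cong refl)
    fix n assume n: "n \<in> {1..b}"
    let ?b = "\<lambda>m. brace scale (restrict_arity n sh) (replicate m (0, g)) b ys"
    let ?n = "\<lambda>m. scale (lam ^ (n - m))
          (brace scale g [(-1, brace scale (restrict_arity n sh) (replicate (m - 1) (0, g)))] b ys)"
    have "(\<Sum>m = 1..n. mixed_term lam sh g m n b ys) = (\<Sum>m = 1..n. (if m = n then ?b m else 0) - ?n m)"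
      by (intro sum.cong) auto
    also have "\<dots> = ?b n - (\<Sum>m = 1..n. ?n m)"
      using n by (simp add: sum_subtractf)
    finally show "(\<Sum>m = 1..n. mixed_term lam sh g m n b ys) = ?b n - (\<Sum>m = 1..n. ?n m)" .
  qed
  finally show ?snd .
qed

lemma maurer_cartan_iff:
  "(sh, g) \<in> C_RBL_maurer_cartan scale V lam \<longleftrightarrow>
    (sh, g) \<in> C_RBL scale V (-1) \<and>
    (\<forall>a ys. brace scale sh [(-1, sh)] a ys = 0 \<and> full_braces scale sh g a ys = nested_braces scale lam sh g a ys)"
proof -
  let ?P = "\<lambda>N a. maurer_cartan_partial_sum lam sh g N \<in> C_RBL_filtration a"
  have mem: "?P N a \<longleftrightarrow> (\<forall>b \<le> a. \<forall>ys. brace scale sh [(-1, sh)] b ys = 0 \<and>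
      full_braces scale sh g b ys = nested_braces scale lam sh g b ys)" if "a + 2 \<le> N" for a N
  proof -
    have "?P N a \<longleftrightarrow> (\<forall>b \<le> a. \<forall>ys. fst (maurer_cartan_partial_sum lam sh g N) b ys = 0 \<and>
        snd (maurer_cartan_partial_sum lam sh g N) b ys = 0)"
      by (auto simp: C_RBL_filtration_def case_prod_unfold fun_eq_iff)
    also have "\<dots> \<longleftrightarrow> (\<forall>b \<le> a. \<forall>ys. brace scale sh [(-1, sh)] b ys = 0 \<and>
      full_braces scale sh g b ys = nested_braces scale lam sh g b ys)"
      using that by (intro all_cong1 imp_cong refl) (simp add: maurer_cartan_partial_sum_components)
    finally show ?thesis .
  qed
  have "(\<forall>a. \<forall>\<^sub>F N in sequentially. ?P N a) \<longleftrightarrow>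
      (\<forall>a ys. brace scale sh [(-1, sh)] a ys = 0 \<and> full_braces scale sh g a ys = nested_braces scale lam sh g a ys)"
    (is "?L \<longleftrightarrow> ?R")
  proof
    assume L: ?L
    show ?R
    proof (intro allI)
      fix a ys
      from L obtain N0 where "\<And>N. N \<ge> N0 \<Longrightarrow> ?P N a"
        unfolding eventually_sequentially by blast
      then have "?P (max N0 (a + 2)) a" by simp
      then show "brace scale sh [(-1, sh)] a ys = 0 \<and> full_braces scale sh g a ys = nested_braces scale lam sh g a ys"
        using mem[of a "max N0 (a + 2)"] by simp
    qed
  next
    assume R: ?R
    show ?L
    proof
      fix a
      show "\<forall>\<^sub>F N in sequentially. ?P N a"
        using R mem[of a] by (intro eventually_sequentiallyI[of "a + 2"]) simp
    qed
  qed
  then show ?thesis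
    by (simp add: C_RBL_maurer_cartan_def maurer_cartan_elements_def maurer_cartan_partial_sum_def)
qed

end

section \<open>Expansion of the braces\<close>

lemma brace_single:
  "brace scale f [(d, h)] a ys =
    (\<Sum>m = 1..a. \<Sum>\<sigma>\<in>shuffles_of [m, a - m].
      comp_perm scale (comp_tensor scale (f (Suc (a - m))) ((m, d, h m) # replicate (a - m) id_factor)) \<sigma> ys)"
  unfolding brace_def
  by (rule sum.reindex_bij_witness[where i = "\<lambda>m. [m]" and j = hd])
    (auto simp: length_Suc_conv Let_def)

lemma finite_bounded_lists: "finite {ms :: nat list. length ms = k \<and> P ms \<and> sum_list ms \<le> a}"
  by (rule finite_subset[OF _ finite_lists_length_eq[of "{..a}" k]])
    (auto dest: member_le_sum_list)

lemma finite_compositions [simp]: "finite (compositions k n)"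
  by (rule finite_subset[OF _ finite_bounded_lists[of k "\<lambda>_. True" n]]) (auto simp: compositions_def)

abbreviation degree_zero_factors :: "'v family \<Rightarrow> nat list \<Rightarrow> 'v factor list" where
  "degree_zero_factors g ms \<equiv> map (\<lambda>m. (m, 0, g m)) ms"

lemma map2_replicate:
  "length ms = k \<Longrightarrow> map2 (\<lambda>m (d, g). (m, d, g m)) ms (replicate k (0, g)) = degree_zero_factors g ms"
  by (induction ms arbitrary: k) auto

lemma koszul_defect_id_factors [simp]: "koszul_defect (replicate r id_factor) = 0"
  by (induction r) (auto simp: id_factor_def sum_list_replicate)

lemma koszul_defect_degree_zero:
  "koszul_defect (degree_zero_factors g ms @ replicate r id_factor) =
    (\<Sum>j < length ms. int (length ms + r - 1 - j) * (int (ms ! j) - 1))"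
proof (induction ms)
  case (Cons m ms)
  have "sum_list (map (\<lambda>(_, d, _). d) (degree_zero_factors g ms @ replicate r id_factor)) = 0"
    by (simp add: sum_list_replicate comp_def)
  then show ?case using Cons
    by (simp add: sum.lessThan_Suc_shift del: sum.lessThan_Suc)
qed simp

context graded_vector_space
begin

lemma comp_tensor_zero: "comp_tensor scale 0 fs = 0"
  by (rule ext) (simp add: comp_tensor_def)

lemma comp_perm_zero: "comp_perm scale 0 \<sigma> xs = 0"
  by (simp add: comp_perm_def)

text \<open>
  The number of identity factors must be \<open>p - k\<close> for the outer map to have arity
  \<open>p\<close>.
\<close>

lemma brace_restrict_arity:
  assumes "k \<le> p"
  shows "brace scale (restrict_arity p sh) (replicate k (0, g)) a ys =
    (\<Sum>ms | length ms = k \<and> (\<forall>m\<in>set ms. 1 \<le> m) \<and> sum_list ms + (p - k) = a.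
      \<Sum>\<sigma>\<in>ordered_shuffles k (ms @ [p - k]).
        comp_perm scale (comp_tensor scale (sh p) (degree_zero_factors g ms @ replicate (p - k) id_factor)) \<sigma> ys)"
  unfolding brace_def length_replicate
proof (rule sum.mono_neutral_cong_right)
  show "finite {ms. length ms = k \<and> (\<forall>m\<in>set ms. 1 \<le> m) \<and> sum_list ms \<le> a}"
    using finite_bounded_lists[of k "\<lambda>ms. \<forall>m\<in>set ms. 1 \<le> m"] by simp
next
  show "\<forall>ms\<in>{ms. length ms = k \<and> (\<forall>m\<in>set ms. 1 \<le> m) \<and> sum_list ms \<le> a} -
      {ms. length ms = k \<and> (\<forall>m\<in>set ms. 1 \<le> m) \<and> sum_list ms + (p - k) = a}.
     (let r = a - sum_list ms in
        \<Sum>\<sigma>\<in>ordered_shuffles k (ms @ [r]). comp_perm scale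
            (comp_tensor scale (restrict_arity p sh (r + k))
              (map2 (\<lambda>m (d, g). (m, d, g m)) ms (replicate k (0, g)) @ replicate r id_factor)) \<sigma> ys) = 0"
  proof
    fix ms assume "ms \<in> {ms. length ms = k \<and> (\<forall>m\<in>set ms. 1 \<le> m) \<and> sum_list ms \<le> a} -
      {ms. length ms = k \<and> (\<forall>m\<in>set ms. 1 \<le> m) \<and> sum_list ms + (p - k) = a}"
    then have "a - sum_list ms + k \<noteq> p" by auto
    then have "restrict_arity p sh (a - sum_list ms + k) = 0" by (simp add: restrict_arity_def)
    then show "(let r = a - sum_list ms in
        \<Sum>\<sigma>\<in>ordered_shuffles k (ms @ [r]). comp_perm scale
            (comp_tensor scale (restrict_arity p sh (r + k))
              (map2 (\<lambda>m (d, g). (m, d, g m)) ms (replicate k (0, g)) @ replicate r id_factor)) \<sigma> ys) = 0"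
      by (simp add: Let_def comp_tensor_zero comp_perm_zero)
  qed
next
  fix ms assume "ms \<in> {ms. length ms = k \<and> (\<forall>m\<in>set ms. 1 \<le> m) \<and> sum_list ms + (p - k) = a}"
  then have ms: "length ms = k" "a - sum_list ms = p - k" by auto
  show "(let r = a - sum_list ms in
        \<Sum>\<sigma>\<in>ordered_shuffles k (ms @ [r]). comp_perm scale
            (comp_tensor scale (restrict_arity p sh (r + k))
              (map2 (\<lambda>m (d, g). (m, d, g m)) ms (replicate k (0, g)) @ replicate r id_factor)) \<sigma> ys) =
      (\<Sum>\<sigma>\<in>ordered_shuffles k (ms @ [p - k]).
        comp_perm scale (comp_tensor scale (sh p) (degree_zero_factors g ms @ replicate (p - k) id_factor)) \<sigma> ys)"
    using assms unfolding Let_def ms(2) map2_replicate[OF ms(1)] by (simp add: restrict_arity_def)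
qed auto

lemma full_braces_expand:
  "full_braces scale sh g a ys =
    (\<Sum>k = 1..a. \<Sum>rs\<in>compositions k a. \<Sum>\<sigma>\<in>ordered_shuffles k rs.
      comp_perm scale (comp_tensor scale (sh k) (degree_zero_factors g rs)) \<sigma> ys)"
  unfolding full_braces_def
proof (intro sum.cong refl)
  fix k
  show "brace scale (restrict_arity k sh) (replicate k (0, g)) a ys =
    (\<Sum>rs\<in>compositions k a. \<Sum>\<sigma>\<in>ordered_shuffles k rs.
      comp_perm scale (comp_tensor scale (sh k) (degree_zero_factors g rs)) \<sigma> ys)"
    unfolding brace_restrict_arity[OF order_refl]
    by (intro sum.cong) (auto simp: compositions_def ordered_shuffles_append_zero)
qed

text \<open>
  The factor
  \<open>sh\<^sub>p \<circ> (g \<otimes> \<dots> \<otimes> g \<otimes> id\<^sup>\<otimes>\<^sup>r)\<close>.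
  It is a single composite, whereas the inner brace is a sum of permuted ones.
\<close>

abbreviation inner_factor :: "'v family \<Rightarrow> 'v family \<Rightarrow> nat \<Rightarrow> nat \<Rightarrow> nat list \<Rightarrow> 'v factor" where
  "inner_factor sh g p r ms \<equiv>
     (sum_list ms + r, -1, comp_tensor scale (sh p) (degree_zero_factors g ms @ replicate r id_factor))"

lemma homogeneous_inner_factor:
  assumes sh: "sh p \<in> graded_hom scale V V p (-1)"
    and g: "\<And>m. m \<in> set ms \<Longrightarrow> homogeneous_factor (m, 0, g m)" and p: "length ms + r = p"
  shows "homogeneous_factor (inner_factor sh g p r ms)"
proof -
  have "homogeneous_factor (sum_list (map fst (degree_zero_factors g ms @ replicate r id_factor)),
      -1 + sum_list (map (\<lambda>(_, d, _). d) (degree_zero_factors g ms @ replicate r id_factor)),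
      comp_tensor scale (sh p) (degree_zero_factors g ms @ replicate r id_factor))"
    using sh g p by (intro homogeneous_factor_comp_tensor) (auto intro: homogeneous_id_factor)
  then show ?thesis by (simp add: comp_def sum_list_replicate)
qed

text \<open>
  The inner brace is a sum of permuted composites \<open>H ms\<close>. The outer map is additive in its first
  slot, and the inner permutation \<open>\<tau>\<close> can be pulled out of that slot, so the summands are
  indexed by pairs of shuffles \<open>(\<sigma>, \<tau>)\<close>, which are collected into
  \<open>\<sigma> \<circ> \<tau>\<close>. The arities \<open>m\<close> of the inner brace and
  \<open>ms\<close> of its arguments are encoded by one composition whose head is the arity of the outer map.
\<close>

lemma brace_brace_expand:
  assumes sh: "sh p \<in> graded_hom scale V V p (-1)"
    and g: "\<And>m. 1 \<le> m \<Longrightarrow> g m \<in> graded_hom scale V W m e"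
    and g0: "\<And>m. 1 \<le> m \<Longrightarrow> homogeneous_factor (m, 0, g m)"
    and ys: "homogeneous V a ys" and pq: "1 \<le> q" "q \<le> p" "p \<le> a"
  shows "brace scale g [(-1, brace scale (restrict_arity p sh) (replicate (q - 1) (0, g)))] a ys =
    (\<Sum>rs\<in>compositions q (a - (p - q)). \<Sum>\<sigma>\<in>ordered_shuffles (q - 1) (tl rs @ [p - q + 1, hd rs - 1]).
      comp_perm scale (comp_tensor scale (g (hd rs))
        (inner_factor sh g p (p - q + 1) (tl rs) # replicate (hd rs - 1) id_factor)) \<sigma> ys)"
proof -
  let ?k = "q - 1" and ?r = "p - q + 1"
  have pk: "p - ?k = ?r" using pq by simp
  let ?B = "brace scale (restrict_arity p sh) (replicate ?k (0, g))"
  define M where "M m = {ms. length ms = ?k \<and> (\<forall>m\<in>set ms. 1 \<le> m) \<and> sum_list ms + ?r = m}" for m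
  have M_fin: "finite (M m)" for m
    by (rule finite_subset[OF _ finite_bounded_lists[of ?k "\<lambda>_. True" m]]) (auto simp: M_def)
  define H where "H ms = comp_tensor scale (sh p) (degree_zero_factors g ms @ replicate ?r id_factor)" for ms
  define C where "C m ms = comp_tensor scale (g (Suc (a - m))) ((m, -1, H ms) # replicate (a - m) id_factor)" for m ms
  define S where "S m = (SIGMA ms:M m. ordered_shuffles ?k (ms @ [?r]))" for m
  have S_fin: "finite (S m)" for m unfolding S_def using M_fin by auto
  have B: "?B m = (\<lambda>ws. \<Sum>(ms, \<tau>)\<in>S m. comp_perm scale (H ms) \<tau> ws)" for m
  proof (rule ext)
    fix ws
    have kp: "?k \<le> p" using pq by simp
    have "?B m ws = (\<Sum>ms\<in>M m. \<Sum>\<tau>\<in>ordered_shuffles ?k (ms @ [?r]). comp_perm scale (H ms) \<tau> ws)"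
      unfolding brace_restrict_arity[OF kp] pk M_def H_def by (rule refl)
    also have "\<dots> = (\<Sum>(ms, \<tau>)\<in>S m. comp_perm scale (H ms) \<tau> ws)"
      unfolding S_def using M_fin by (intro sum.Sigma) auto
    finally show "?B m ws = (\<Sum>(ms, \<tau>)\<in>S m. comp_perm scale (H ms) \<tau> ws)" .
  qed
  have len: "length ys = a" using ys by (simp add: homogeneous_def)
  have step: "comp_perm scale (comp_tensor scale (g (Suc (a - m))) ((m, -1, ?B m) # replicate (a - m) id_factor)) \<sigma> ys
      = (\<Sum>(ms, \<tau>)\<in>S m. comp_perm scale (C m ms) (\<sigma> \<circ> \<tau>) ys)"
    if m: "m \<in> {1..a}" and \<sigma>: "\<sigma> \<in> shuffles_of [m, a - m]" for m \<sigma>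
  proof -
    have sp: "\<sigma> permutes {..<length ys}" using shuffles_of_permutes[OF \<sigma>] m len by simp
    have tp: "\<tau> permutes {..<m}" if "(ms, \<tau>) \<in> S m" for ms \<tau>
      using that ordered_shuffles_permutes[of \<tau> ?k "ms @ [?r]"] by (auto simp: S_def M_def)
    have hom: "homogeneous_factor (m, -1, comp_perm scale (H ms) \<tau>)" if "(ms, \<tau>) \<in> S m" for ms \<tau>
    proof -
      have ms: "length ms + ?r = p" "sum_list ms + ?r = m" "\<And>m. m \<in> set ms \<Longrightarrow> 1 \<le> m"
        using that pq by (auto simp: S_def M_def)
      have "homogeneous_factor (inner_factor sh g p ?r ms)"
        using sh g0 ms by (intro homogeneous_inner_factor) auto
      then show ?thesis unfolding ms(2) H_def by (rule homogeneous_factor_comp_perm) (rule tp[OF that])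
    qed
    have "comp_tensor scale (g (Suc (a - m))) ((m, -1, ?B m) # replicate (a - m) id_factor) zs =
        (\<Sum>(ms, \<tau>)\<in>S m. comp_perm scale (C m ms) \<tau> zs)" if zs: "homogeneous V a zs" for zs
    proof -
      have zlen: "length zs = m + (a - m)" and zs': "homogeneous V (m + (a - m)) zs"
        using zs m by (auto simp: homogeneous_def)
      have gm: "g (Suc (a - m)) \<in> graded_hom scale V W (Suc (a - m)) e" by (rule g) simp
      have "comp_tensor scale (g (Suc (a - m))) ((m, -1, ?B m) # replicate (a - m) id_factor) zs =
          (\<Sum>i\<in>S m. comp_tensor scale (g (Suc (a - m)))
            ((m, -1, (\<lambda>(ms, \<tau>). comp_perm scale (H ms) \<tau>) i) # replicate (a - m) id_factor) zs)"
        unfolding B case_prod_unfold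
        by (rule comp_tensor_head_sum[OF gm S_fin _ zs']) (use hom in auto)
      also have "\<dots> = (\<Sum>(ms, \<tau>)\<in>S m. comp_perm scale (C m ms) \<tau> zs)"
        using comp_tensor_head_perm[OF graded_hom_slot_scaling[OF gm] tp zlen]
        by (intro sum.cong refl) (auto simp: C_def)
      finally show ?thesis .
    qed
    then have "comp_perm scale (comp_tensor scale (g (Suc (a - m))) ((m, -1, ?B m) # replicate (a - m) id_factor)) \<sigma> ys
      = comp_perm scale (\<lambda>zs. \<Sum>i\<in>S m. comp_perm scale (C m (fst i)) (snd i) zs) \<sigma> ys"
      by (intro comp_perm_cong[OF sp ys]) (simp add: case_prod_unfold)
    also have "\<dots> = (\<Sum>i\<in>S m. comp_perm scale (C m (fst i)) (\<sigma> \<circ> snd i) ys)"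
      unfolding comp_perm_sum
    proof (intro sum.cong refl)
      fix i assume "i \<in> S m"
      then have "snd i permutes {..<m}" using tp[of "fst i" "snd i"] by simp
      then have "snd i permutes {..<length ys}" by (rule permutes_subset) (use m len in auto)
      then show "comp_perm scale (comp_perm scale (C m (fst i)) (snd i)) \<sigma> ys =
          comp_perm scale (C m (fst i)) (\<sigma> \<circ> snd i) ys"
        by (rule comp_perm_comp_perm[OF sp])
    qed
    finally show ?thesis by (simp add: case_prod_unfold)
  qed
  have "brace scale g [(-1, ?B)] a ys =
      (\<Sum>m = 1..a. \<Sum>\<sigma>\<in>shuffles_of [m, a - m]. \<Sum>(ms, \<tau>)\<in>S m. comp_perm scale (C m ms) (\<sigma> \<circ> \<tau>) ys)"
    unfolding brace_single by (intro sum.cong refl) (rule step)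
  also have "\<dots> = (\<Sum>m = 1..a. \<Sum>ms\<in>M m. \<Sum>\<pi>\<in>ordered_shuffles ?k (ms @ [?r, a - m]). comp_perm scale (C m ms) \<pi> ys)"
  proof (rule sum.cong[OF refl])
    fix m assume m: "m \<in> {1..a}"
    have "(\<Sum>\<sigma>\<in>shuffles_of [m, a - m]. \<Sum>(ms, \<tau>)\<in>S m. comp_perm scale (C m ms) (\<sigma> \<circ> \<tau>) ys) =
        (\<Sum>\<sigma>\<in>shuffles_of [m, a - m]. \<Sum>ms\<in>M m. \<Sum>\<tau>\<in>ordered_shuffles ?k (ms @ [?r]). comp_perm scale (C m ms) (\<sigma> \<circ> \<tau>) ys)"
      unfolding S_def using M_fin by (simp add: sum.Sigma)
    also have "\<dots> = (\<Sum>ms\<in>M m. \<Sum>\<sigma>\<in>shuffles_of [m, a - m]. \<Sum>\<tau>\<in>ordered_shuffles ?k (ms @ [?r]). comp_perm scale (C m ms) (\<sigma> \<circ> \<tau>) ys)"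
      by (rule sum.swap)
    also have "\<dots> = (\<Sum>ms\<in>M m. \<Sum>\<pi>\<in>ordered_shuffles ?k (ms @ [?r, a - m]). comp_perm scale (C m ms) \<pi> ys)"
    proof (rule sum.cong[OF refl])
      fix ms assume ms: "ms \<in> M m"
      then have "bij_betw (\<lambda>(\<sigma>, \<tau>). \<sigma> \<circ> \<tau>) (shuffles_of [m, a - m] \<times> ordered_shuffles ?k (ms @ [?r]))
          (ordered_shuffles ?k (ms @ [?r, a - m]))"
        using bij_betw_shuffle_composition[of ?k "ms @ [?r]" "a - m"] by (fastforce simp: M_def)
      then show "(\<Sum>\<sigma>\<in>shuffles_of [m, a - m]. \<Sum>\<tau>\<in>ordered_shuffles ?k (ms @ [?r]). comp_perm scale (C m ms) (\<sigma> \<circ> \<tau>) ys)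
          = (\<Sum>\<pi>\<in>ordered_shuffles ?k (ms @ [?r, a - m]). comp_perm scale (C m ms) \<pi> ys)"
        unfolding sum.cartesian_product by (subst sum.reindex_bij_betw[symmetric]) (auto simp: case_prod_unfold)
    qed
    finally show "(\<Sum>\<sigma>\<in>shuffles_of [m, a - m]. \<Sum>(ms, \<tau>)\<in>S m. comp_perm scale (C m ms) (\<sigma> \<circ> \<tau>) ys) =
        (\<Sum>ms\<in>M m. \<Sum>\<pi>\<in>ordered_shuffles ?k (ms @ [?r, a - m]). comp_perm scale (C m ms) \<pi> ys)" .
  qed
  also have "\<dots> = (\<Sum>(m, ms)\<in>(SIGMA m:{1..a}. M m). \<Sum>\<pi>\<in>ordered_shuffles ?k (ms @ [?r, a - m]). comp_perm scale (C m ms) \<pi> ys)"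
    by (rule sum.Sigma) (auto simp: M_fin)
  also have "\<dots> = (\<Sum>rs\<in>compositions q (a - (p - q)). \<Sum>\<pi>\<in>ordered_shuffles ?k (tl rs @ [?r, hd rs - 1]).
      comp_perm scale (comp_tensor scale (g (hd rs))
        (inner_factor sh g p ?r (tl rs) # replicate (hd rs - 1) id_factor)) \<pi> ys)"
  proof (rule sum.reindex_bij_witness[where
        j = "\<lambda>(m, ms). Suc (a - m) # ms" and i = "\<lambda>rs. (sum_list (tl rs) + ?r, tl rs)"])
    fix x assume x: "x \<in> (SIGMA m:{1..a}. M m)"
    then obtain m ms where mms: "x = (m, ms)" "1 \<le> m" "m \<le> a" "ms \<in> M m" by auto
    then have m: "sum_list ms + ?r = m" "length ms = ?k" "\<forall>m\<in>set ms. 1 \<le> m" by (auto simp: M_def)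
    show "(sum_list (tl (case x of (m, ms) \<Rightarrow> Suc (a - m) # ms)) + ?r, tl (case x of (m, ms) \<Rightarrow> Suc (a - m) # ms)) = x"
      using m mms by simp
    show "(case x of (m, ms) \<Rightarrow> Suc (a - m) # ms) \<in> compositions q (a - (p - q))"
      using m mms pq by (auto simp: compositions_def)
    show "(\<Sum>\<pi>\<in>ordered_shuffles ?k (tl (case x of (m, ms) \<Rightarrow> Suc (a - m) # ms) @
            [?r, hd (case x of (m, ms) \<Rightarrow> Suc (a - m) # ms) - 1]).
        comp_perm scale (comp_tensor scale (g (hd (case x of (m, ms) \<Rightarrow> Suc (a - m) # ms)))
         (inner_factor sh g p ?r (tl (case x of (m, ms) \<Rightarrow> Suc (a - m) # ms)) #
          replicate (hd (case x of (m, ms) \<Rightarrow> Suc (a - m) # ms) - 1) id_factor)) \<pi> ys) =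
      (case x of (m, ms) \<Rightarrow> \<Sum>\<pi>\<in>ordered_shuffles ?k (ms @ [?r, a - m]). comp_perm scale (C m ms) \<pi> ys)"
      unfolding mms(1) by (simp add: C_def H_def m(1)[simplified])
  next
    fix rs assume rs: "rs \<in> compositions q (a - (p - q))"
    then obtain r1 ms where r1: "rs = r1 # ms" using pq by (cases rs) (auto simp: compositions_def)
    then have "1 \<le> r1" "length ms = ?k" "\<forall>m\<in>set ms. 1 \<le> m" "r1 + sum_list ms = a - (p - q)"
      using rs by (auto simp: compositions_def)
    then show "(sum_list (tl rs) + ?r, tl rs) \<in> (SIGMA m:{1..a}. M m)"
      "(case (sum_list (tl rs) + ?r, tl rs) of (m, ms) \<Rightarrow> Suc (a - m) # ms) = rs"
      using pq by (auto simp: r1 M_def)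
  qed
  finally show ?thesis .
qed

lemma nested_braces_expand:
  assumes sh: "\<And>p. 1 \<le> p \<Longrightarrow> sh p \<in> graded_hom scale V V p (-1)"
    and g: "\<And>m. 1 \<le> m \<Longrightarrow> g m \<in> graded_hom scale V W m e"
    and g0: "\<And>m. 1 \<le> m \<Longrightarrow> homogeneous_factor (m, 0, g m)"
    and ys: "homogeneous V a ys"
  shows "nested_braces scale lam sh g a ys =
    (\<Sum>p = 1..a. \<Sum>q = 1..p. \<Sum>rs\<in>compositions q (a - (p - q)).
      \<Sum>\<sigma>\<in>ordered_shuffles (q - 1) (tl rs @ [p - q + 1, hd rs - 1]). scale (lam ^ (p - q))
        (comp_perm scale (comp_tensor scale (g (hd rs))
          (inner_factor sh g p (p - q + 1) (tl rs) # replicate (hd rs - 1) id_factor)) \<sigma> ys))"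
  unfolding nested_braces_def scale_sum_right[symmetric]
  by (intro sum.cong refl arg_cong[where f = "scale _"] brace_brace_expand[where W = W and e = e] sh g g0 ys) auto

text \<open>
  The alternative \<open>F k = 0\<close> covers the component of index \<open>0\<close> and the components
  removed by \<open>restrict_arity\<close>.
\<close>

lemma brace_inhomogeneous:
  assumes F: "\<And>k. F k = 0 \<or> F k \<in> graded_hom scale V W k e"
    and gs: "\<And>m d g. 1 \<le> m \<Longrightarrow> (d, g) \<in> set gs \<Longrightarrow> detects_homogeneity (m, d, g m)"
    and ys: "\<not> homogeneous V a ys"
  shows "brace scale F gs a ys = 0"
  unfolding brace_def Let_def
proof (intro sum.neutral ballI)
  fix ms \<sigma>
  let ?r = "a - sum_list ms"
  let ?fs = "map2 (\<lambda>m (d, g). (m, d, g m)) ms gs @ replicate ?r id_factor"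
  assume "ms \<in> {ms. length ms = length gs \<and> (\<forall>m\<in>set ms. 1 \<le> m) \<and> sum_list ms \<le> a}"
    and \<sigma>: "\<sigma> \<in> ordered_shuffles (length gs) (ms @ [?r])"
  then have ms: "length ms = length gs" "\<And>m. m \<in> set ms \<Longrightarrow> 1 \<le> m" "sum_list ms \<le> a" by auto
  have "map fst (map2 (\<lambda>m (d, g). (m, d, g m)) ms gs) = ms"
    using ms(1) by (induction ms gs rule: list_induct2) auto
  then have ar: "sum_list (map fst ?fs) = a" using ms by (simp add: sum_list_replicate)
  have "comp_tensor scale (F (?r + length gs)) ?fs zs = 0" if "\<not> homogeneous V a zs" for zs
  proof (cases "F (?r + length gs) = 0")
    case True
    then show ?thesis by (simp add: comp_tensor_zero)
  next
    case False
    then have "F (?r + length gs) \<in> graded_hom scale V W (length ?fs) e"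
      using F[of "?r + length gs"] ms(1) by (simp add: add.commute)
    then show ?thesis
    proof (rule comp_tensor_inhomogeneous)
      show "detects_homogeneity fac" if "fac \<in> set ?fs" for fac
        using that ms(2)
        by (auto intro!: gs detects_homogeneity_id_factor dest: set_zip_leftD set_zip_rightD)
    qed (use that ar in simp)
  qed
  moreover have "\<sigma> permutes {..<a}" using ordered_shuffles_permutes[OF \<sigma>] ms(3) by simp
  ultimately show "comp_perm scale (comp_tensor scale (F (?r + length gs)) ?fs) \<sigma> ys = 0"
    using ys by (intro comp_perm_inhomogeneous)
qed

lemma graded_hom_detects_homogeneity:
  "f \<in> graded_hom scale V W m e \<Longrightarrow> detects_homogeneity (m, d, f)"
  using graded_hom_off by (auto simp: detects_homogeneity_def)

lemma full_braces_inhomogeneous: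
  assumes sh: "\<And>p. sh p = 0 \<or> sh p \<in> graded_hom scale V V p (-1)"
    and g: "\<And>m. 1 \<le> m \<Longrightarrow> g m \<in> graded_hom scale V W m e"
    and ys: "\<not> homogeneous V a ys"
  shows "full_braces scale sh g a ys = 0"
  unfolding full_braces_def
  by (intro sum.neutral ballI brace_inhomogeneous[where W = V and e = "-1", OF _ _ ys])
    (use sh g in \<open>auto simp: restrict_arity_def intro: graded_hom_detects_homogeneity split: if_splits\<close>)

lemma nested_braces_inhomogeneous:
  assumes sh: "\<And>p. sh p = 0 \<or> sh p \<in> graded_hom scale V V p (-1)"
    and g: "\<And>m. g m = 0 \<or> g m \<in> graded_hom scale V W m e"
    and g': "\<And>m. 1 \<le> m \<Longrightarrow> g m \<in> graded_hom scale V W m e"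
    and ys: "\<not> homogeneous V a ys"
  shows "nested_braces scale lam sh g a ys = 0"
  unfolding nested_braces_def
proof (intro sum.neutral ballI)
  fix n m
  have "brace scale (restrict_arity n sh) (replicate (m - 1) (0, g)) b zs = 0" if "\<not> homogeneous V b zs" for b zs
    by (rule brace_inhomogeneous[where W = V and e = "-1", OF _ _ that])
      (use sh g' in \<open>auto simp: restrict_arity_def intro: graded_hom_detects_homogeneity split: if_splits\<close>)
  then have "brace scale g [(-1, brace scale (restrict_arity n sh) (replicate (m - 1) (0, g)))] a ys = 0"
    by (intro brace_inhomogeneous[OF g _ ys]) (auto simp: detects_homogeneity_def)
  then show "scale (lam ^ (n - m)) (brace scale g [(-1, brace scale (restrict_arity n sh) (replicate (m - 1) (0, g)))] a ys) = 0"
    by simp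
qed

end

section \<open>The homotopy Rota-Baxter equations after suspension\<close>

lemma desuspended_id_factor:
  assumes "\<And>v. scale 1 v = v" shows "desuspended_factor scale id_factor id_factor"
  by (auto simp: desuspended_factor_def id_factor_def length_Suc_conv assms)

lemma desuspended_hrb_l_factor:
  "desuspended_factor scale (hrb_l_factor (desuspend scale f) n) (n, -1, f n)"
  by (simp add: desuspended_factor_def hrb_l_factor_def desuspend_eq)

lemma desuspended_hrb_T_factor:
  "desuspended_factor scale (hrb_T_factor (desuspend scale f) n) (n, 0, f n)"
  by (simp add: desuspended_factor_def hrb_T_factor_def desuspend_eq)

lemma int_minus_one_sum_list:
  "\<forall>m\<in>set ms. 1 \<le> m \<Longrightarrow> int (\<Sum>i < length ms. ms ! i - 1) = int (sum_list ms) - int (length ms)"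
  by (induction ms) (auto simp: sum.lessThan_Suc_shift of_nat_diff simp del: sum.lessThan_Suc of_nat_sum)

lemma hrb_delta_koszul_defect:
  assumes "rs \<in> compositions k n"
  shows "int (hrb_delta k rs) = 1 + koszul_defect (degree_zero_factors g rs)"
proof -
  have k: "length rs = k" and pos: "\<And>j. j < k \<Longrightarrow> 1 \<le> rs ! j"
    using assms by (auto simp: compositions_def)
  have "int (hrb_delta k rs) = 1 + (\<Sum>j < k. int (k - Suc j) * (int (rs ! j) - 1))"
    unfolding hrb_delta_def One_nat_def sum.atLeast1_atMost_eq of_nat_add of_nat_sum of_nat_mult
    using pos by (auto simp: of_nat_diff)
  then show ?thesis using koszul_defect_degree_zero[of g rs 0] by (simp add: k)
qed

lemma sum_from_two: "(\<Sum>j = 2..q. \<phi> j) = (\<Sum>i < q - 1. \<phi> (Suc (Suc i)))" for \<phi> :: "nat \<Rightarrow> 'a::comm_monoid_add"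
  by (rule sum.reindex_bij_witness[where i = "\<lambda>i. Suc (Suc i)" and j = "\<lambda>j. j - 2"])
    (auto intro!: arg_cong[where f = \<phi>])

text \<open>
  The first summand comes from the outer composite, whose first factor has arity
  \<open>sum_list ms + (p - q + 1)\<close> and degree \<open>-1\<close> as a map on \<open>sV\<close>;
  the second is the defect of the inner composite.
\<close>

lemma hrb_eta_koszul_defect:
  assumes ms: "r # ms \<in> compositions q n" and pq: "q \<le> p"
  shows "int (hrb_eta p q (r # ms)) =
    int (sum_list ms + (p - q + 1)) * (int r - 1) +
    koszul_defect (degree_zero_factors g ms @ replicate (p - q + 1) id_factor)"
proof -
  have len: "length ms = q - 1" "q \<ge> 1" and pos: "\<forall>m\<in>set ms. 1 \<le> m" and r: "1 \<le> r"
    using ms by (auto simp: compositions_def)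
  have "int (\<Sum>j = 2..q. (r # ms) ! (j - 1) - 1) = int (sum_list ms) - int (q - 1)"
    unfolding sum_from_two using int_minus_one_sum_list[OF pos] len by simp
  then have 1: "int (p + (\<Sum>j = 2..q. (r # ms) ! (j - 1) - 1)) = int (sum_list ms + (p - q + 1))"
    using pq len by (simp add: of_nat_diff)
  have "int (\<Sum>j = 2..q. ((r # ms) ! (j - 1) - 1) * (p - j + 1)) =
      (\<Sum>j < length ms. int (length ms + (p - q + 1) - 1 - j) * (int (ms ! j) - 1))"
    unfolding sum_from_two of_nat_sum len(1)
  proof (rule sum.cong[OF refl])
    fix j assume j: "j \<in> {..<q - 1}"
    then have "1 \<le> ms ! j" using pos len by simp
    moreover have "p - Suc (Suc j) + 1 = q - 1 + (p - q + 1) - 1 - j" using j pq by auto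
    ultimately show "int (((r # ms) ! (Suc (Suc j) - 1) - 1) * (p - Suc (Suc j) + 1)) =
        int (q - 1 + (p - q + 1) - 1 - j) * (int (ms ! j) - 1)"
      by (simp add: of_nat_diff mult.commute)
  qed
  then have 2: "int (\<Sum>j = 2..q. ((r # ms) ! (j - 1) - 1) * (p - j + 1)) =
      koszul_defect (degree_zero_factors g ms @ replicate (p - q + 1) id_factor)"
    unfolding koszul_defect_degree_zero .
  show ?thesis
    unfolding hrb_eta_def of_nat_add[of "_ * _"] of_nat_mult[of "_ + _"] 1 2 using r by (simp add: of_nat_diff)
qed

context graded_vector_space
begin

lemma comp_tensor_head_scale:
  assumes G: "slot_scaling G" and c: "c \<noteq> 0"
  shows "comp_tensor scale G ((m, d, \<lambda>ys. scale c (f ys)) # replicate r id_factor) =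
    (\<lambda>xs. scale c (comp_tensor scale G ((m, d, f) # replicate r id_factor) xs))"
  using G[unfolded slot_scaling_def, rule_format, OF c, of "[]"]
  by (intro ext) (simp add: comp_tensor_head)

lemma comp_perm_scale:
  "comp_perm scale (\<lambda>xs. scale c (f xs)) \<sigma> xs = scale c (comp_perm scale f \<sigma> xs)"
  by (simp add: comp_perm_def mult.commute)

text \<open>
  The form in which the two sign computations are applied: every homotopy equation is a sum of such terms.
\<close>

lemma desuspended_term:
  assumes F: "slot_scaling (f k)" and fs: "list_all2 (desuspended_factor scale) fs fs'" and k: "length fs' = k"
    and \<sigma>: "\<sigma> permutes {..<length xs}"
  shows "scale (c * of_int (sign \<sigma>)) (comp_perm scale (comp_tensor scale (desuspend scale f k) fs) \<sigma> xs) =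
    scale (c * (-1) powi koszul_defect fs' * desusp_sign (map fst xs))
      (comp_perm scale (comp_tensor scale (f k) fs') \<sigma> (suspend xs))"
proof -
  have "scale (of_int (sign \<sigma>)) (comp_perm scale (comp_tensor scale (desuspend scale f k) fs) \<sigma> xs) =
    scale ((-1) powi koszul_defect fs' * desusp_sign (map fst xs))
      (comp_perm scale (comp_tensor scale (f k) fs') \<sigma> (suspend xs))"
    by (rule comp_perm_desuspended[OF \<sigma>], rule comp_tensor_desuspended[OF fs F])
      (simp add: desuspend_eq k)
  then have "scale c (scale (of_int (sign \<sigma>)) (comp_perm scale (comp_tensor scale (desuspend scale f k) fs) \<sigma> xs)) =
    scale c (scale ((-1) powi koszul_defect fs' * desusp_sign (map fst xs))
      (comp_perm scale (comp_tensor scale (f k) fs') \<sigma> (suspend xs)))"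
    by (rule arg_cong)
  then show ?thesis by (simp add: mult.assoc)
qed

lemma list_all2_id_factors:
  "list_all2 (desuspended_factor scale) (replicate r id_factor) (replicate r id_factor)"
  by (simp add: list_all2_same desuspended_id_factor)

lemma list_all2_T_factors:
  "list_all2 (desuspended_factor scale) (map (hrb_T_factor (desuspend scale g)) rs) (degree_zero_factors g rs)"
  by (simp add: list_all2_map1 list_all2_map2 list_all2_same desuspended_hrb_T_factor)

lemma hrb_jacobi_desuspend:
  assumes sh: "\<And>n. 1 \<le> n \<Longrightarrow> slot_scaling (sh n)" and n: "length xs = n"
  shows "hrb_jacobi scale (desuspend scale sh) n xs =
    scale (desusp_sign (map fst xs)) (brace scale sh [(-1, sh)] n (suspend xs))"
  unfolding hrb_jacobi_def brace_single scale_sum_right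
proof (intro sum.cong refl)
  fix i \<sigma> assume i: "i \<in> {1..n}" and \<sigma>: "\<sigma> \<in> shuffles_of [i, n - i]"
  have "\<sigma> permutes {..<length xs}" using shuffles_of_permutes[OF \<sigma>] i n by simp
  then have "scale ((-1) ^ (i * (n - i)) * of_int (sign \<sigma>))
      (comp_perm scale (comp_tensor scale (desuspend scale sh (Suc (n - i)))
         (hrb_l_factor (desuspend scale sh) i # replicate (n - i) id_factor)) \<sigma> xs) =
    scale ((-1) ^ (i * (n - i)) * (-1) powi koszul_defect ((i, -1, sh i) # replicate (n - i) id_factor) * desusp_sign (map fst xs))
      (comp_perm scale (comp_tensor scale (sh (Suc (n - i))) ((i, -1, sh i) # replicate (n - i) id_factor)) \<sigma> (suspend xs))"
    by (intro desuspended_term sh) (simp_all add: desuspended_hrb_l_factor list_all2_id_factors)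
  also have "(-1) ^ (i * (n - i)) * (-1) powi koszul_defect ((i, -1, sh i) # replicate (n - i) id_factor) = (1 :: 'k)"
    using i by (auto simp: sum_list_replicate minus_one_power_iff power_int_minus_left)
  finally show "scale (of_int (sign \<sigma>) * (-1) ^ (i * (n - i)))
      (comp_perm scale (comp_tensor scale (desuspend scale sh (n - i + 1))
         (hrb_l_factor (desuspend scale sh) i # replicate (n - i) id_factor)) \<sigma> xs) =
    scale (desusp_sign (map fst xs))
      (comp_perm scale (comp_tensor scale (sh (Suc (n - i))) ((i, -1, sh i) # replicate (n - i) id_factor)) \<sigma> (suspend xs))"
    by (simp add: mult.commute)
qed

lemma hrb_lhs_desuspend:
  assumes sh: "\<And>n. 1 \<le> n \<Longrightarrow> slot_scaling (sh n)" and n: "length xs = n"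
  shows "hrb_lhs scale (desuspend scale sh) (desuspend scale g) n xs =
    scale (desusp_sign (map fst xs)) (full_braces scale sh g n (suspend xs))"
  unfolding hrb_lhs_def full_braces_expand scale_sum_right
proof (intro sum.cong refl)
  fix k rs \<sigma> assume k: "k \<in> {1..n}" and rs: "rs \<in> compositions k n" and \<sigma>: "\<sigma> \<in> ordered_shuffles k rs"
  have "\<sigma> permutes {..<length xs}" using ordered_shuffles_permutes[OF \<sigma>] rs n by (simp add: compositions_def)
  then have "scale ((-1) ^ (hrb_delta k rs + 1) * of_int (sign \<sigma>))
      (comp_perm scale (comp_tensor scale (desuspend scale sh k) (map (hrb_T_factor (desuspend scale g)) rs)) \<sigma> xs) =
    scale ((-1) ^ (hrb_delta k rs + 1) * (-1) powi koszul_defect (degree_zero_factors g rs) * desusp_sign (map fst xs))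
      (comp_perm scale (comp_tensor scale (sh k) (degree_zero_factors g rs)) \<sigma> (suspend xs))"
    using k rs by (intro desuspended_term sh list_all2_T_factors) (auto simp: compositions_def)
  also have "(-1) ^ (hrb_delta k rs + 1) * (-1) powi koszul_defect (degree_zero_factors g rs) = (1 :: 'k)"
    using hrb_delta_koszul_defect[OF rs, of g]
    unfolding minus_one_power_powi minus_one_powi_add by (auto simp: power_int_minus_left)
  finally show "scale ((-1) ^ (hrb_delta k rs + 1) * of_int (sign \<sigma>))
      (comp_perm scale (comp_tensor scale (desuspend scale sh k) (map (hrb_T_factor (desuspend scale g)) rs)) \<sigma> xs) =
    scale (desusp_sign (map fst xs))
      (comp_perm scale (comp_tensor scale (sh k) (degree_zero_factors g rs)) \<sigma> (suspend xs))"
    by simp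
qed

text \<open>
  Desuspension is applied twice, to the inner composite and then to the outer one. The inner sign
  \<open>c\<close> is kept inside the first factor until the outer step is done.
\<close>

lemma hrb_rhs_term_desuspend:
  assumes sh: "\<And>n. 1 \<le> n \<Longrightarrow> slot_scaling (sh n)" and g: "\<And>n. 1 \<le> n \<Longrightarrow> slot_scaling (g n)"
    and n: "length xs = n" and pq: "1 \<le> q" "q \<le> p" "p \<le> n" and rs: "rs \<in> compositions q (n - (p - q))"
    and \<sigma>: "\<sigma> \<in> ordered_shuffles (q - 1) (tl rs @ [p - q + 1, hd rs - 1])"
  shows "scale (lam ^ (p - q) * (-1) ^ hrb_eta p q rs * of_int (sign \<sigma>))
      (comp_perm scale (comp_tensor scale (desuspend scale g (hd rs))
        ((sum_list (tl rs) + (p - q + 1), int p - 2 + (\<Sum>r \<leftarrow> tl rs. int r - 1),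
          comp_tensor scale (desuspend scale sh p)
            (map (hrb_T_factor (desuspend scale g)) (tl rs) @ replicate (p - q + 1) id_factor))
         # replicate (hd rs - 1) id_factor)) \<sigma> xs) =
    scale (desusp_sign (map fst xs)) (scale (lam ^ (p - q))
      (comp_perm scale (comp_tensor scale (g (hd rs))
        (inner_factor sh g p (p - q + 1) (tl rs) # replicate (hd rs - 1) id_factor)) \<sigma> (suspend xs)))"
proof -
  obtain r ms where rms: "rs = r # ms" using rs pq by (cases rs) (auto simp: compositions_def)
  have r: "1 \<le> r" and ms: "length ms = q - 1" and sum: "r + sum_list ms = n - (p - q)"
    using rs by (auto simp: rms compositions_def)
  let ?s = "p - q + 1" and ?ids = "replicate (r - 1) id_factor"
  let ?fs = "map (hrb_T_factor (desuspend scale g)) ms @ replicate (p - q + 1) id_factor"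
  let ?fs' = "degree_zero_factors g ms @ replicate (p - q + 1) id_factor"
  let ?m = "sum_list ms + ?s"
  define c :: 'k where "c = (-1) powi koszul_defect ?fs'"
  let ?inner = "(?m, int p - 2 + (\<Sum>r \<leftarrow> ms. int r - 1), comp_tensor scale (desuspend scale sh p) ?fs)"
  let ?inner' = "(?m, -1, \<lambda>ys. scale c (comp_tensor scale (sh p) ?fs' ys))"
  have fs: "list_all2 (desuspended_factor scale) ?fs ?fs'"
    by (intro list_all2_appendI list_all2_T_factors list_all2_id_factors)
  have "comp_tensor scale (desuspend scale sh p) ?fs ys =
      scale (c * desusp_sign (map fst ys)) (comp_tensor scale (sh p) ?fs' (suspend ys))" for ys
    unfolding c_def using pq ms by (intro comp_tensor_desuspended fs sh) (auto simp: desuspend_eq)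
  moreover have "(\<Sum>r \<leftarrow> ms. int r - 1) = int (sum_list ms) - int (length ms)"
    by (induction ms) auto
  ultimately have "desuspended_factor scale ?inner ?inner'"
    using pq ms by (simp add: desuspended_factor_def of_nat_diff mult.commute)
  then have all: "list_all2 (desuspended_factor scale) (?inner # ?ids) (?inner' # ?ids)"
    by (simp add: list_all2_id_factors)
  have "sum_list ms + (?s + (r - 1)) = length xs" using r sum pq n by linarith
  then have "\<sigma> permutes {..<length xs}"
    using ordered_shuffles_permutes[OF \<sigma>] by (simp add: rms)
  with all g[OF r] have "scale (lam ^ (p - q) * (-1) ^ hrb_eta p q rs * of_int (sign \<sigma>))
      (comp_perm scale (comp_tensor scale (desuspend scale g r) (?inner # ?ids)) \<sigma> xs) =
    scale (lam ^ (p - q) * (-1) ^ hrb_eta p q rs * (-1) powi koszul_defect (?inner' # ?ids) * desusp_sign (map fst xs))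
      (comp_perm scale (comp_tensor scale (g r) (?inner' # ?ids)) \<sigma> (suspend xs))"
    using r by (intro desuspended_term) simp_all
  also have "comp_perm scale (comp_tensor scale (g r) (?inner' # ?ids)) \<sigma> (suspend xs) =
      scale c (comp_perm scale (comp_tensor scale (g r) (inner_factor sh g p ?s ms # ?ids)) \<sigma> (suspend xs))"
    by (subst comp_tensor_head_scale[OF g[OF r]]) (simp_all add: c_def comp_perm_scale)
  also have "scale (lam ^ (p - q) * (-1) ^ hrb_eta p q rs * (-1) powi koszul_defect (?inner' # ?ids) * desusp_sign (map fst xs)) \<dots> =
      scale (((-1) ^ hrb_eta p q rs * (-1) powi koszul_defect (?inner' # ?ids) * c) * (desusp_sign (map fst xs) * lam ^ (p - q)))
        (comp_perm scale (comp_tensor scale (g r) (inner_factor sh g p ?s ms # ?ids)) \<sigma> (suspend xs))"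
    by (simp only: scale_scale mult_ac)
  also have "(-1) ^ hrb_eta p q rs * (-1) powi koszul_defect (?inner' # ?ids) * c = 1"
  proof -
    have d: "koszul_defect (?inner' # ?ids) = (int r - 1) * (int ?m - 2)"
      using r by (simp add: sum_list_replicate of_nat_diff)
    have "(-1) ^ hrb_eta p q rs * (-1) powi koszul_defect (?inner' # ?ids) * c =
        (-1) powi (int (hrb_eta p q rs) + koszul_defect (?inner' # ?ids) + koszul_defect ?fs')"
      unfolding c_def minus_one_power_powi minus_one_powi_add ..
    also have "\<dots> = (-1) powi 0"
      unfolding d hrb_eta_koszul_defect[OF rs[unfolded rms] pq(2), of g, folded rms]
      by (rule minus_one_powi_eqI[where t = "int ?m * (int r - 1) - (int r - 1) + koszul_defect ?fs'"])
        (simp add: algebra_simps)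
    finally show ?thesis by simp
  qed
  finally show ?thesis by (simp add: rms)
qed

lemma hrb_rhs_desuspend:
  assumes sh: "\<And>n. 1 \<le> n \<Longrightarrow> sh n \<in> graded_hom scale (susp V) (susp V) n (-1)"
    and g: "\<And>n. 1 \<le> n \<Longrightarrow> g n \<in> graded_hom scale (susp V) V n (-1)"
    and xs: "homogeneous V n xs"
  shows "hrb_rhs scale lam (desuspend scale sh) (desuspend scale g) n xs =
    scale (desusp_sign (map fst xs)) (nested_braces scale lam sh g n (suspend xs))"
proof -
  interpret S: graded_vector_space scale "susp V" by (rule susp_graded_vector_space)
  have n: "length xs = n" using xs by (simp add: homogeneous_def)
  have g0: "S.homogeneous_factor (m, 0, g m)" if "1 \<le> m" for m
    using graded_hom_degree g[OF that] by (fastforce simp: S.homogeneous_factor_def susp_def graded_hom_def)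
  have sc: "slot_scaling (sh m)" "slot_scaling (g m)" if "1 \<le> m" for m
    using S.graded_hom_slot_scaling sh[OF that] g[OF that] by (auto simp: slot_scaling_def S.slot_scaling_def)
  have expand: "nested_braces scale lam sh g n (suspend xs) =
    (\<Sum>p = 1..n. \<Sum>q = 1..p. \<Sum>rs\<in>compositions q (n - (p - q)).
      \<Sum>\<sigma>\<in>ordered_shuffles (q - 1) (tl rs @ [p - q + 1, hd rs - 1]). scale (lam ^ (p - q))
        (comp_perm scale (comp_tensor scale (g (hd rs))
          (inner_factor sh g p (p - q + 1) (tl rs) # replicate (hd rs - 1) id_factor)) \<sigma> (suspend xs)))"
    using sh g g0 xs
    by (intro S.nested_braces_expand[where W = V and e = "-1"]) (auto simp: homogeneous_susp_suspend)
  show ?thesis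
    unfolding expand hrb_rhs_def scale_sum_right Let_def
    by (intro sum.cong refl, rule hrb_rhs_term_desuspend[OF sc n]) auto
qed

end

section \<open>The correspondence\<close>

lemma all_suspend: "(\<forall>ys. P ys) \<longleftrightarrow> (\<forall>xs. P (suspend xs))"
  by (metis surj_suspend)

lemma suspend_update: "suspend (xs[i := (p, u)]) = (suspend xs)[i := (p + 1, u)]"
  by (simp add: suspend_def map_update)

lemma fst_update_same_degree:
  "i < length xs \<Longrightarrow> map fst (xs[i := (fst (xs ! i), u)]) = map fst xs"
  by (simp add: map_update) (metis list_update_id nth_map)

definition resuspend :: "('k::field \<Rightarrow> 'v::ab_group_add \<Rightarrow> 'v) \<Rightarrow> 'v family \<Rightarrow> 'v family" where
  "resuspend scale \<phi> n ys =
     (if length ys = n then scale (desusp_sign (map (\<lambda>y. fst y - 1) ys)) (\<phi> n (map (apfst (\<lambda>p. p - 1)) ys)) else 0)"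

context graded_vector_space
begin

text \<open>
  Used with \<open>s = -1\<close> for values in \<open>sV\<close> and with \<open>s = 0\<close> for values
  in \<open>V\<close>.
\<close>

lemma desuspend_graded_hom_iff:
  assumes W: "\<And>p. W p = V (p + s)" and off: "\<And>ys. length ys \<noteq> n \<Longrightarrow> f n ys = 0"
  shows "desuspend scale f n \<in> graded_hom scale V V n (int n - 1 + s) \<longleftrightarrow>
    f n \<in> graded_hom scale (susp V) W n (-1)"
proof -
  have 1: "(\<not> homogeneous V n xs \<longrightarrow> desuspend scale f n xs = 0) \<longleftrightarrow>
      (\<not> homogeneous (susp V) n (suspend xs) \<longrightarrow> f n (suspend xs) = 0)" for xs
    by (simp add: homogeneous_susp_suspend desuspend_eq off)
  have 2: "(homogeneous V n xs \<longrightarrow> desuspend scale f n xs \<in> V (int n - 1 + s + total_degree xs)) \<longleftrightarrow>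
      (homogeneous (susp V) n (suspend xs) \<longrightarrow> f n (suspend xs) \<in> W (-1 + total_degree (suspend xs)))" for xs
    unfolding homogeneous_susp_suspend
  proof (rule imp_cong[OF refl])
    assume "homogeneous V n xs"
    then have len: "length xs = n" by (simp add: homogeneous_def)
    have "- 1 + total_degree (suspend xs) + s = int n - 1 + s + total_degree xs"
      unfolding total_degree_suspend len by simp
    then show "desuspend scale f n xs \<in> V (int n - 1 + s + total_degree xs) \<longleftrightarrow>
        f n (suspend xs) \<in> W (-1 + total_degree (suspend xs))"
      by (simp only: W desuspend_eq len if_True refl scale_in_component[OF desusp_sign_nonzero])
  qed
  have 3: "(homogeneous V n xs \<and> i < n \<longrightarrow>
        (let p = fst (xs ! i) in
          (\<forall>u \<in> V p. \<forall>w \<in> V p. desuspend scale f n (xs[i := (p, u + w)]) =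
             desuspend scale f n (xs[i := (p, u)]) + desuspend scale f n (xs[i := (p, w)])) \<and>
          (\<forall>c. \<forall>u \<in> V p. desuspend scale f n (xs[i := (p, scale c u)]) = scale c (desuspend scale f n (xs[i := (p, u)]))))) \<longleftrightarrow>
      (homogeneous (susp V) n (suspend xs) \<and> i < n \<longrightarrow>
        (let p = fst (suspend xs ! i) in
          (\<forall>u \<in> susp V p. \<forall>w \<in> susp V p. f n ((suspend xs)[i := (p, u + w)]) =
             f n ((suspend xs)[i := (p, u)]) + f n ((suspend xs)[i := (p, w)])) \<and>
          (\<forall>c. \<forall>u \<in> susp V p. f n ((suspend xs)[i := (p, scale c u)]) = scale c (f n ((suspend xs)[i := (p, u)])))))" for xs i
  proof (cases "homogeneous V n xs \<and> i < n")
    case True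
    then have i: "i < length xs" "length xs = n" by (auto simp: homogeneous_def)
    let ?p = "fst (xs ! i)"
    have p: "fst (suspend xs ! i) = ?p + 1" "susp V (?p + 1) = V ?p"
      using i by (simp_all add: suspend_def susp_def)
    have d: "desuspend scale f n (xs[i := (?p, u)]) =
        scale (desusp_sign (map fst xs)) (f n ((suspend xs)[i := (?p + 1, u)]))" for u
      using i by (simp add: desuspend_eq fst_update_same_degree suspend_update)
    have add: "scale (desusp_sign (map fst xs)) a = scale (desusp_sign (map fst xs)) b + scale (desusp_sign (map fst xs)) c
        \<longleftrightarrow> a = b + c" for a b c
      by (simp add: scale_right_distrib[symmetric])
    have mult: "scale (desusp_sign (map fst xs)) a = scale c (scale (desusp_sign (map fst xs)) b) \<longleftrightarrow> a = scale c b" for a b c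
      unfolding scale_left_commute[of c "desusp_sign (map fst xs)" b]
      by (simp only: scale_cancel_left desusp_sign_nonzero simp_thms)
    show ?thesis
      using True by (simp only: Let_def p d add mult homogeneous_susp_suspend)
  next
    case False
    then show ?thesis by (simp only: homogeneous_susp_suspend simp_thms)
  qed
  show ?thesis
    unfolding graded_hom_def mem_Collect_eq all_suspend[of "\<lambda>xs. \<not> homogeneous (susp V) n xs \<longrightarrow> f n xs = 0"]
      all_suspend[of "\<lambda>xs. homogeneous (susp V) n xs \<longrightarrow> f n xs \<in> W (- 1 + total_degree xs)"]
      all_suspend[of "\<lambda>xs. \<forall>i. homogeneous (susp V) n xs \<and> i < n \<longrightarrow> _ xs i"]
      1 2 3 ..
qed

lemma desuspend_symmetric_iff:
  assumes "\<sigma> permutes {..<n}" "length xs = n"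
  shows "desuspend scale f n xs = scale (chi_sign \<sigma> (map fst xs)) (desuspend scale f n (permute_list \<sigma> xs)) \<longleftrightarrow>
    f n (suspend xs) = comp_perm scale (f n) \<sigma> (suspend xs)"
proof -
  have "scale (of_int (sign \<sigma>)) (comp_perm scale (desuspend scale f n) \<sigma> xs) =
      scale (1 * desusp_sign (map fst xs)) (comp_perm scale (f n) \<sigma> (suspend xs))"
    using assms by (intro comp_perm_desuspended) (simp_all add: desuspend_eq)
  then have "scale (chi_sign \<sigma> (map fst xs)) (desuspend scale f n (permute_list \<sigma> xs)) =
      scale (desusp_sign (map fst xs)) (comp_perm scale (f n) \<sigma> (suspend xs))"
    by (simp add: chi_sign_def comp_perm_def[of scale "desuspend scale f n"])
  then show ?thesis using assms by (simp add: desuspend_eq)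
qed

lemma desuspend_antisymmetric_iff:
  assumes W: "\<And>p. W p = V (p + s)" and off: "\<And>n ys. length ys \<noteq> n \<Longrightarrow> f n ys = 0"
  shows "antisymmetric_family scale V (\<lambda>n. int n - 1 + s) (desuspend scale f) \<longleftrightarrow> f \<in> sym_hom_product scale V W (-1)"
proof -
  have 0: "desuspend scale f 0 = (\<lambda>_. 0) \<longleftrightarrow> f 0 = (\<lambda>_. 0)"
    unfolding fun_eq_iff all_suspend[of "\<lambda>ys. f 0 ys = 0"] using off[where n = 0]
    by (intro all_cong1) (auto simp: desuspend_eq suspend_def)
  have "(\<forall>xs \<sigma>. homogeneous V n xs \<and> \<sigma> permutes {..<n} \<longrightarrow>
        desuspend scale f n xs = scale (chi_sign \<sigma> (map fst xs)) (desuspend scale f n (permute_list \<sigma> xs))) \<longleftrightarrow>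
      (\<forall>ys \<sigma>. homogeneous (susp V) n ys \<and> \<sigma> permutes {..<n} \<longrightarrow> f n ys = comp_perm scale (f n) \<sigma> ys)" for n
    unfolding all_suspend[of "\<lambda>ys. \<forall>\<sigma>. homogeneous (susp V) n ys \<and> \<sigma> permutes {..<n} \<longrightarrow> f n ys = comp_perm scale (f n) \<sigma> ys"]
      homogeneous_susp_suspend
    by (intro all_cong1 imp_cong refl desuspend_symmetric_iff) (auto simp: homogeneous_def)
  then show ?thesis
    unfolding antisymmetric_family_def sym_hom_product_def mem_Collect_eq 0
    using desuspend_graded_hom_iff[where W = W and s = s and f = f, OF W off] by simp
qed

lemma desuspend_resuspend:
  assumes "\<And>n xs. length xs \<noteq> n \<Longrightarrow> \<phi> n xs = 0"
  shows "desuspend scale (resuspend scale \<phi>) = \<phi>"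
proof (intro ext)
  fix n and xs :: "'v elt list"
  have 1: "map (apfst (\<lambda>p. p - 1)) (suspend xs) = xs" "map (\<lambda>y. fst y - 1) (suspend xs) = map fst xs"
    by (simp_all add: suspend_def comp_def prod.expand map_idI)
  show "desuspend scale (resuspend scale \<phi>) n xs = \<phi> n xs"
    by (simp add: desuspend_eq resuspend_def 1 assms)
qed

lemma antisymmetric_family_off:
  assumes "antisymmetric_family scale V d \<phi>" "length xs \<noteq> n" shows "\<phi> n xs = 0"
proof (cases "n = 0")
  case False
  then have "\<phi> n \<in> graded_hom scale V V n (d n)" using assms by (simp add: antisymmetric_family_def)
  then show ?thesis using assms(2) by (auto simp: graded_hom_def homogeneous_def)
qed (use assms in \<open>simp add: antisymmetric_family_def\<close>)

lemma sym_hom_product_off: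
  assumes "f \<in> sym_hom_product scale V W d" "length ys \<noteq> n" shows "f n ys = 0"
proof (cases "n = 0")
  case False
  then have "f n \<in> graded_hom scale (susp V) W n d" using assms by (simp add: sym_hom_product_def)
  then show ?thesis using assms(2) by (auto simp: graded_hom_def homogeneous_def)
qed (use assms in \<open>simp add: sym_hom_product_def\<close>)

lemma bij_betw_desuspend:
  assumes W: "\<And>p. W p = V (p + s)"
  shows "bij_betw (desuspend scale) (sym_hom_product scale V W (-1))
    {\<phi>. antisymmetric_family scale V (\<lambda>n. int n - 1 + s) \<phi>}"
  unfolding bij_betw_def
proof (intro conjI inj_onI equalityI subsetI)
  fix f f' assume f: "f \<in> sym_hom_product scale V W (-1)" "f' \<in> sym_hom_product scale V W (-1)"
    and eq: "desuspend scale f = desuspend scale f'"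
  show "f = f'"
  proof (intro ext)
    fix n and ys :: "'v elt list"
    obtain xs where ys: "ys = suspend xs" by (rule surj_suspend)
    show "f n ys = f' n ys"
      using fun_cong[OF fun_cong[OF eq, of n], of xs] f[THEN sym_hom_product_off]
      by (cases "length xs = n") (auto simp: desuspend_eq ys)
  qed
next
  fix \<phi> assume "\<phi> \<in> desuspend scale ` sym_hom_product scale V W (-1)"
  then obtain f where f: "f \<in> sym_hom_product scale V W (-1)" "\<phi> = desuspend scale f" by auto
  then show "\<phi> \<in> {\<phi>. antisymmetric_family scale V (\<lambda>n. int n - 1 + s) \<phi>}"
    using desuspend_antisymmetric_iff[where f = f, OF W sym_hom_product_off[OF f(1)]] by simp
next
  fix \<phi> assume \<phi>: "\<phi> \<in> {\<phi>. antisymmetric_family scale V (\<lambda>n. int n - 1 + s) \<phi>}"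
  then have eq: "desuspend scale (resuspend scale \<phi>) = \<phi>"
    using antisymmetric_family_off by (intro desuspend_resuspend) blast
  have off: "resuspend scale \<phi> n ys = 0" if "length ys \<noteq> n" for n ys
    using that by (simp add: resuspend_def)
  have "resuspend scale \<phi> \<in> sym_hom_product scale V W (-1)"
    using \<phi> desuspend_antisymmetric_iff[where f = "resuspend scale \<phi>", OF W off] by (simp add: eq)
  then show "\<phi> \<in> desuspend scale ` sym_hom_product scale V W (-1)"
    using eq by (metis image_eqI)
qed

lemma bij_betw_induced_structure:
  "bij_betw (induced_structure scale) (C_RBL scale V (-1))
    ({\<ll>. antisymmetric_family scale V (\<lambda>n. int n - 2) \<ll>} \<times> {T. antisymmetric_family scale V (\<lambda>n. int n - 1) T})"
  unfolding induced_structure_def C_RBL_def C_Lie_def C_RBLO_def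
  using bij_betw_map_prod[OF bij_betw_desuspend[of "susp V" "-1"] bij_betw_desuspend[of V 0]]
  by (simp add: susp_def)

text \<open>
  Both sides of each homotopy equation are, up to the nonzero factor \<open>desusp_sign\<close>, the sides of a
  Maurer-Cartan equation on the suspended list. In arity \<open>0\<close> and on inhomogeneous lists everything
  vanishes.
\<close>

lemma maurer_cartan_iff_homotopy_equations:
  assumes "(sh, g) \<in> C_RBL scale V (-1)"
  shows "(sh, g) \<in> C_RBL_maurer_cartan scale V lam \<longleftrightarrow>
    (\<forall>n\<ge>1. \<forall>xs. homogeneous V n xs \<longrightarrow> hrb_jacobi scale (desuspend scale sh) n xs = 0) \<and>
    (\<forall>n\<ge>1. \<forall>xs. homogeneous V n xs \<longrightarrow> hrb_lhs scale (desuspend scale sh) (desuspend scale g) n xs =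
       hrb_rhs scale lam (desuspend scale sh) (desuspend scale g) n xs)"
proof -
  interpret S: graded_vector_space scale "susp V" by (rule susp_graded_vector_space)
  have sh: "sh n \<in> graded_hom scale (susp V) (susp V) n (-1)" and g: "g n \<in> graded_hom scale (susp V) V n (-1)"
    if "1 \<le> n" for n
    using assms that by (auto simp: C_RBL_def C_Lie_def C_RBLO_def sym_hom_product_def)
  have zero: "sh 0 = 0" "g 0 = 0"
    using assms by (auto simp: C_RBL_def C_Lie_def C_RBLO_def sym_hom_product_def fun_eq_iff)
  have sh0: "sh n = 0 \<or> sh n \<in> graded_hom scale (susp V) (susp V) n (-1)"
    and g0: "g n = 0 \<or> g n \<in> graded_hom scale (susp V) V n (-1)" for n
    using sh[of n] g[of n] zero by (cases "n = 0"; simp)+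
  have sc: "slot_scaling (sh m)" if "1 \<le> m" for m
    using S.graded_hom_slot_scaling sh[OF that] by (auto simp: slot_scaling_def S.slot_scaling_def)
  have jac: "hrb_jacobi scale (desuspend scale sh) n xs =
      scale (desusp_sign (map fst xs)) (brace scale sh [(-1, sh)] n (suspend xs))" if "homogeneous V n xs" for n xs
    using that by (intro hrb_jacobi_desuspend sc) (auto simp: homogeneous_def)
  have lhs: "hrb_lhs scale (desuspend scale sh) (desuspend scale g) n xs =
      scale (desusp_sign (map fst xs)) (full_braces scale sh g n (suspend xs))" if "homogeneous V n xs" for n xs
    using that by (intro hrb_lhs_desuspend sc) (auto simp: homogeneous_def)
  have rhs: "hrb_rhs scale lam (desuspend scale sh) (desuspend scale g) n xs =
      scale (desusp_sign (map fst xs)) (nested_braces scale lam sh g n (suspend xs))" if "homogeneous V n xs" for n xs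
    using that by (intro hrb_rhs_desuspend sh g)
  have off: "brace scale sh [(-1, sh)] a ys = 0 \<and> full_braces scale sh g a ys = 0 \<and> nested_braces scale lam sh g a ys = 0"
    if "a = 0 \<or> \<not> homogeneous (susp V) a ys" for a ys
  proof (cases "a = 0")
    case True
    then show ?thesis by (simp add: brace_single full_braces_def nested_braces_def)
  next
    case False
    then have ys: "\<not> homogeneous (susp V) a ys" using that by simp
    have "brace scale sh [(-1, sh)] a ys = 0"
      by (rule S.brace_inhomogeneous[OF sh0 _ ys]) (auto intro: S.graded_hom_detects_homogeneity[OF sh])
    then show ?thesis
      using S.full_braces_inhomogeneous[OF sh0 g ys] S.nested_braces_inhomogeneous[OF sh0 g0 g ys] by simp
  qed
  have iff: "(\<forall>a ys. P a ys) \<longleftrightarrow> (\<forall>n\<ge>1. \<forall>xs. homogeneous V n xs \<longrightarrow> P n (suspend xs))"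
    if P: "\<And>a ys. a = 0 \<or> \<not> homogeneous (susp V) a ys \<Longrightarrow> P a ys" for P :: "nat \<Rightarrow> 'v elt list \<Rightarrow> bool"
  proof (intro iffI allI)
    fix a and ys :: "'v elt list" assume R: "\<forall>n\<ge>1. \<forall>xs. homogeneous V n xs \<longrightarrow> P n (suspend xs)"
    obtain xs where ys: "ys = suspend xs" by (rule surj_suspend)
    show "P a ys"
    proof (cases "a = 0 \<or> \<not> homogeneous (susp V) a ys")
      case False
      then have "1 \<le> a" "homogeneous V a xs" by (simp_all add: ys homogeneous_susp_suspend)
      then show ?thesis using R ys by blast
    qed (rule P)
  qed simp
  have "(sh, g) \<in> C_RBL_maurer_cartan scale V lam \<longleftrightarrow>
    (\<forall>a ys. brace scale sh [(-1, sh)] a ys = 0 \<and> full_braces scale sh g a ys = nested_braces scale lam sh g a ys)"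
    using assms by (simp add: maurer_cartan_iff)
  also have "\<dots> \<longleftrightarrow> (\<forall>n\<ge>1. \<forall>xs. homogeneous V n xs \<longrightarrow> brace scale sh [(-1, sh)] n (suspend xs) = 0 \<and>
      full_braces scale sh g n (suspend xs) = nested_braces scale lam sh g n (suspend xs))"
    by (rule iff) (use off in simp)
  also have "\<dots> \<longleftrightarrow> (\<forall>n\<ge>1. \<forall>xs. homogeneous V n xs \<longrightarrow> hrb_jacobi scale (desuspend scale sh) n xs = 0) \<and>
    (\<forall>n\<ge>1. \<forall>xs. homogeneous V n xs \<longrightarrow> hrb_lhs scale (desuspend scale sh) (desuspend scale g) n xs =
       hrb_rhs scale lam (desuspend scale sh) (desuspend scale g) n xs)"
    using jac lhs rhs by auto
  finally show ?thesis .
qed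

theorem bij_betw_maurer_cartan:
  "bij_betw (induced_structure scale) (C_RBL_maurer_cartan scale V lam) (homotopy_Rota_Baxter_structures scale V lam)"
proof -
  let ?A = "C_RBL scale V (-1)"
  let ?B = "{\<ll>. antisymmetric_family scale V (\<lambda>n. int n - 2) \<ll>} \<times> {T. antisymmetric_family scale V (\<lambda>n. int n - 1) T}"
  note bij = bij_betw_induced_structure
  have mem: "induced_structure scale \<alpha> \<in> homotopy_Rota_Baxter_structures scale V lam \<longleftrightarrow>
      \<alpha> \<in> C_RBL_maurer_cartan scale V lam" if \<alpha>: "\<alpha> \<in> ?A" for \<alpha>
  proof -
    obtain sh g where "\<alpha> = (sh, g)" by (cases \<alpha>)
    moreover have "induced_structure scale \<alpha> \<in> ?B" using bij \<alpha> by (auto simp: bij_betw_def)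
    ultimately show ?thesis
      using maurer_cartan_iff_homotopy_equations[of sh g lam] \<alpha>
      by (simp add: homotopy_Rota_Baxter_structures_def induced_structure_def)
  qed
  have MC: "C_RBL_maurer_cartan scale V lam \<subseteq> ?A"
    using maurer_cartan_iff by auto
  have HRB: "homotopy_Rota_Baxter_structures scale V lam \<subseteq> ?B"
    by (auto simp: homotopy_Rota_Baxter_structures_def)
  have "induced_structure scale ` C_RBL_maurer_cartan scale V lam = homotopy_Rota_Baxter_structures scale V lam"
  proof (intro equalityI subsetI)
    fix \<beta> assume \<beta>: "\<beta> \<in> homotopy_Rota_Baxter_structures scale V lam"
    then have "\<beta> \<in> induced_structure scale ` ?A" using HRB bij by (auto simp only: bij_betw_def)
    then obtain \<alpha> where "\<alpha> \<in> ?A" "\<beta> = induced_structure scale \<alpha>" by blast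
    then show "\<beta> \<in> induced_structure scale ` C_RBL_maurer_cartan scale V lam"
      using mem[of \<alpha>] \<beta> by auto
  qed (use mem MC in auto)
  then show ?thesis using bij_betw_subset[OF bij MC] by simp
qed

end

section \<open>Spaces concentrated in degree zero\<close>

lemma koszul_sign_zeros:
  assumes "\<sigma> permutes {..<length ds}" "\<forall>d\<in>set ds. d = 0"
  shows "koszul_sign \<sigma> ds = (1 :: 'k::field)"
proof -
  have "\<sigma> i < length ds" if "i < length ds" for i using permutes_in_image[OF assms(1)] that by auto
  then have "ds ! \<sigma> i = 0" if "i < length ds" for i using assms(2) that by simp
  then show ?thesis
    unfolding koszul_sign_index_pairs by (intro prod.neutral) (auto simp: index_pairs_def)
qed

lemma permutes_two: "\<sigma> permutes {..<2} \<longleftrightarrow> \<sigma> = id \<or> \<sigma> = Transposition.transpose 0 (1 :: nat)"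
proof
  assume p: "\<sigma> permutes {..<2}"
  then have "\<sigma> 0 < 2" "\<sigma> 1 < 2" "\<sigma> 0 \<noteq> \<sigma> 1" "\<And>i. 2 \<le> i \<Longrightarrow> \<sigma> i = i"
    using permutes_in_image[OF p, of 0] permutes_in_image[OF p, of 1] permutes_not_in[OF p]
    by (auto simp: inj_eq[OF permutes_inj[OF p]])
  then have "\<sigma> i = (if \<sigma> 0 = 0 then id i else Transposition.transpose 0 1 i)" for i
    by (cases "i = 0"; cases "i = 1") (auto simp: Transposition.transpose_def less_2_cases_iff)
  then show "\<sigma> = id \<or> \<sigma> = Transposition.transpose 0 1" by (cases "\<sigma> 0 = 0") (auto simp: fun_eq_iff)
qed (auto intro: permutes_id permutes_swap_id)

lemma shuffles_two_zero: "shuffles_of [2, 0] = {id}"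
proof -
  have "\<sigma> = id" if "\<sigma> permutes {..<2}" "\<sigma> 0 < \<sigma> (1 :: nat)" for \<sigma>
    using that by (auto simp: permutes_two)
  then show ?thesis
    by (auto simp: shuffles_of_two strict_mono_on_def permutes_id)
qed

lemma shuffles_one_one: "shuffles_of [1, 1] = {id, Transposition.transpose 0 1}"
proof -
  have "\<sigma> \<in> shuffles_of [1, 1] \<longleftrightarrow> \<sigma> permutes {..<2}" for \<sigma>
    unfolding shuffles_of_two one_add_one by (auto simp: strict_mono_on_def)
  then show ?thesis by (auto simp: permutes_two)
qed

lemma ordered_shuffles_one_one: "ordered_shuffles 2 [1, 1] = {id}"
proof -
  have "(\<forall>i j. i < j \<and> j < 2 \<longrightarrow> P i j) \<longleftrightarrow> P 0 (1 :: nat)" for P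
    by (auto simp: less_2_cases_iff)
  then show ?thesis
    unfolding ordered_shuffles_def shuffles_one_one
    by (auto simp: block_start_def Transposition.transpose_def)
qed

lemma shuffles_two_one:
  "shuffles_of [2, 1] = {id, Transposition.transpose 1 2, Transposition.transpose 0 1 \<circ> Transposition.transpose 1 2}"
  (is "_ = {_, ?b, ?c}")
proof (intro equalityI subsetI)
  fix \<sigma> assume "\<sigma> \<in> shuffles_of [2, 1]"
  then have p: "\<sigma> permutes {..<3}" and less: "\<sigma> 0 < \<sigma> 1"
    by (auto simp: shuffles_of_two strict_mono_on_def)
  have "\<sigma> 0 < 3" "\<sigma> 1 < 3" "\<sigma> 2 < 3" using permutes_in_image[OF p, of 0] permutes_in_image[OF p, of 1] permutes_in_image[OF p, of 2] by simp_all
  moreover have "\<sigma> 0 \<noteq> \<sigma> 1" "\<sigma> 0 \<noteq> \<sigma> 2" "\<sigma> 1 \<noteq> \<sigma> 2" by (simp_all add: inj_eq[OF permutes_inj[OF p]])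
  ultimately have "(\<sigma> 0 = 0 \<and> \<sigma> 1 = 1 \<and> \<sigma> 2 = 2) \<or> (\<sigma> 0 = 0 \<and> \<sigma> 1 = 2 \<and> \<sigma> 2 = 1) \<or> (\<sigma> 0 = 1 \<and> \<sigma> 1 = 2 \<and> \<sigma> 2 = 0)"
    using less by presburger
  moreover have "\<sigma> = \<tau>" if "\<tau> permutes {..<3}" "\<sigma> 0 = \<tau> 0" "\<sigma> 1 = \<tau> 1" "\<sigma> 2 = \<tau> 2" for \<tau>
  proof
    fix i :: nat
    consider "i = 0" | "i = 1" | "i = 2" | "i \<ge> 3" by linarith
    then show "\<sigma> i = \<tau> i" using p that by cases (auto simp: permutes_not_in)
  qed
  moreover have "?b permutes {..<3}" "?c permutes {..<3}" by (auto intro!: permutes_compose permutes_swap_id)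
  ultimately show "\<sigma> \<in> {id, ?b, ?c}"
    by (auto simp: Transposition.transpose_def permutes_id intro: permutes_id)
next
  fix \<sigma> assume \<sigma>: "\<sigma> \<in> {id, ?b, ?c}"
  then have "\<sigma> permutes {..<2 + 1}" by (auto intro!: permutes_compose permutes_swap_id permutes_id)
  with \<sigma> show "\<sigma> \<in> shuffles_of [2, 1]"
    by (auto simp: shuffles_of_two strict_mono_on_def Transposition.transpose_def less_2_cases_iff)
qed

lemma compositions_one: "1 \<le> n \<Longrightarrow> compositions 1 n = {[n]}"
  by (auto simp: compositions_def length_Suc_conv)

lemma compositions_two_two: "compositions 2 2 = {[1, 1]}"
  by (auto simp: compositions_def length_Suc_conv numeral_2_eq_2)

lemma permute_list_lessThan_two: "permute_list \<sigma> [x, y] = [[x, y] ! \<sigma> 0, [x, y] ! \<sigma> 1]"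
  by (simp add: permute_list_def)

lemma permute_list_lessThan_three:
  "permute_list \<sigma> [x, y, z] = [[x, y, z] ! \<sigma> 0, [x, y, z] ! \<sigma> 1, [x, y, z] ! \<sigma> 2]"
  by (simp add: permute_list_def numeral_3_eq_3 numeral_2_eq_2)

context graded_vector_space
begin

lemma comp_perm_degree_zero:
  assumes "\<sigma> permutes {..<length xs}" "\<forall>x\<in>set xs. fst x = 0"
  shows "comp_perm scale f \<sigma> xs = f (permute_list \<sigma> xs)"
  using koszul_sign_zeros[of \<sigma> "map fst xs", where ?'k = 'k] assms by (simp add: comp_perm_def)

lemma comp_tensor_id_factors:
  "length xs = r \<Longrightarrow> comp_tensor scale F (replicate r id_factor) xs = F xs"
  by (simp add: comp_tensor_def tensor_id_factors sum_list_replicate)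

lemma graded_hom_vanishes:
  assumes concentrated: "V d = {0}" and f: "f \<in> graded_hom scale V V n d" and xs: "\<forall>x\<in>set xs. fst x = 0"
  shows "f xs = 0"
proof (cases "homogeneous V n xs")
  case True
  have "total_degree xs = 0" using xs by (induction xs) auto
  then have "f xs \<in> V d" using graded_hom_degree[OF f True] by simp
  then show ?thesis using concentrated by simp
qed (rule graded_hom_off[OF f])

text \<open>
  A graded map of nonzero degree vanishes on elements of degree \<open>0\<close>. The composites with
  \<open>\<ll>\<^sub>1\<close>, \<open>\<ll>\<^sub>3\<close> or \<open>T\<^sub>2\<close> therefore vanish, which
  leaves three shuffles in the equation of arity \<open>3\<close> for \<open>\<ll>\<close>, and one composite
  \<open>[T, T]\<close> against three composites \<open>T[-, -]\<close> in the equation of arity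
  \<open>2\<close> for \<open>T\<close>.
\<close>

lemma homotopy_Rota_Baxter_degree_zero:
  assumes concentrated: "\<And>p. p \<noteq> 0 \<Longrightarrow> V p = {0}"
    and "(\<ll>, T) \<in> homotopy_Rota_Baxter_structures scale V lam"
  shows "Rota_Baxter_Lie_algebra_on scale lam (V 0) (\<lambda>x y. \<ll> 2 [(0, x), (0, y)]) (\<lambda>x. T 1 [(0, x)])"
proof -
  define br where "br x y = \<ll> 2 [(0, x), (0, y)]" for x y
  define t where "t x = T 1 [(0, x)]" for x
  have anti: "antisymmetric_family scale V (\<lambda>n. int n - 2) \<ll>" "antisymmetric_family scale V (\<lambda>n. int n - 1) T"
    and jac: "\<And>n xs. 1 \<le> n \<Longrightarrow> homogeneous V n xs \<Longrightarrow> hrb_jacobi scale \<ll> n xs = 0"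
    and rb: "\<And>n xs. 1 \<le> n \<Longrightarrow> homogeneous V n xs \<Longrightarrow> hrb_lhs scale \<ll> T n xs = hrb_rhs scale lam \<ll> T n xs"
    using assms(2) by (auto simp: homotopy_Rota_Baxter_structures_def)
  have \<ll>: "\<ll> n \<in> graded_hom scale V V n (int n - 2)" and T: "T n \<in> graded_hom scale V V n (int n - 1)" if "1 \<le> n" for n
    using anti that by (auto simp: antisymmetric_family_def)
  have \<ll>2: "\<ll> 2 \<in> graded_hom scale V V 2 0" and T1: "T 1 \<in> graded_hom scale V V 1 0"
    using \<ll>[of 2] T[of 1] by simp_all
  have hom2: "homogeneous V 2 [(0, x), (0, y)]" if "x \<in> V 0" "y \<in> V 0" for x y
    using that by (simp add: homogeneous_def)
  have hom1: "homogeneous V 1 [(0, x)]" if "x \<in> V 0" for x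
    using that by (simp add: homogeneous_def)
  have br_closed: "br x y \<in> V 0" if "x \<in> V 0" "y \<in> V 0" for x y
    using graded_hom_degree[OF \<ll>2 hom2[OF that]] by (simp add: br_def)
  have t_closed: "t x \<in> V 0" if "x \<in> V 0" for x
    using graded_hom_degree[OF T1 hom1[OF that]] by (simp add: t_def)
  have br_add: "br (x + y) z = br x z + br y z" "br z (x + y) = br z x + br z y"
    if "x \<in> V 0" "y \<in> V 0" "z \<in> V 0" for x y z
    using graded_hom_slot(1)[OF \<ll>2, of "[]" 0 x "[(0, z)]" x y]
      graded_hom_slot(1)[OF \<ll>2, of "[(0, z)]" 0 x "[]" x y] hom2 that by (simp_all add: br_def)
  have br_scale: "br (scale c x) y = scale c (br x y)" "br x (scale c y) = scale c (br x y)"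
    if "x \<in> V 0" "y \<in> V 0" for c x y
    using graded_hom_slot(2)[OF \<ll>2, of "[]" 0 x "[(0, y)]" x c]
      graded_hom_slot(2)[OF \<ll>2, of "[(0, x)]" 0 y "[]" y c] hom2 that by (simp_all add: br_def)
  have t_add: "t (x + y) = t x + t y" if "x \<in> V 0" "y \<in> V 0" for x y
    using graded_hom_slot(1)[OF T1, of "[]" 0 x "[]" x y] hom1 that by (simp add: t_def)
  have t_scale: "t (scale c x) = scale c (t x)" if "x \<in> V 0" for c x
    using graded_hom_slot(2)[OF T1, of "[]" 0 x "[]" x c] hom1 that by (simp add: t_def)
  have swap: "Transposition.transpose 0 1 permutes {..<2 :: nat}" by (auto intro: permutes_swap_id)
  have br_swap: "br x y = - br y x" if "x \<in> V 0" "y \<in> V 0" for x y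
  proof -
    have "chi_sign (Transposition.transpose 0 1) [0, 0] = (-1 :: 'k)"
      using koszul_sign_zeros[of "Transposition.transpose 0 1" "[0, 0]", where ?'k = 'k] swap
      by (simp add: chi_sign_def sign_swap_id numeral_2_eq_2)
    moreover have "\<ll> 2 [(0, x), (0, y)] = scale (chi_sign (Transposition.transpose 0 1) (map fst [(0, x), (0, y)]))
        (\<ll> 2 (permute_list (Transposition.transpose 0 1) [(0, x), (0, y)]))"
      using anti(1) hom2[OF that] swap unfolding antisymmetric_family_def by (meson one_le_numeral)
    ultimately show ?thesis by (simp add: br_def permute_list_lessThan_two)
  qed
  \<comment> \<open>Antisymmetry only gives \<open>2 [x, x] = 0\<close>; characteristic \<open>0\<close> is used here.\<close>
  have br_self: "br x x = 0" if "x \<in> V 0" for x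
  proof -
    have "scale 2 (br x x) = br x x + br x x" using scale_left_distrib[of 1 1 "br x x"] by simp
    also have "\<dots> = 0" using br_swap[OF that that] by (metis add.right_inverse)
    finally show ?thesis by simp
  qed
  have \<ll>_vanish: "\<ll> n xs = 0" if "1 \<le> n" "n \<noteq> 2" "\<forall>x\<in>set xs. fst x = 0" for n xs
    using graded_hom_vanishes[OF _ \<ll>[OF that(1)]] that concentrated by simp
  have T_vanish: "T n xs = 0" if "1 < n" "\<forall>x\<in>set xs. fst x = 0" for n xs
    using graded_hom_vanishes[OF _ T[of n]] that concentrated by simp
  have jacobi: "br x (br y z) + br y (br z x) + br z (br x y) = 0" if xyz: "x \<in> V 0" "y \<in> V 0" "z \<in> V 0" for x y z
  proof -
    let ?xs = "[(0 :: int, x), (0, y), (0, z)]"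
    let ?term = "\<lambda>i \<sigma>. scale (of_int (sign \<sigma>) * (-1) ^ (i * (3 - i)))
          (comp_perm scale (comp_tensor scale (\<ll> (3 - i + 1)) (hrb_l_factor \<ll> i # replicate (3 - i) id_factor)) \<sigma> ?xs)"
    \<comment> \<open>The inner map \<open>\<ll>\<^sub>1\<close> or \<open>\<ll>\<^sub>3\<close> puts a zero into the first slot of the outer one.\<close>
    have zero: "?term i \<sigma> = 0" if i: "i = 1 \<or> i = 3" and \<sigma>: "\<sigma> \<in> shuffles_of [i, 3 - i]" for i \<sigma>
    proof -
      have sp: "\<sigma> permutes {..<length ?xs}" using shuffles_of_permutes[OF \<sigma>] i by (auto simp: numeral_3_eq_3)
      then have d: "\<forall>x\<in>set (permute_list \<sigma> ?xs). fst x = 0" by simp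
      have "\<ll> i (take i (permute_list \<sigma> ?xs)) = 0"
        using i d by (intro \<ll>_vanish) (auto dest: in_set_takeD)
      moreover have "\<ll> (3 - i + 1) ((q, 0) # ys) = 0" for q ys
        using graded_hom_zero_slot[OF \<ll>[of "3 - i + 1"], of "[]"] by simp
      ultimately show ?thesis
        unfolding hrb_l_factor_def by (simp add: comp_perm_degree_zero[OF sp] comp_tensor_head del: permute_list_Nil)
    qed
    have two: "?term 2 \<sigma> = scale (of_int (sign \<sigma>))
        (br (br (snd (?xs ! \<sigma> 0)) (snd (?xs ! \<sigma> 1))) (snd (?xs ! \<sigma> 2)))" if \<sigma>: "\<sigma> \<in> shuffles_of [2, 1]" for \<sigma>
    proof -
      have sp: "\<sigma> permutes {..<length ?xs}" using shuffles_of_permutes[OF \<sigma>] by (simp add: numeral_3_eq_3)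
      have "fst (?xs ! \<sigma> i) = 0" if "i < 3" for i
      proof -
        have "\<sigma> i < length ?xs" using permutes_in_image[OF sp, of i] that by simp
        then show ?thesis by (metis (no_types, lifting) fst_conv nth_mem set_ConsD list.set(1) empty_iff)
      qed
      then have "?xs ! \<sigma> i = (0, snd (?xs ! \<sigma> i))" if "i < 3" for i
        using that by (simp add: prod_eq_iff)
      from this[of 0] this[of 1] this[of 2] obtain a b c where
        abc: "?xs ! \<sigma> 0 = (0, a)" "?xs ! \<sigma> 1 = (0, b)" "?xs ! \<sigma> 2 = (0, c)" by force
      have "comp_perm scale (comp_tensor scale (\<ll> (3 - 2 + 1)) (hrb_l_factor \<ll> 2 # replicate (3 - 2) id_factor)) \<sigma> ?xs
          = comp_tensor scale (\<ll> 2) ((2, 0, \<ll> 2) # replicate 1 id_factor) [(0, a), (0, b), (0, c)]"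
        unfolding hrb_l_factor_def by (subst comp_perm_degree_zero[OF sp]) (simp_all add: permute_list_lessThan_three abc abc(2)[unfolded One_nat_def] numeral_2_eq_2[symmetric])
      also have "\<dots> = br (br a b) c" by (subst comp_tensor_head) (simp add: br_def)
      finally show ?thesis by (simp add: abc abc(2)[unfolded One_nat_def])
    qed
    have "0 = hrb_jacobi scale \<ll> 3 ?xs" using jac[of 3 ?xs] xyz by (simp add: homogeneous_def)
    also have "\<dots> = (\<Sum>i\<in>{1, 2, 3}. \<Sum>\<sigma>\<in>shuffles_of [i, 3 - i]. ?term i \<sigma>)"
      unfolding hrb_jacobi_def by (rule sum.cong) auto
    also have "\<dots> = (\<Sum>\<sigma>\<in>shuffles_of [2, 1]. ?term 2 \<sigma>)"
    proof -
      have "(\<Sum>\<sigma>\<in>shuffles_of [i, 3 - i]. ?term i \<sigma>) = 0" if "i = 1 \<or> i = 3" for i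
        using zero[OF that] by (intro sum.neutral ballI)
      moreover have "(\<Sum>i\<in>{1, 2, 3}. f i) = f 1 + (f 2 + f 3)" for f :: "nat \<Rightarrow> 'v" by simp
      moreover have "(3 :: nat) - 2 = 1" by simp
      ultimately show ?thesis by (simp only: add_0_left add_0_right simp_thms)
    qed
    also have "\<dots> = (\<Sum>\<sigma>\<in>shuffles_of [2, 1]. scale (of_int (sign \<sigma>))
        (br (br (snd (?xs ! \<sigma> 0)) (snd (?xs ! \<sigma> 1))) (snd (?xs ! \<sigma> 2))))"
      by (rule sum.cong[OF refl two])
    also have "\<dots> = br (br x y) z - br (br x z) y + br (br y z) x"
    proof -
      let ?b = "Transposition.transpose 1 (2 :: nat)" and ?c = "Transposition.transpose 0 1 \<circ> Transposition.transpose 1 (2 :: nat)"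
      have s: "sign ?b = -1" "sign ?c = 1"
        by (simp_all add: sign_swap_id sign_compose permutation_swap_id del: o_apply)
      have ne: "id \<noteq> ?b" "id \<noteq> ?c" "?b \<noteq> ?c"
        by (auto dest: fun_cong[of _ _ 2] fun_cong[of _ _ 0] simp: Transposition.transpose_def)
      show ?thesis
        unfolding shuffles_two_one using ne s
        by (simp add: Transposition.transpose_def)
    qed
    finally have "br (br x y) z - br (br x z) y + br (br y z) x = 0" by simp
    moreover have "br x (br y z) = - br (br y z) x" "br z (br x y) = - br (br x y) z" "br y (br z x) = - br (br z x) y"
      "br (br z x) y = - br (br x z) y"
    proof -
      show "br x (br y z) = - br (br y z) x" "br z (br x y) = - br (br x y) z" "br y (br z x) = - br (br z x) y"
        using xyz by (auto intro!: br_swap br_closed)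
      show "br (br z x) y = - br (br x z) y"
        using br_swap[of z x] br_scale(1)[of "br x z" y "-1"] xyz br_closed by simp
    qed
    ultimately show ?thesis by (simp add: algebra_simps)
  qed
  have rota: "br (t x) (t y) = t (br x (t y) + br (t x) y + scale lam (br x y))" if xy: "x \<in> V 0" "y \<in> V 0" for x y
  proof -
    let ?xs = "[(0 :: int, x), (0, y)]"
    have perm0: "\<sigma> permutes {..<length ?xs}" if "\<sigma> permutes {..<2}" for \<sigma> using that by (simp add: numeral_2_eq_2)
    have deg0: "\<forall>x\<in>set ?xs. fst x = 0" by simp
    have l1: "\<ll> 1 ((q, 0) # ys) = 0" for q ys
      using graded_hom_zero_slot[OF \<ll>[of 1], of "[]"] by simp
    have t2: "T 2 ((q, 0) # ys) = 0" for q ys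
      using graded_hom_zero_slot[OF T[of 2], of "[]"] by simp
    have "hrb_lhs scale \<ll> T 2 ?xs = br (t x) (t y)"
    proof -
      have "comp_perm scale (comp_tensor scale (\<ll> 1) (map (hrb_T_factor T) [2])) \<sigma> ?xs = 0" if "\<sigma> \<in> ordered_shuffles 1 [2]" for \<sigma>
      proof -
        have sp: "\<sigma> permutes {..<length ?xs}" using ordered_shuffles_permutes[OF that] by (intro perm0) simp
        have "comp_tensor scale (\<ll> 1) ((2, 1, T 2) # replicate 0 id_factor) (permute_list \<sigma> ?xs) = 0"
          using T_vanish[of 2 "permute_list \<sigma> ?xs"] sp by (subst comp_tensor_head) (simp add: l1[unfolded One_nat_def])
        then show ?thesis by (simp add: comp_perm_degree_zero[OF sp deg0] hrb_T_factor_def)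
      qed
      moreover have "comp_perm scale (comp_tensor scale (\<ll> 2) (map (hrb_T_factor T) [1, 1])) id ?xs = br (t x) (t y)"
        by (subst comp_perm_degree_zero) (auto simp: permutes_id comp_tensor_def hrb_T_factor_def br_def t_def)
      moreover have "{1..2} = {1, 2 :: nat}" by auto
      ultimately show ?thesis
        by (simp add: hrb_lhs_def compositions_one[simplified] compositions_two_two[simplified]
            ordered_shuffles_one_one[simplified] hrb_delta_def)
    qed
    moreover have "hrb_rhs scale lam \<ll> T 2 ?xs = scale lam (t (br x y)) + (t (br (t x) y) - t (br (t y) x))"
    proof -
      let ?inner = "\<lambda>p q rs. (sum_list (tl rs) + (p - q + 1), int p - 2 + (\<Sum>r \<leftarrow> tl rs. int r - 1),
           comp_tensor scale (\<ll> p) (map (hrb_T_factor T) (tl rs) @ replicate (p - q + 1) id_factor))"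
      let ?S = "\<lambda>p q rs. \<Sum>\<sigma>\<in>ordered_shuffles (q - 1) (tl rs @ [p - q + 1, hd rs - 1]).
          scale (lam ^ (p - q) * (-1) ^ hrb_eta p q rs * of_int (sign \<sigma>))
           (comp_perm scale (comp_tensor scale (T (hd rs)) (?inner p q rs # replicate (hd rs - 1) id_factor)) \<sigma> ?xs)"
      have "hrb_rhs scale lam \<ll> T 2 ?xs = (\<Sum>p = 1..2. \<Sum>q = 1..p. \<Sum>rs\<in>compositions q (2 - (p - q)). ?S p q rs)"
        unfolding hrb_rhs_def Let_def ..
      also have "\<dots> = ?S 1 1 [2] + (?S 2 1 [1] + ?S 2 2 [1, 1])"
      proof -
        have "{1..2} = {1, 2 :: nat}" by auto
        moreover have "compositions 1 2 = {[2]}" "compositions 1 1 = {[1]}" using compositions_one by auto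
        ultimately show ?thesis using compositions_two_two by (simp del: One_nat_def add: One_nat_def[symmetric])
      qed
      also have "?S 1 1 [2] = 0"
      proof (rule sum.neutral, rule ballI)
        fix \<sigma> assume "\<sigma> \<in> ordered_shuffles (1 - 1) (tl [2] @ [1 - 1 + 1, hd [2] - 1])"
        then have sp: "\<sigma> permutes {..<length ?xs}"
          by (intro perm0) (auto dest!: ordered_shuffles_permutes simp: numeral_2_eq_2)
        have "\<ll> 1 (take 1 (permute_list \<sigma> ?xs)) = 0"
          using sp by (intro \<ll>_vanish) (auto dest!: in_set_takeD)
        then have "comp_tensor scale (\<ll> 1) (replicate 1 id_factor) (take 1 (permute_list \<sigma> ?xs)) = 0"
          by (subst comp_tensor_id_factors) simp_all
        then have "comp_tensor scale (T 2) ((1, -1, comp_tensor scale (\<ll> 1) (replicate 1 id_factor)) # replicate 1 id_factor)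
            (permute_list \<sigma> ?xs) = 0"
          by (subst comp_tensor_head) (simp add: t2)
        then show "scale (lam ^ (1 - 1) * (-1) ^ hrb_eta 1 1 [2] * of_int (sign \<sigma>))
           (comp_perm scale (comp_tensor scale (T (hd [2])) (?inner 1 1 [2] # replicate (hd [2] - 1) id_factor)) \<sigma> ?xs) = 0"
          by (simp add: comp_perm_degree_zero[OF sp deg0])
      qed
      \<comment> \<open>The term of weight \<open>\<lambda>\<close> has no inner operator.\<close>
      also have "?S 2 1 [1] = scale lam (t (br x y))"
      proof -
        have "ordered_shuffles (1 - 1) (tl [1] @ [2 - 1 + 1, hd [1] - 1]) = {id}"
          using shuffles_two_zero by (simp add: ordered_shuffles_def numeral_2_eq_2)
        then show ?thesis
          by (simp add: comp_perm_degree_zero[OF perm0[OF permutes_id] deg0] comp_tensor_head hrb_eta_def)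
            (simp add: comp_tensor_def id_factor_def t_def br_def)
      qed
      \<comment> \<open>The two orders of the arguments of the inner bracket, of which only the first carries the operator.\<close>
      also have "?S 2 2 [1, 1] = t (br (t x) y) - t (br (t y) x)"
      proof -
        have "ordered_shuffles (2 - 1) (tl [1, 1] @ [2 - 2 + 1, hd [1, 1] - 1]) = {id, Transposition.transpose 0 1}"
          using ordered_shuffles_append_zero[of 1 "[1, 1]"] shuffles_one_one by simp
        moreover have "id \<noteq> Transposition.transpose 0 (1 :: nat)"
          by (auto dest: fun_cong[of _ _ 0])
        moreover have "comp_tensor scale (T 1) [?inner 2 2 [1, 1]] [(0, a), (0, b)] = t (br (t a) b)" for a b
          by (simp add: comp_tensor_def hrb_T_factor_def id_factor_def t_def br_def numeral_2_eq_2)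
        ultimately show ?thesis
          by (simp add: comp_perm_degree_zero[OF perm0[OF permutes_id] deg0] comp_perm_degree_zero[OF perm0[OF swap] deg0]
              permute_list_lessThan_two hrb_eta_def sign_swap_id del: One_nat_def)
      qed
      finally show ?thesis by simp
    qed
    moreover have "hrb_lhs scale \<ll> T 2 ?xs = hrb_rhs scale lam \<ll> T 2 ?xs"
      using rb[of 2 ?xs] hom2[OF xy] by simp
    moreover have "t (br x (t y)) = - t (br (t y) x)"
      using br_swap[of x "t y"] t_scale[of "br (t y) x" "-1"] xy t_closed br_closed by simp
    moreover have "t (br x (t y) + br (t x) y + scale lam (br x y)) =
        t (br x (t y)) + t (br (t x) y) + scale lam (t (br x y))"
      using xy by (simp add: t_add t_scale br_closed t_closed component_closed)
    ultimately show ?thesis by (simp add: algebra_simps)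
  qed
  have "Rota_Baxter_Lie_algebra_on scale lam (V 0) br t"
    unfolding Rota_Baxter_Lie_algebra_on_def Lie_algebra_on_def
    using vector_space_axioms subspace_component br_closed br_add br_scale br_self jacobi t_closed t_add t_scale rota
    by simp
  then show ?thesis unfolding br_def[abs_def] t_def[abs_def] .
qed

end

theorem proposition3p3:
  fixes scale :: "'k::field_char_0 \<Rightarrow> 'v::ab_group_add \<Rightarrow> 'v"
    and V :: "int \<Rightarrow> 'v set"
    and lam :: 'k
  assumes "graded_vector_space scale V"
  shows "bij_betw (induced_structure scale) (C_RBL_maurer_cartan scale V lam)
      (homotopy_Rota_Baxter_structures scale V lam) \<and>
    ((\<forall>p. p \<noteq> 0 \<longrightarrow> V p = {0}) \<longrightarrow>
      (\<forall>\<alpha> \<in> C_RBL_maurer_cartan scale V lam. \<forall>\<ll> T. induced_structure scale \<alpha> = (\<ll>, T) \<longrightarrow>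
         Rota_Baxter_Lie_algebra_on scale lam (V 0)
           (\<lambda>x y. \<ll> 2 [(0, x), (0, y)]) (\<lambda>x. T 1 [(0, x)])))"
proof (intro conjI impI ballI allI)
  interpret graded_vector_space scale V by (rule assms)
  show bij: "bij_betw (induced_structure scale) (C_RBL_maurer_cartan scale V lam)
      (homotopy_Rota_Baxter_structures scale V lam)"
    by (rule bij_betw_maurer_cartan)
  fix \<alpha> \<ll> T
  assume concentrated: "\<forall>p. p \<noteq> 0 \<longrightarrow> V p = {0}"
  assume "\<alpha> \<in> C_RBL_maurer_cartan scale V lam" "induced_structure scale \<alpha> = (\<ll>, T)"
  then have "(\<ll>, T) \<in> homotopy_Rota_Baxter_structures scale V lam"
    using bij by (metis bij_betw_apply)
  then show "Rota_Baxter_Lie_algebra_on scale lam (V 0) (\<lambda>x y. \<ll> 2 [(0, x), (0, y)]) (\<lambda>x. T 1 [(0, x)])"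
    using concentrated by (intro homotopy_Rota_Baxter_degree_zero) auto
qed

end
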